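(* Let $n\ge 2$, let $D$ be a domain in $\mathbb{R}^n$, let $p\ge 1$, and let $f:D\to\mathbb{R}^n$ be a (continuous) discrete mapping which is differentiable almost everywhere in $D$ and has the $N$-property, the $N^{-1}$-property and the $ACP_p^{-1}$-property. Suppose that $\Gamma$ is a family of curves in $D$, that $m$ is a positive integer, and that $f$ winds every path of $\Gamma$ $m$ times around itself. Then $$M_p(f(\Gamma))\ \le\ \frac{1}{m}\int_{D}K_{I,p}(x,f)\cdot\rho^p(x)\,dm(x)$$ for every $\rho\in\mathrm{adm}\,\Gamma$.
   Context: Measures. In $dm(x)$ and $m(S)$, the symbol $m$ denotes Lebesgue measure in $\mathbb{R}^n$; elsewhere $m$ is the positive integer of the statement. "Almost everywhere" refers to Lebesgue measure. Every mapping $f:D\to\mathbb{R}^n$ is assumed continuous. Mappings. $f$ is discrete if for every $y\in\mathbb{R}^n$ the preimage $f^{-1}(y)$ consists of isolated points. $f$ has the $N$-property if $m(f(S))=0$ whenever $S\subset D$ and $m(S)=0$. $f$ has the $N^{-1}$-property if $m(f^{-1}(S))=0$ whenever $S\subset\mathbb{R}^n$ and $m(S)=0$. Dilatation. Let $J(x,f)=\det f'(x)$ and $l(f'(x))=\inf\{|f'(x)h| : h\in\mathbb{R}^n,\ |h|=1\}$. The inner dilatation of order $p$ of $f$ at $x$ is $K_{I,p}(x,f)=|J(x,f)|/l(f'(x))^p$ if $J(x,f)\neq 0$; $K_{I,p}(x,f)=1$ if $f'(x)=0$; and $K_{I,p}(x,f)=\infty$ otherwise. Curves and modulus. A curve (path)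 in $\mathbb{R}^n$ is a continuous mapping $\gamma:\Delta\to\mathbb{R}^n$ of an interval $\Delta\subset\mathbb{R}$; it is a curve in $D$ if its image lies in $D$. A "closed curve" is one defined on a closed interval $[a,b]$ (its endpoints need not coincide). For a family $\Gamma$ of curves, $f(\Gamma)=\{f\circ\gamma:\gamma\in\Gamma\}$. A Borel function $\rho:\mathbb{R}^n\to[0,\infty]$ is admissible for $\Gamma$, written $\rho\in\mathrm{adm}\,\Gamma$, if $\int_\gamma\rho(x)\,|dx|\ge 1$ for each locally rectifiable $\gamma\in\Gamma$. The $p$-modulus is $M_p(\Gamma)=\inf_{\rho\in\mathrm{adm}\,\Gamma}\int_{\mathbb{R}^n}\rho^p(x)\,dm(x)$, interpreted as $+\infty$ if $\mathrm{adm}\,\Gamma=\varnothing$. A property holds for $p$-almost every ($p$-a.e.) curve of a family if the subfamily of curves for which it fails has $p$-modulus zero. Normal representation. For a rectifiable curve $\beta:[a,b]\to\mathbb{R}^n$, let $l_\beta(t)$ be the length of $\beta|_{[a,t]}$ and $l(\beta)$ the length of $\beta$. The normal representation of $\beta$ is the curve $\beta^0:[0,l(\beta)]\to\mathbb{R}^n$ with $\beta(t)=\beta^0(l_\beta(t))$ for all $t\in[a,b]$. $f$-representation. Suppose $f^{-1}(y)$ contains no nondegenerate curve for any $y\in\mathbb{R}^n$ (this holds for discrete $f$). Let $\alpha:[a,b]\to D$ be a curve such that $\beta=f\circ\alpha$ is rectifiable. Then $\alpha$ is constant on every interval on which $l_\beta$ is constant, so there is a unique function $\alpha^*:[0,l(\beta)]\to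 D$ with $\alpha=\alpha^*\circ l_\beta$; it is called the $f$-representation of $\alpha$ with respect to $\beta$. $ACP_p^{-1}$. A curve $\gamma$ in $D$ is a lifting of a curve $\widetilde\gamma$ in $\mathbb{R}^n$ under $f$ if $\widetilde\gamma=f\circ\gamma$. The mapping $f$ has the $ACP_p^{-1}$-property (is absolutely continuous on curves in the inverse direction) if for $p$-a.e. closed curve $\widetilde\gamma$, each lifting $\gamma$ of $\widetilde\gamma$ is rectifiable and the corresponding $f$-representation $\gamma^*$ of $\gamma$ (with respect to $\widetilde\gamma$) is absolutely continuous. Winding. For a closed curve $\alpha:[a,b]\to D$, $f$ winds $\alpha$ $m$ times around itself if $\beta=f\circ\alpha$ is rectifiable and the following holds: let $c=l(\beta)$, let $\beta^0:[0,c]\to\mathbb{R}^n$ be the normal representation of $\beta$, let $\alpha^*:[0,c]\to D$ be the $f$-representation of $\alpha$ with respect to $\beta$, and let $h=c/m$; then $\beta^0(t+jh)=\beta^0(t)$ and $\alpha^*(t+jh)\neq\alpha^*(t)$ whenever $0\le t<t+jh<c$ and $j\in\{1,\dots,m-1\}$. In particular, every curve of $\Gamma$ in the statement is a closed curve. *)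

theory Defs
  imports "HOL-Analysis.Analysis"
begin

section \<open>Mappings\<close>

text \<open>A mapping defined on \<open>D\<close> is a total function of which only the values on \<open>D\<close> are used;
  preimages are therefore taken within \<open>D\<close>.\<close>

definition discrete_map :: "'a::topological_space set \<Rightarrow> ('a \<Rightarrow> 'b) \<Rightarrow> bool" where
  "discrete_map D f \<longleftrightarrow> (\<forall>y. discrete {x \<in> D. f x = y})"

definition N_property :: "'a::euclidean_space set \<Rightarrow> ('a \<Rightarrow> 'b::euclidean_space) \<Rightarrow> bool" where
  "N_property D f \<longleftrightarrow>
    (\<forall>S. S \<subseteq> D \<longrightarrow> S \<in> null_sets lebesgue \<longrightarrow> f ` S \<in> null_sets lebesgue)"

definition N_inv_property :: "'a::euclidean_space set \<Rightarrow> ('a \<Rightarrow> 'b::euclidean_space) \<Rightarrow> bool" where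
  "N_inv_property D f \<longleftrightarrow>
    (\<forall>S. S \<in> null_sets lebesgue \<longrightarrow> {x \<in> D. f x \<in> S} \<in> null_sets lebesgue)"


section \<open>Dilatation\<close>

definition jacobian_det :: "(real^'n \<Rightarrow> real^'n) \<Rightarrow> real^'n \<Rightarrow> real" where
  "jacobian_det f x = det (matrix (frechet_derivative f (at x)))"

definition min_stretch :: "('a::real_normed_vector \<Rightarrow> 'b::real_normed_vector) \<Rightarrow> real" where
  "min_stretch A = Inf {norm (A h) | h. norm h = 1}"

text \<open>Meaningful only where \<open>f\<close> is differentiable; the other points form a null set in the
  theorem and do not influence the integral.\<close>

definition inner_dilatation :: "real \<Rightarrow> (real^'n \<Rightarrow> real^'n) \<Rightarrow> real^'n \<Rightarrow> ennreal" where
  "inner_dilatation p f x =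
    (if jacobian_det f x \<noteq> 0
     then ennreal (\<bar>jacobian_det f x\<bar> / min_stretch (frechet_derivative f (at x)) powr p)
     else if frechet_derivative f (at x) = (\<lambda>h. 0) then 1
     else \<infinity>)"


section \<open>Curves\<close>

text \<open>A curve is a pair of its parameter interval and a function, whose values outside the
  interval are irrelevant.\<close>

type_synonym 'a curve = "real set \<times> (real \<Rightarrow> 'a)"

definition curve_in :: "'a::topological_space set \<Rightarrow> 'a curve \<Rightarrow> bool" where
  "curve_in D = (\<lambda>(\<Delta>, \<gamma>). is_interval \<Delta> \<and> \<Delta> \<noteq> {} \<and> continuous_on \<Delta> \<gamma> \<and> \<gamma> ` \<Delta> \<subseteq> D)"

text \<open>``Closed'' means: defined on a closed bounded interval. The endpoints need not coincide.\<close>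

definition closed_curve_in :: "'a::topological_space set \<Rightarrow> 'a curve \<Rightarrow> bool" where
  "closed_curve_in D = (\<lambda>(\<Delta>, \<gamma>). curve_in D (\<Delta>, \<gamma>) \<and> (\<exists>a b. a \<le> b \<and> \<Delta> = {a..b}))"

definition image_family :: "('a \<Rightarrow> 'b) \<Rightarrow> 'a curve set \<Rightarrow> 'b curve set" where
  "image_family f \<Gamma> = (\<lambda>(\<Delta>, \<gamma>). (\<Delta>, f \<circ> \<gamma>)) ` \<Gamma>"

definition curve_length :: "real set \<Rightarrow> (real \<Rightarrow> 'a::metric_space) \<Rightarrow> ennreal" where
  "curve_length S \<gamma> =
    (SUP (N, t) \<in> {(N, t). mono_on {..N::nat} t \<and> t ` {..N} \<subseteq> S}.
      \<Sum>i<N. ennreal (dist (\<gamma> (t i)) (\<gamma> (t (Suc i)))))"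

definition rectifiable :: "real set \<Rightarrow> (real \<Rightarrow> 'a::metric_space) \<Rightarrow> bool" where
  "rectifiable \<Delta> \<gamma> \<longleftrightarrow> curve_length \<Delta> \<gamma> < \<infinity>"

definition locally_rectifiable :: "real set \<Rightarrow> (real \<Rightarrow> 'a::metric_space) \<Rightarrow> bool" where
  "locally_rectifiable \<Delta> \<gamma> \<longleftrightarrow> (\<forall>a b. a \<le> b \<longrightarrow> {a..b} \<subseteq> \<Delta> \<longrightarrow> rectifiable {a..b} \<gamma>)"

text \<open>The function \<open>l\<^sub>\<gamma>\<close>. On an interval \<open>{a..b}\<close> this is the length of \<open>\<gamma>\<close> restricted to \<open>{a..t}\<close>.\<close>

definition length_fun :: "real set \<Rightarrow> (real \<Rightarrow> 'a::metric_space) \<Rightarrow> real \<Rightarrow> real" where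
  "length_fun \<Delta> \<gamma> t = enn2real (curve_length (\<Delta> \<inter> {..t}) \<gamma>)"

text \<open>For a rectifiable curve \<open>\<beta>\<close> on \<open>\<Delta> = {a..b}\<close> of length \<open>c\<close>, the function \<open>l\<^sub>\<beta>\<close> maps \<open>\<Delta>\<close>
  onto \<open>{0..c}\<close>. The two representations below exist and are uniquely determined on \<open>{0..c}\<close>
  (the second one if the fibres of \<open>f\<close> contain no nondegenerate curve), so the choice operator
  only fixes irrelevant values outside \<open>{0..c}\<close>.\<close>

definition normal_rep :: "real set \<Rightarrow> (real \<Rightarrow> 'a::metric_space) \<Rightarrow> real \<Rightarrow> 'a" where
  "normal_rep \<Delta> \<beta> = (SOME \<beta>0. \<forall>t\<in>\<Delta>. \<beta> t = \<beta>0 (length_fun \<Delta> \<beta> t))"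

definition f_rep :: "('a \<Rightarrow> 'b::metric_space) \<Rightarrow> real set \<Rightarrow> (real \<Rightarrow> 'a) \<Rightarrow> real \<Rightarrow> 'a" where
  "f_rep f \<Delta> \<alpha> = (SOME \<alpha>'. \<forall>t\<in>\<Delta>. \<alpha> t = \<alpha>' (length_fun \<Delta> (f \<circ> \<alpha>) t))"

definition abs_continuous_on :: "real set \<Rightarrow> (real \<Rightarrow> 'a::metric_space) \<Rightarrow> bool" where
  "abs_continuous_on S g \<longleftrightarrow>
    (\<forall>\<epsilon>>0. \<exists>\<delta>>0. \<forall>(N::nat) u v.
      (\<forall>i<N. u i \<le> v i \<and> {u i..v i} \<subseteq> S) \<longrightarrow>
      disjoint_family_on (\<lambda>i. {u i<..<v i}) {..<N} \<longrightarrow>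
      (\<Sum>i<N. v i - u i) < \<delta> \<longrightarrow>
      (\<Sum>i<N. dist (g (u i)) (g (v i))) < \<epsilon>)"


section \<open>Modulus\<close>

text \<open>The power with positive real exponent, extended by \<open>\<infinity>\<^sup>p = \<infinity>\<close>.\<close>

definition ennpowr :: "ennreal \<Rightarrow> real \<Rightarrow> ennreal" where
  "ennpowr x p = (if x = \<infinity> then \<infinity> else ennreal (enn2real x powr p))"

text \<open>For a locally rectifiable curve the integral with respect to arc length is the supremum of
  the integrals over its closed subcurves, which are computed by means of the normal
  representation.\<close>

definition curve_integral ::
    "real set \<Rightarrow> (real \<Rightarrow> 'a::metric_space) \<Rightarrow> ('a \<Rightarrow> ennreal) \<Rightarrow> ennreal" where
  "curve_integral \<Delta> \<gamma> \<rho> =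
    (SUP (a, b) \<in> {(a, b). a \<le> b \<and> {a..b} \<subseteq> \<Delta>}.
      \<integral>\<^sup>+ s \<in> {0..enn2real (curve_length {a..b} \<gamma>)}. \<rho> (normal_rep {a..b} \<gamma> s) \<partial>lborel)"

definition adm :: "'a::metric_space curve set \<Rightarrow> ('a \<Rightarrow> ennreal) set" where
  "adm \<Gamma> = {\<rho> \<in> borel_measurable borel.
    \<forall>(\<Delta>, \<gamma>) \<in> \<Gamma>. locally_rectifiable \<Delta> \<gamma> \<longrightarrow> curve_integral \<Delta> \<gamma> \<rho> \<ge> 1}"

definition modulus :: "real \<Rightarrow> 'a::euclidean_space curve set \<Rightarrow> ennreal" where
  "modulus p \<Gamma> = (INF \<rho> \<in> adm \<Gamma>. \<integral>\<^sup>+ x. ennpowr (\<rho> x) p \<partial>lebesgue)"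

definition ae_curve ::
    "real \<Rightarrow> 'a::euclidean_space curve set \<Rightarrow> ('a curve \<Rightarrow> bool) \<Rightarrow> bool" where
  "ae_curve p \<Gamma> P \<longleftrightarrow> modulus p {\<gamma> \<in> \<Gamma>. \<not> P \<gamma>} = 0"


section \<open>Absolute continuity in the inverse direction and winding\<close>

definition lifting ::
    "'a::topological_space set \<Rightarrow> ('a \<Rightarrow> 'b) \<Rightarrow> real set \<Rightarrow> (real \<Rightarrow> 'b) \<Rightarrow> (real \<Rightarrow> 'a) \<Rightarrow> bool" where
  "lifting D f \<Delta> \<beta> \<alpha> \<longleftrightarrow> curve_in D (\<Delta>, \<alpha>) \<and> (\<forall>t\<in>\<Delta>. \<beta> t = f (\<alpha> t))"

text \<open>The curves \<open>\<beta>\<close> that are not rectifiable, for which no \<open>f\<close>-representation is available, do not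
  affect the modulus of the exceptional family.\<close>

definition ACP_inv ::
    "real \<Rightarrow> 'a::euclidean_space set \<Rightarrow> ('a \<Rightarrow> 'b::euclidean_space) \<Rightarrow> bool" where
  "ACP_inv p D f \<longleftrightarrow>
    ae_curve p {\<beta>. closed_curve_in UNIV \<beta>}
      (\<lambda>(\<Delta>, \<beta>). \<forall>\<alpha>. lifting D f \<Delta> \<beta> \<alpha> \<longrightarrow>
        rectifiable \<Delta> \<alpha> \<and>
        abs_continuous_on {0..enn2real (curve_length \<Delta> \<beta>)} (f_rep f \<Delta> \<alpha>))"

definition winds :: "('a \<Rightarrow> 'b::metric_space) \<Rightarrow> nat \<Rightarrow> real set \<Rightarrow> (real \<Rightarrow> 'a) \<Rightarrow> bool" where
  "winds f m \<Delta> \<alpha> \<longleftrightarrow>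
    rectifiable \<Delta> (f \<circ> \<alpha>) \<and>
    (let c = enn2real (curve_length \<Delta> (f \<circ> \<alpha>)); h = c / real m in
      \<forall>t. \<forall>j\<in>{1..m-1}. 0 \<le> t \<and> t < t + real j * h \<and> t + real j * h < c \<longrightarrow>
        normal_rep \<Delta> (f \<circ> \<alpha>) (t + real j * h) = normal_rep \<Delta> (f \<circ> \<alpha>) t \<and>
        f_rep f \<Delta> \<alpha> (t + real j * h) \<noteq> f_rep f \<Delta> \<alpha> t)"

end

theory Submission
  imports Defs
begin

text \<open>Up to a set whose image is null, \<open>D\<close> is a disjoint union of Borel pieces \<open>G k\<close> on which
  \<open>f\<close> is injective and differentiable with nonzero Jacobian: the nondifferentiability set is mapped
  to a null set by the \<open>N\<close>-property, the critical set by Sard's argument. Let \<open>E\<close> be a Borel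
  null set containing the image of the exceptional set, and put
  \<open>\<rho>' y = (1/m \<Sum> (\<rho> x / l (f' x))\<^sup>p)\<^bsup>1/p\<^esup>\<close>, summed over the points \<open>x\<close> of the fibre of
  \<open>y\<close> that lie in the pieces, and \<open>\<rho>' = \<infinity>\<close> on \<open>E\<close>. The change of variables formula on each piece
  bounds \<open>\<integral> \<rho>'\<^sup>p\<close> by the right-hand side.

  For admissibility consider a curve \<open>\<alpha>\<close> with absolutely continuous \<open>f\<close>-representation \<open>\<alpha>\<^sup>*\<close> on
  \<open>[0, c]\<close>. Since \<open>f \<circ> \<alpha>\<^sup>*\<close> is parametrized by arc length, \<open>\<alpha>\<^sup>*\<close> is Lipschitz at almost every \<open>t\<close>
  with any constant above \<open>1 / l (f' (\<alpha>\<^sup>* t))\<close>, so the integral of \<open>\<rho>\<close> over \<open>\<alpha>\<close> is at most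
  \<open>\<integral> \<rho> (\<alpha>\<^sup>* t) / l (f' (\<alpha>\<^sup>* t)) dt\<close>. Winding folds this integral onto \<open>[0, c/m]\<close>, where the \<open>m\<close>
  values \<open>\<alpha>\<^sup>* (t + j c/m)\<close> are distinct points of one fibre, and the power mean inequality bounds
  their sum by \<open>m \<rho>'\<close>. Curves violating the \<open>ACP\<close> condition are
  absorbed by adding to \<open>\<rho>'\<^sup>p\<close> the \<open>p\<close>-th power of a function of small \<open>p\<close>-norm admissible for them.\<close>

section \<open>Length of curves\<close>

text \<open>Line integrals are formed in the arc length of \<open>\<alpha>\<close>, while the
  hypotheses control \<open>\<alpha>\<^sup>*\<close> in the arc length of
  \<open>f \<circ> \<alpha>\<close>. Instead of differentiating \<open>\<alpha>\<^sup>*\<close>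
  almost everywhere, the proof compares measures: Vitali coverings show that Lebesgue measure in the
  second parameter, pushed forward to the first, dominates the measure whose density is
  \<open>l (f' x)\<close> along the curve. Absolute continuity keeps exceptional null sets null
  under this passage. The infinite value on \<open>E\<close> is what permits neglecting
  \<open>E\<close>: an image curve with positive length in \<open>E\<close> has infinite integral,
  and for any other curve the bad parameters form a null set. Indexing the pieces names each
  relevant point of a fibre by its piece, so the fibre sum is a series of Borel functions. Since
  admissible functions are Borel, derivative data that are only Lebesgue measurable are replaced by
  Borel functions, and the points of disagreement join the exceptional set.\<close>

lemma curve_length_mono:
  "S \<subseteq> T \<Longrightarrow> curve_length S \<gamma> \<le> curve_length T \<gamma>"
  unfolding curve_length_def by (rule SUP_subset_mono) auto

lemma chord_sum_le_curve_length:
  assumes "mono_on {..N} t" "t ` {..N} \<subseteq> S"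
  shows "(\<Sum>i<N. ennreal (dist (\<gamma> (t i)) (\<gamma> (t (Suc i))))) \<le> curve_length S \<gamma>"
  unfolding curve_length_def using assms
  by (intro SUP_upper2[where i="(N, t)"]) auto

lemma curve_length_leI:
  assumes "\<And>N t. mono_on {..N} t \<Longrightarrow> t ` {..N} \<subseteq> S \<Longrightarrow>
    (\<Sum>i<N. ennreal (dist (\<gamma> (t i)) (\<gamma> (t (Suc i))))) \<le> B"
  shows "curve_length S \<gamma> \<le> B"
  unfolding curve_length_def using assms by (auto intro!: SUP_least)

lemma dist_le_curve_length:
  assumes "u \<in> S" "v \<in> S" "u \<le> v"
  shows "ennreal (dist (\<gamma> u) (\<gamma> v)) \<le> curve_length S \<gamma>"
proof -
  let ?t = "\<lambda>i::nat. if i = 0 then u else v"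
  have "(\<Sum>i<1. ennreal (dist (\<gamma> (?t i)) (\<gamma> (?t (Suc i))))) \<le> curve_length S \<gamma>"
    using assms by (intro chord_sum_le_curve_length) (auto simp: mono_on_def)
  then show ?thesis by simp
qed

lemma curve_length_singleton [simp]: "curve_length {a} \<gamma> = 0"
proof -
  have "curve_length {a} \<gamma> \<le> 0"
  proof (rule curve_length_leI)
    fix N t assume "mono_on {..N::nat} t" and *: "t ` {..N} \<subseteq> {a}"
    have "t i = a" if "i \<le> N" for i using * that by auto
    then show "(\<Sum>i<N. ennreal (dist (\<gamma> (t i)) (\<gamma> (t (Suc i))))) \<le> 0" by simp
  qed
  then show ?thesis by simp
qed

lemma SUP_add_SUP_le:
  fixes f :: "'a \<Rightarrow> ennreal"
  assumes "A \<noteq> {}" "B \<noteq> {}" "\<And>x y. x \<in> A \<Longrightarrow> y \<in> B \<Longrightarrow> f x + g y \<le> c"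
  shows "(SUP x\<in>A. f x) + (SUP y\<in>B. g y) \<le> c"
proof -
  have "f x + (SUP y\<in>B. g y) \<le> c" if "x \<in> A" for x
    using assms that by (subst ennreal_SUP_add_right) (auto intro: SUP_least)
  then show ?thesis using assms(1) by (subst ennreal_SUP_add_left[symmetric]) (auto intro: SUP_least)
qed

text \<open>Clamping a partition at \<open>b\<close> from either side gives partitions of the two
  pieces, and the triangle inequality splits the chord across \<open>b\<close>. Conversely,
  partitions of the pieces concatenate.\<close>

lemma curve_length_Icc_additive:
  assumes "a \<le> b" "b \<le> c"
  shows "curve_length {a..c} \<gamma> = curve_length {a..b} \<gamma> + curve_length {b..c} \<gamma>"
proof (rule antisym)
  show "curve_length {a..c} \<gamma> \<le> curve_length {a..b} \<gamma> + curve_length {b..c} \<gamma>"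
  proof (rule curve_length_leI)
    fix N t assume t: "mono_on {..N::nat} t" "t ` {..N} \<subseteq> {a..c}"
    have 1: "(\<Sum>i<N. ennreal (dist (\<gamma> (min b (t i))) (\<gamma> (min b (t (Suc i)))))) \<le> curve_length {a..b} \<gamma>"
      using t assms by (intro chord_sum_le_curve_length) (auto simp: mono_on_def min.coboundedI2)
    have 2: "(\<Sum>i<N. ennreal (dist (\<gamma> (max b (t i))) (\<gamma> (max b (t (Suc i)))))) \<le> curve_length {b..c} \<gamma>"
      using t assms by (intro chord_sum_le_curve_length) (auto simp: mono_on_def max.coboundedI2)
    have "ennreal (dist (\<gamma> (t i)) (\<gamma> (t (Suc i)))) \<le>
        ennreal (dist (\<gamma> (min b (t i))) (\<gamma> (min b (t (Suc i))))) +
        ennreal (dist (\<gamma> (max b (t i))) (\<gamma> (max b (t (Suc i)))))" if "i < N" for i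
    proof -
      have "t i \<le> t (Suc i)" using t(1) that by (auto simp: mono_on_def)
      then show ?thesis
        by (auto simp: min_def max_def dist_triangle simp flip: ennreal_plus intro!: ennreal_leI)
    qed
    then have "(\<Sum>i<N. ennreal (dist (\<gamma> (t i)) (\<gamma> (t (Suc i))))) \<le>
      (\<Sum>i<N. ennreal (dist (\<gamma> (min b (t i))) (\<gamma> (min b (t (Suc i))))) +
        ennreal (dist (\<gamma> (max b (t i))) (\<gamma> (max b (t (Suc i))))))"
      by (intro sum_mono) auto
    also have "\<dots> \<le> curve_length {a..b} \<gamma> + curve_length {b..c} \<gamma>"
      unfolding sum.distrib by (intro add_mono 1 2)
    finally show "(\<Sum>i<N. ennreal (dist (\<gamma> (t i)) (\<gamma> (t (Suc i))))) \<le>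
      curve_length {a..b} \<gamma> + curve_length {b..c} \<gamma>" .
  qed
next
  let ?A = "{(N, t). mono_on {..N::nat} t \<and> t ` {..N} \<subseteq> {a..b}}"
  let ?B = "{(N, t). mono_on {..N::nat} t \<and> t ` {..N} \<subseteq> {b..c}}"
  let ?s = "\<lambda>(N, t). \<Sum>i<N. ennreal (dist (\<gamma> (t i)) (\<gamma> (t (Suc i))))"
  have ne: "?A \<noteq> {}" "?B \<noteq> {}"
  proof -
    have "(0, \<lambda>_. b) \<in> ?A" "(0, \<lambda>_. b) \<in> ?B" using assms by (auto simp: mono_on_def)
    then show "?A \<noteq> {}" "?B \<noteq> {}" by blast+
  qed
  have "?s x + ?s y \<le> curve_length {a..c} \<gamma>" if "x \<in> ?A" "y \<in> ?B" for x y
  proof -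
    obtain N t M r where xy: "x = (N, t)" "y = (M, r)" by (cases x, cases y) auto
    have t: "mono_on {..N} t" "t ` {..N} \<subseteq> {a..b}" and r: "mono_on {..M} r" "r ` {..M} \<subseteq> {b..c}"
      using that xy by auto
    \<comment> \<open>The two partitions are run one after the other; the chord at index
      \<open>N\<close>, joining \<open>t N\<close> to \<open>r 0\<close>, belongs to neither sum and
      is discarded as nonnegative.\<close>
    define q where "q = (\<lambda>i. if i \<le> N then t i else r (i - Suc N))"
    have "mono_on {..Suc (N + M)} q"
    proof (rule mono_onI)
      fix i j assume ij: "i \<in> {..Suc (N + M)}" "j \<in> {..Suc (N + M)}" "i \<le> j"
      consider "j \<le> N" | "i > N" | "i \<le> N" "j > N" using ij by linarith
      then show "q i \<le> q j"
      proof cases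
        case 1 then show ?thesis using t ij by (auto simp: q_def mono_on_def)
      next
        case 2 then show ?thesis using ij mono_onD[OF r(1), of "i - Suc N" "j - Suc N"] by (auto simp: q_def)
      next
        case 3
        have "t i \<le> b" "b \<le> r (j - Suc N)" using t(2) r(2) 3 ij by (auto simp: image_subset_iff)
        then show ?thesis using 3 by (auto simp: q_def)
      qed
    qed
    moreover have "q ` {..Suc (N + M)} \<subseteq> {a..c}"
    proof
      fix y assume "y \<in> q ` {..Suc (N + M)}"
      then obtain i where i: "i \<le> Suc (N + M)" "y = q i" by auto
      show "y \<in> {a..c}"
      proof (cases "i \<le> N")
        case True
        then have "t i \<in> {a..b}" using t(2) by blast
        then show ?thesis using True i assms by (simp add: q_def)
      next
        case False
        then have "r (i - Suc N) \<in> {b..c}" using i by (intro subsetD[OF r(2)]) auto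
        then show ?thesis using False i assms by (simp add: q_def)
      qed
    qed
    ultimately have le: "(\<Sum>i<Suc (N + M). ennreal (dist (\<gamma> (q i)) (\<gamma> (q (Suc i))))) \<le> curve_length {a..c} \<gamma>"
      by (rule chord_sum_le_curve_length)
    have "?s x + ?s y = (\<Sum>i<N. ennreal (dist (\<gamma> (q i)) (\<gamma> (q (Suc i))))) +
       (\<Sum>i\<in>{Suc N..<Suc N + M}. ennreal (dist (\<gamma> (q i)) (\<gamma> (q (Suc i)))))"
    proof -
      have 1: "(\<Sum>i\<in>{Suc N..<Suc N + M}. ennreal (dist (\<gamma> (q i)) (\<gamma> (q (Suc i))))) =
        (\<Sum>i<M. ennreal (dist (\<gamma> (r i)) (\<gamma> (r (Suc i)))))"
        by (rule sum.reindex_bij_witness[of _ "\<lambda>i. i + Suc N" "\<lambda>i. i - Suc N"])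
           (auto simp: q_def Suc_diff_Suc)
      have 2: "(\<Sum>i<N. ennreal (dist (\<gamma> (q i)) (\<gamma> (q (Suc i))))) = (\<Sum>i<N. ennreal (dist (\<gamma> (t i)) (\<gamma> (t (Suc i)))))"
        by (rule sum.cong) (auto simp: q_def)
      show ?thesis using 1 2 xy by simp
    qed
    also have "\<dots> \<le> (\<Sum>i<Suc (N + M). ennreal (dist (\<gamma> (q i)) (\<gamma> (q (Suc i)))))"
    proof -
      have "sum G {..<N} + sum G {Suc N..<Suc N + M} = sum G ({..<N} \<union> {Suc N..<Suc N + M})" for G :: "nat \<Rightarrow> ennreal"
        by (rule sum.union_disjoint[symmetric]) auto
      also have "sum G ({..<N} \<union> {Suc N..<Suc N + M}) \<le> sum G {..<Suc (N + M)}" for G :: "nat \<Rightarrow> ennreal"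
        by (rule sum_mono2) auto
      finally show ?thesis .
    qed
    finally show ?thesis using le by simp
  qed
  then show "curve_length {a..b} \<gamma> + curve_length {b..c} \<gamma> \<le> curve_length {a..c} \<gamma>"
    unfolding curve_length_def[of "{a..b}"] curve_length_def[of "{b..c}"]
    by (intro SUP_add_SUP_le ne) auto
qed

section \<open>Arc length function, normal representation and reparametrization\<close>

lemma rectifiable_subset: "rectifiable T \<gamma> \<Longrightarrow> S \<subseteq> T \<Longrightarrow> rectifiable S \<gamma>"
  unfolding rectifiable_def using curve_length_mono[of S T \<gamma>] by (auto simp: le_less_trans)

lemma length_fun_Icc:
  assumes "t \<in> {a..b}"
  shows "length_fun {a..b} \<gamma> t = enn2real (curve_length {a..t} \<gamma>)"
proof -
  have "{a..b} \<inter> {..t} = {a..t}" using assms by auto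
  then show ?thesis by (simp only: length_fun_def)
qed

lemma length_fun_left: "a \<le> b \<Longrightarrow> length_fun {a..b} \<gamma> a = 0"
  by (simp add: length_fun_Icc)

lemma length_fun_right: "a \<le> b \<Longrightarrow> length_fun {a..b} \<gamma> b = enn2real (curve_length {a..b} \<gamma>)"
  by (simp add: length_fun_Icc)

lemma length_fun_diff:
  assumes "rectifiable {a..b} \<gamma>" "a \<le> u" "u \<le> v" "v \<le> b"
  shows "length_fun {a..b} \<gamma> v - length_fun {a..b} \<gamma> u = enn2real (curve_length {u..v} \<gamma>)"
proof -
  have "rectifiable {a..u} \<gamma>" "rectifiable {u..v} \<gamma>" using assms by (auto intro!: rectifiable_subset[OF assms(1)])
  then have "enn2real (curve_length {a..u} \<gamma> + curve_length {u..v} \<gamma>) =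
    enn2real (curve_length {a..u} \<gamma>) + enn2real (curve_length {u..v} \<gamma>)"
    by (intro enn2real_plus) (auto simp: rectifiable_def)
  then show ?thesis using assms curve_length_Icc_additive[of a u v \<gamma>] by (simp add: length_fun_Icc)
qed

lemma dist_le_length_fun_diff:
  assumes "rectifiable {a..b} \<gamma>" "a \<le> u" "u \<le> v" "v \<le> b"
  shows "dist (\<gamma> u) (\<gamma> v) \<le> length_fun {a..b} \<gamma> v - length_fun {a..b} \<gamma> u"
proof -
  have "rectifiable {u..v} \<gamma>" using assms by (auto intro!: rectifiable_subset[OF assms(1)])
  then have "ennreal (enn2real (curve_length {u..v} \<gamma>)) = curve_length {u..v} \<gamma>"
    by (simp add: rectifiable_def)
  moreover have "ennreal (dist (\<gamma> u) (\<gamma> v)) \<le> curve_length {u..v} \<gamma>"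
    using assms by (intro dist_le_curve_length) auto
  ultimately have "ennreal (dist (\<gamma> u) (\<gamma> v)) \<le> ennreal (enn2real (curve_length {u..v} \<gamma>))"
    by simp
  then show ?thesis unfolding length_fun_diff[OF assms] by simp
qed

lemma length_fun_mono:
  assumes "rectifiable {a..b} \<gamma>" "a \<le> u" "u \<le> v" "v \<le> b"
  shows "length_fun {a..b} \<gamma> u \<le> length_fun {a..b} \<gamma> v"
  using dist_le_length_fun_diff[OF assms] zero_le_dist[of "\<gamma> u" "\<gamma> v"] by linarith

text \<open>For a fixed partition the chord sum of the partition clamped to \<open>{s..}\<close> (or \<open>{..s}\<close>) depends
  continuously on \<open>s\<close>, so the length of the remaining piece is lower semicontinuous.\<close>

lemma clamped_curve_length:
  fixes h :: "real \<Rightarrow> real \<Rightarrow> real"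
  assumes cont: "continuous_on {a..b} \<gamma>" and x: "x \<in> {a..b}"
    and h: "\<And>r. r \<in> I \<Longrightarrow> continuous_on UNIV (\<lambda>s. h s r)" "\<And>s r r'. r \<le> r' \<Longrightarrow> h s r \<le> h s r'"
      "\<And>r. r \<in> I \<Longrightarrow> h x r = r"
      "\<And>s r. s \<in> {a..b} \<Longrightarrow> r \<in> I \<Longrightarrow> h s r \<in> J s \<and> h s r \<in> {a..b}"
    and e: "e < curve_length I \<gamma>"
  shows "\<exists>d>0. \<forall>s\<in>{a..b}. \<bar>s - x\<bar> < d \<longrightarrow> e < curve_length (J s) \<gamma>"
proof -
  obtain N t where t: "mono_on {..N::nat} t" "t ` {..N} \<subseteq> I"
    and e': "e < (\<Sum>i<N. ennreal (dist (\<gamma> (t i)) (\<gamma> (t (Suc i)))))"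
    using e unfolding curve_length_def less_SUP_iff by auto
  define F where "F = (\<lambda>s. \<Sum>i<N. ennreal (dist (\<gamma> (h s (t i))) (\<gamma> (h s (t (Suc i))))))"
  have tI: "t i \<in> I" if "i \<le> N" for i using t(2) that by auto
  have "continuous_on {a..b} (\<lambda>s. \<gamma> (h s (t i)))" if "i \<le> N" for i
    using h(4) tI[OF that] 
    by (intro continuous_on_compose2[OF cont] continuous_on_subset[OF h(1)]) auto
  then have cF: "continuous_on {a..b} F"
    unfolding F_def by (intro continuous_on_sum continuous_on_ennreal continuous_on_dist) auto
  have "F x = (\<Sum>i<N. ennreal (dist (\<gamma> (t i)) (\<gamma> (t (Suc i)))))"
    unfolding F_def using h(3) tI by (intro sum.cong) auto
  then have "e < F x" using e' by simp
  then have "\<forall>\<^sub>F s in at x within {a..b}. e < F s"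
    using cF x unfolding continuous_on_def by (auto intro: order_tendstoD(1))
  then obtain d where d: "d > 0" "\<And>s. s \<in> {a..b} \<Longrightarrow> s \<noteq> x \<Longrightarrow> dist s x < d \<Longrightarrow> e < F s"
    unfolding eventually_at by auto
  have "F s \<le> curve_length (J s) \<gamma>" if "s \<in> {a..b}" for s
    unfolding F_def using t that h(2,4) tI
    by (intro chord_sum_le_curve_length) (auto simp: mono_on_def)
  moreover have "e < F s" if "s \<in> {a..b}" "\<bar>s - x\<bar> < d" for s
    using d(2)[of s] \<open>e < F x\<close> that by (cases "s = x") (auto simp: dist_real_def)
  ultimately show ?thesis using d(1) by (meson less_le_trans)
qed

text \<open>Both the piece before a point and the piece after it have lower semicontinuous length;
  the two add up to a constant, so the first is also upper semicontinuous.\<close>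

lemma continuous_on_length_fun:
  assumes cont: "continuous_on {a..b} \<gamma>" and rect: "rectifiable {a..b} \<gamma>"
  shows "continuous_on {a..b} (length_fun {a..b} \<gamma>)"
  unfolding continuous_on_iff
proof (intro ballI allI impI)
  fix x e :: real assume x: "x \<in> {a..b}" and e: "e > 0"
  let ?l = "length_fun {a..b} \<gamma>"
  have fin: "curve_length {u..v} \<gamma> < \<infinity>" if "a \<le> u" "v \<le> b" for u v
    using rectifiable_subset[OF rect, of "{u..v}"] that by (auto simp: rectifiable_def)
  \<comment> \<open>Transfers the extended-real bound of \<open>clamped_curve_length\<close> to
    reals. If \<open>e\<close> exceeds the length, the left-hand side is negative and
    \<open>ennreal\<close> would truncate it, so that case is settled directly.\<close>
  have gt: "\<exists>d>0. \<forall>s\<in>{a..b}. \<bar>s - x\<bar> < d \<longrightarrow> enn2real (curve_length I \<gamma>) - e < enn2real (curve_length (J s) \<gamma>)"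
    if I: "curve_length I \<gamma> < \<infinity>" and J: "\<And>s. s \<in> {a..b} \<Longrightarrow> curve_length (J s) \<gamma> < \<infinity>"
      and *: "\<And>e. e < curve_length I \<gamma> \<Longrightarrow> \<exists>d>0. \<forall>s\<in>{a..b}. \<bar>s - x\<bar> < d \<longrightarrow> e < curve_length (J s) \<gamma>"
    for I J
  proof (cases "e \<le> enn2real (curve_length I \<gamma>)")
    case True
    then have "ennreal (enn2real (curve_length I \<gamma>) - e) < ennreal (enn2real (curve_length I \<gamma>))"
      using e by (intro ennreal_lessI) auto
    also have "\<dots> = curve_length I \<gamma>" using I by simp
    finally obtain d where d: "d > 0" "\<And>s. s\<in>{a..b} \<Longrightarrow> \<bar>s - x\<bar> < d \<Longrightarrow>
      ennreal (enn2real (curve_length I \<gamma>) - e) < curve_length (J s) \<gamma>" using * by blast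
    have "enn2real (curve_length I \<gamma>) - e < enn2real (curve_length (J s) \<gamma>)" if "s \<in> {a..b}" "\<bar>s - x\<bar> < d" for s
    proof -
      have "ennreal (enn2real (curve_length I \<gamma>) - e) < ennreal (enn2real (curve_length (J s) \<gamma>))"
        using d(2)[OF that] J[OF that(1)] by simp
      then show ?thesis using True by (subst (asm) ennreal_less_iff) auto
    qed
    then show ?thesis using d(1) by auto
  next
    case False
    then have "enn2real (curve_length I \<gamma>) - e < enn2real (curve_length (J s) \<gamma>)" for s
      using enn2real_nonneg[of "curve_length (J s) \<gamma>"] by linarith
    then show ?thesis by (intro exI[of _ 1]) auto
  qed
  have "\<exists>d>0. \<forall>s\<in>{a..b}. \<bar>s - x\<bar> < d \<longrightarrow> enn2real (curve_length {x..b} \<gamma>) - e < enn2real (curve_length {s..b} \<gamma>)"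
  proof (rule gt)
    fix e' assume "e' < curve_length {x..b} \<gamma>"
    then show "\<exists>d>0. \<forall>s\<in>{a..b}. \<bar>s - x\<bar> < d \<longrightarrow> e' < curve_length {s..b} \<gamma>"
      using x by (intro clamped_curve_length[OF cont x, where h=max]) (auto intro!: continuous_intros)
  qed (use x fin in auto)
  then obtain d1 where d1: "d1 > 0" "\<And>s. s\<in>{a..b} \<Longrightarrow> \<bar>s - x\<bar> < d1 \<Longrightarrow>
    enn2real (curve_length {x..b} \<gamma>) - e < enn2real (curve_length {s..b} \<gamma>)" by blast
  have "\<exists>d>0. \<forall>s\<in>{a..b}. \<bar>s - x\<bar> < d \<longrightarrow> enn2real (curve_length {a..x} \<gamma>) - e < enn2real (curve_length {a..s} \<gamma>)"
  proof (rule gt)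
    fix e' assume "e' < curve_length {a..x} \<gamma>"
    then show "\<exists>d>0. \<forall>s\<in>{a..b}. \<bar>s - x\<bar> < d \<longrightarrow> e' < curve_length {a..s} \<gamma>"
      using x by (intro clamped_curve_length[OF cont x, where h=min]) (auto intro!: continuous_intros simp: min.coboundedI2)
  qed (use x fin in auto)
  then obtain d2 where d2: "d2 > 0" "\<And>s. s\<in>{a..b} \<Longrightarrow> \<bar>s - x\<bar> < d2 \<Longrightarrow>
    enn2real (curve_length {a..x} \<gamma>) - e < enn2real (curve_length {a..s} \<gamma>)" by blast
  have "dist (?l s) (?l x) < e" if s: "s \<in> {a..b}" "dist s x < min d1 d2" for s
  proof -
    have "?l b - ?l x = enn2real (curve_length {x..b} \<gamma>)" "?l b - ?l s = enn2real (curve_length {s..b} \<gamma>)"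
      using x s by (auto intro!: length_fun_diff[OF rect])
    moreover have "?l x = enn2real (curve_length {a..x} \<gamma>)" "?l s = enn2real (curve_length {a..s} \<gamma>)"
      using x s by (auto intro!: length_fun_Icc)
    ultimately show ?thesis using d1(2)[OF s(1)] d2(2)[OF s(1)] s(2) by (auto simp: dist_real_def abs_if)
  qed
  then show "\<exists>d>0. \<forall>x'\<in>{a..b}. dist x' x < d \<longrightarrow> dist (?l x') (?l x) < e"
    using d1(1) d2(1) by (intro exI[of _ "min d1 d2"]) auto
qed

lemma length_fun_image_Icc:
  assumes "continuous_on {a..b} \<gamma>" "rectifiable {a..b} \<gamma>" "a \<le> u" "u \<le> v" "v \<le> b"
  shows "length_fun {a..b} \<gamma> ` {u..v} = {length_fun {a..b} \<gamma> u..length_fun {a..b} \<gamma> v}"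
proof
  show "length_fun {a..b} \<gamma> ` {u..v} \<subseteq> {length_fun {a..b} \<gamma> u..length_fun {a..b} \<gamma> v}"
    using assms by (auto intro!: length_fun_mono)
  have c: "continuous_on {u..v} (length_fun {a..b} \<gamma>)"
    by (rule continuous_on_subset[OF continuous_on_length_fun[OF assms(1,2)]]) (use assms in auto)
  show "{length_fun {a..b} \<gamma> u..length_fun {a..b} \<gamma> v} \<subseteq> length_fun {a..b} \<gamma> ` {u..v}"
  proof
    fix y assume "y \<in> {length_fun {a..b} \<gamma> u..length_fun {a..b} \<gamma> v}"
    then obtain x where "u \<le> x" "x \<le> v" "length_fun {a..b} \<gamma> x = y"
      using IVT'[of "length_fun {a..b} \<gamma>" u y v] c assms by auto
    then show "y \<in> length_fun {a..b} \<gamma> ` {u..v}" by auto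
  qed
qed

lemma length_fun_image:
  assumes "continuous_on {a..b} \<gamma>" "rectifiable {a..b} \<gamma>" "a \<le> b"
  shows "length_fun {a..b} \<gamma> ` {a..b} = {0..enn2real (curve_length {a..b} \<gamma>)}"
  using length_fun_image_Icc[OF assms(1,2), of a b] assms(3)
  by (simp add: length_fun_left length_fun_right)

text \<open>Gives the existence statements without which nothing is known about the
  \<open>SOME\<close> in \<open>normal_rep\<close> and \<open>f_rep\<close>: a preimage under
  \<open>l\<close> may be chosen freely when \<open>g\<close> is constant on the fibres of
  \<open>l\<close>.\<close>

lemma factor_through:
  assumes "\<And>u v. u \<in> A \<Longrightarrow> v \<in> A \<Longrightarrow> l u = l v \<Longrightarrow> g u = g v"
  shows "\<exists>g'. \<forall>t\<in>A. g t = g' (l t)"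
proof (intro exI ballI)
  fix t assume "t \<in> A"
  then have "inv_into A l (l t) \<in> A" "l (inv_into A l (l t)) = l t"
    by (auto simp: inv_into_into f_inv_into_f)
  then have "g t = g (inv_into A l (l t))" using \<open>t \<in> A\<close> by (intro assms) auto
  then show "g t = (g \<circ> inv_into A l) (l t)" by simp
qed

lemma normal_rep_length_fun:
  assumes "rectifiable {a..b} \<beta>" "t \<in> {a..b}"
  shows "normal_rep {a..b} \<beta> (length_fun {a..b} \<beta> t) = \<beta> t"
proof -
  have "\<exists>\<beta>0. \<forall>t\<in>{a..b}. \<beta> t = \<beta>0 (length_fun {a..b} \<beta> t)"
  proof (rule factor_through)
    fix u v assume uv: "u \<in> {a..b}" "v \<in> {a..b}" "length_fun {a..b} \<beta> u = length_fun {a..b} \<beta> v"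
    have "dist (\<beta> u) (\<beta> v) \<le> 0"
    proof (cases "u \<le> v")
      case True then show ?thesis using dist_le_length_fun_diff[OF assms(1), of u v] uv by simp
    next
      case False then show ?thesis using dist_le_length_fun_diff[OF assms(1), of v u] uv by (simp add: dist_commute)
    qed
    then show "\<beta> u = \<beta> v" by simp
  qed
  from someI_ex[OF this] show ?thesis using assms(2) unfolding normal_rep_def by auto
qed

lemma dist_normal_rep_le:
  assumes "continuous_on {a..b} \<beta>" "rectifiable {a..b} \<beta>" "a \<le> b"
    and "s \<in> {0..enn2real (curve_length {a..b} \<beta>)}" "s' \<in> {0..enn2real (curve_length {a..b} \<beta>)}"
  shows "dist (normal_rep {a..b} \<beta> s) (normal_rep {a..b} \<beta> s') \<le> \<bar>s - s'\<bar>"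
proof -
  obtain u v where uv: "u \<in> {a..b}" "v \<in> {a..b}" "s = length_fun {a..b} \<beta> u" "s' = length_fun {a..b} \<beta> v"
    using length_fun_image[OF assms(1-3)] assms(4,5) by blast
  show ?thesis
    using dist_le_length_fun_diff[OF assms(2), of u v] dist_le_length_fun_diff[OF assms(2), of v u] uv
    by (cases "u \<le> v") (auto simp: normal_rep_length_fun[OF assms(2)] dist_commute)
qed

lemma curve_length_reparam:
  fixes h :: "real \<Rightarrow> real"
  assumes mono: "\<And>u v. u \<in> A \<Longrightarrow> v \<in> A \<Longrightarrow> u \<le> v \<Longrightarrow> h u \<le> h v"
    and \<gamma>: "\<And>t. t \<in> A \<Longrightarrow> \<gamma> t = \<delta> (h t)"
  shows "curve_length (h ` A) \<delta> = curve_length A \<gamma>"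
proof (rule antisym)
  show "curve_length A \<gamma> \<le> curve_length (h ` A) \<delta>"
  proof (rule curve_length_leI)
    fix N t assume t: "mono_on {..N::nat} t" "t ` {..N} \<subseteq> A"
    have "(\<Sum>i<N. ennreal (dist (\<gamma> (t i)) (\<gamma> (t (Suc i))))) = (\<Sum>i<N. ennreal (dist (\<delta> (h (t i))) (\<delta> (h (t (Suc i))))))"
      using t by (intro sum.cong) (auto simp: \<gamma> image_subset_iff)
    also have "\<dots> \<le> curve_length (h ` A) \<delta>"
      using t mono by (intro chord_sum_le_curve_length) (auto simp: mono_on_def image_subset_iff)
    finally show "(\<Sum>i<N. ennreal (dist (\<gamma> (t i)) (\<gamma> (t (Suc i))))) \<le> curve_length (h ` A) \<delta>" .
  qed
next
  show "curve_length (h ` A) \<delta> \<le> curve_length A \<gamma>"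
  proof (rule curve_length_leI)
    fix N t assume t: "mono_on {..N::nat} t" "t ` {..N} \<subseteq> h ` A"
    define r where "r = (\<lambda>i. inv_into A h (t i))"
    have r: "r i \<in> A" "h (r i) = t i" if "i \<le> N" for i
      using t(2) that unfolding r_def by (auto simp: inv_into_into f_inv_into_f image_subset_iff)
    have "mono_on {..N} r"
    proof (rule mono_onI)
      fix i j assume ij: "i \<in> {..N}" "j \<in> {..N}" "i \<le> j"
      then have le: "t i \<le> t j" using t by (auto simp: mono_on_def)
      \<comment> \<open>\<open>h\<close> may be constant on parts of \<open>A\<close>, but
        \<open>r i\<close> depends on \<open>i\<close> only through the value \<open>t i\<close>,
        and distinct values force the order of their preimages.\<close>
      show "r i \<le> r j"
      proof (cases "t i = t j")
        case True then show ?thesis by (simp add: r_def)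
      next
        case False
        then show ?thesis using mono[of "r j" "r i"] r[of i] r[of j] ij le by fastforce
      qed
    qed
    moreover have "r ` {..N} \<subseteq> A" using r by auto
    ultimately have "(\<Sum>i<N. ennreal (dist (\<gamma> (r i)) (\<gamma> (r (Suc i))))) \<le> curve_length A \<gamma>"
      by (rule chord_sum_le_curve_length)
    moreover have "(\<Sum>i<N. ennreal (dist (\<gamma> (r i)) (\<gamma> (r (Suc i))))) = (\<Sum>i<N. ennreal (dist (\<delta> (t i)) (\<delta> (t (Suc i)))))"
      using r by (intro sum.cong) (auto simp: \<gamma>)
    ultimately show "(\<Sum>i<N. ennreal (dist (\<delta> (t i)) (\<delta> (t (Suc i))))) \<le> curve_length A \<gamma>" by simp
  qed
qed

section \<open>Vitali coverings and line integrals\<close>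

lemma lmeasurable_Un_negligible:
  assumes "M \<in> lmeasurable" "negligible N"
  shows "M \<union> N \<in> lmeasurable" "measure lebesgue (M \<union> N) \<le> measure lebesgue M"
proof -
  have N: "N \<in> lmeasurable" "measure lebesgue N = 0"
    using assms(2) by (simp_all add: negligible_imp_measurable negligible_imp_measure0)
  then show "M \<union> N \<in> lmeasurable" using assms(1) by (intro fmeasurable.Un)
  show "measure lebesgue (M \<union> N) \<le> measure lebesgue M"
    using measure_Un_le[of M lebesgue N] assms(1) N by (auto dest: fmeasurableD)
qed

text \<open>Vitali's theorem extracts a countable disjoint subfamily that covers \<open>S\<close> up
  to a null set; a bound on all finite disjoint subfamilies survives the countable union. The
  conclusion bounds the outer measure, so \<open>S\<close> may be any set.\<close>

lemma Vitali_covering_bound: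
  fixes S :: "real set" and V :: "(real \<times> real) set"
  assumes V: "\<And>u v. (u, v) \<in> V \<Longrightarrow> u < v"
    and cov: "\<And>s d. s \<in> S \<Longrightarrow> d > 0 \<Longrightarrow> \<exists>u v. (u, v) \<in> V \<and> s \<in> {u..v} \<and> v - u < d"
    and bound: "\<And>F. F \<subseteq> V \<Longrightarrow> finite F \<Longrightarrow> disjoint_family_on (\<lambda>(u, v). {u..v}) F \<Longrightarrow>
      (\<Sum>(u, v)\<in>F. v - u) \<le> e"
  shows "\<exists>M. M \<in> lmeasurable \<and> S \<subseteq> M \<and> measure lebesgue M \<le> e"
proof -
  define a where "a = (\<lambda>(u::real, v). (u + v) / 2)"
  define r where "r = (\<lambda>(u::real, v). (v - u) / 2)"
  have cb: "cball (a i) (r i) = (case i of (u, v) \<Rightarrow> {u..v})" for i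
    by (auto simp: a_def r_def cball_eq_atLeastAtMost field_simps split: prod.splits)
  obtain C where C: "countable C" "C \<subseteq> V"
    "pairwise (\<lambda>i j. disjnt (cball (a i) (r i)) (cball (a j) (r j))) C"
    "negligible (S - (\<Union>i\<in>C. cball (a i) (r i)))"
  proof (rule Vitali_covering_theorem_cballs[of V r S a])
    show "0 < r i" if "i \<in> V" for i using V that by (auto simp: r_def split: prod.splits)
    show "\<exists>i. i \<in> V \<and> x \<in> cball (a i) (r i) \<and> r i < d" if xd: "x \<in> S" "d > 0" for x d
    proof -
      obtain u v where "(u, v) \<in> V" "x \<in> {u..v}" "v - u < d" using cov[OF xd] by auto
      moreover from this have "x \<in> cball (a (u, v)) (r (u, v))" unfolding cb by simp
      ultimately show ?thesis using V[of u v] by (intro exI[of _ "(u, v)"]) (auto simp: r_def)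
    qed
  qed blast
  have disj: "disjoint_family_on (\<lambda>(u, v). {u..v}) C"
    using C(3) by (auto simp: disjoint_family_on_def pairwise_def cb disjnt_def split: prod.splits)
  have bnd: "measure lebesgue (\<Union>\<E>) \<le> e" if \<E>: "\<E> \<subseteq> (\<lambda>(u, v). {u..v}) ` C" "finite \<E>" for \<E>
  proof -
    obtain F where F: "F \<subseteq> C" "finite F" "\<E> = (\<lambda>(u, v). {u..v}) ` F"
      using finite_subset_image[OF \<E>(2,1)] by blast
    have "measure lebesgue (\<Union>\<E>) \<le> (\<Sum>i\<in>F. measure lebesgue ((\<lambda>(u, v). {u..v}) i))"
      unfolding F(3) by (rule measure_UNION_le[OF F(2)]) auto
    also have "\<dots> = (\<Sum>(u, v)\<in>F. v - u)"
      using F(1) C(2) V by (intro sum.cong) (fastforce split: prod.splits)+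
    also have "\<dots> \<le> e"
      using F(1) C(2) by (intro bound F(2) disjoint_family_on_mono[OF F(1) disj]) auto
    finally show ?thesis .
  qed
  let ?U = "\<Union>((\<lambda>(u, v). {u..v}) ` C)"
  have U: "?U \<in> lmeasurable" "measure lebesgue ?U \<le> e"
  proof -
    have c: "countable ((\<lambda>(u, v). {u..v}) ` C)" using C(1) by simp
    have m: "D \<in> lmeasurable" if "D \<in> (\<lambda>(u, v). {u..v}) ` C" for D using that by auto
    show "?U \<in> lmeasurable" by (rule fmeasurable_Union_bound[OF c m bnd])
    show "measure lebesgue ?U \<le> e" by (rule measure_Union_bound[OF c m bnd])
  qed
  have N: "negligible (S - ?U)" using C(4) by (simp add: cb)
  then show ?thesis using U lmeasurable_Un_negligible[OF U(1) N]
    by (intro exI[of _ "?U \<union> (S - ?U)"]) auto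
qed

text \<open>Any member of the family splits the others into those to its left and those to its
  right, which are handled recursively. Nonnegativity of \<open>Q\<close> pays for the gaps, so the
  family may be sparser than a partition.\<close>

lemma superadditive_sum_le:
  fixes Q :: "real \<Rightarrow> real \<Rightarrow> real"
  assumes "finite F" "\<And>u v. (u, v) \<in> F \<Longrightarrow> u < v \<and> a \<le> u \<and> v \<le> b" "a \<le> b"
    and "disjoint_family_on (\<lambda>(u, v). {u<..<v}) F"
    and "\<And>u v. a \<le> u \<Longrightarrow> u \<le> v \<Longrightarrow> v \<le> b \<Longrightarrow> 0 \<le> Q u v"
    and "\<And>u v w. a \<le> u \<Longrightarrow> u \<le> v \<Longrightarrow> v \<le> w \<Longrightarrow> w \<le> b \<Longrightarrow> Q u v + Q v w \<le> Q u w"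
  shows "(\<Sum>(u, v)\<in>F. Q u v) \<le> Q a b"
  using assms
proof (induction "card F" arbitrary: F a b rule: less_induct)
  case less
  show ?case
  proof (cases "F = {}")
    case True then show ?thesis using less.prems by auto
  next
    case False
    then obtain u v where uv: "(u, v) \<in> F" by auto
    define L where "L = {(x, y)\<in>F. y \<le> u}"
    define R where "R = {(x, y)\<in>F. v \<le> x}"
    note p = less.prems
    have uvb: "u < v" "a \<le> u" "v \<le> b" using p(2)[OF uv] by auto
    have sub: "L \<subseteq> F" "R \<subseteq> F" by (auto simp: L_def R_def)
    have notin: "(u, v) \<notin> L" "(u, v) \<notin> R" using uvb by (auto simp: L_def R_def)
    have dis: "L \<inter> R = {}" using uvb p(2) by (fastforce simp: L_def R_def)
    have F: "F = insert (u, v) (L \<union> R)"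
    proof -
      have "(x, y) \<in> L \<union> R" if xy: "(x, y) \<in> F" "(x, y) \<noteq> (u, v)" for x y
      proof (rule ccontr)
        assume "(x, y) \<notin> L \<union> R"
        then have "u < y" "x < v" using xy by (auto simp: L_def R_def)
        moreover have "x < y" using p(2) xy by auto
        ultimately have "max x u < min y v" using uvb by auto
        then obtain z where "max x u < z" "z < min y v" using dense by blast
        then have "z \<in> {x<..<y} \<inter> {u<..<v}" by auto
        moreover have "{x<..<y} \<inter> {u<..<v} = {}"
          using p(4) xy uv unfolding disjoint_family_on_def by fastforce
        ultimately show False by blast
      qed
      then show ?thesis using uv sub by auto
    qed
    have fin: "finite L" "finite R" using p(1) sub by (auto intro: finite_subset)
    have card: "card L < card F" "card R < card F"
      using sub notin uv p(1) by (auto intro!: psubset_card_mono)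
    have 1: "(\<Sum>(u, v)\<in>L. Q u v) \<le> Q a u"
      using p(2) uvb sub by (intro less.hyps card fin disjoint_family_on_mono[OF sub(1) p(4)] p(5) p(6)) (auto simp: L_def)
    have 2: "(\<Sum>(u, v)\<in>R. Q u v) \<le> Q v b"
      using p(2) uvb sub by (intro less.hyps card fin disjoint_family_on_mono[OF sub(2) p(4)] p(5) p(6)) (auto simp: R_def)
    have "(\<Sum>(u, v)\<in>F. Q u v) = Q u v + ((\<Sum>(u, v)\<in>L. Q u v) + (\<Sum>(u, v)\<in>R. Q u v))"
      using notin fin dis by (subst F) (simp add: sum.union_disjoint)
    also have "\<dots> \<le> Q u v + (Q a u + Q v b)" using 1 2 by simp
    also have "\<dots> \<le> Q a b" using p(6)[of a u v] p(6)[of a v b] uvb by linarith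
    finally show ?thesis .
  qed
qed

lemma sum_Union_le:
  fixes f :: "'a \<Rightarrow> real"
  assumes "finite I" "\<And>i. i \<in> I \<Longrightarrow> finite (G i)" "\<And>i x. i \<in> I \<Longrightarrow> x \<in> G i \<Longrightarrow> 0 \<le> f x"
  shows "sum f (\<Union>i\<in>I. G i) \<le> (\<Sum>i\<in>I. sum f (G i))"
  using assms
proof (induction I rule: finite_induct)
  case (insert i I)
  have "sum f (\<Union>j\<in>insert i I. G j) + sum f (G i \<inter> (\<Union>j\<in>I. G j)) = sum f (G i) + sum f (\<Union>j\<in>I. G j)"
    using insert by (simp add: sum.union_inter)
  moreover have "0 \<le> sum f (G i \<inter> (\<Union>j\<in>I. G j))" using insert.prems by (intro sum_nonneg) auto
  ultimately have "sum f (\<Union>j\<in>insert i I. G j) \<le> sum f (G i) + sum f (\<Union>j\<in>I. G j)" by linarith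
  also have "\<dots> \<le> sum f (G i) + (\<Sum>j\<in>I. sum f (G j))" using insert by auto
  finally show ?case using insert by simp
qed simp

text \<open>Where chords are shorter than the arc by a fixed factor, the nonnegative superadditive defect
  \<open>v - u - dist (g u) (g v)\<close> is proportional to \<open>v - u\<close>, whereas its sum over a nearly optimal
  partition is small.\<close>

lemma arc_length_chord_lower_bound:
  fixes g :: "real \<Rightarrow> 'a::metric_space"
  assumes Lip: "\<And>u v. u \<in> {0..l} \<Longrightarrow> v \<in> {0..l} \<Longrightarrow> dist (g u) (g v) \<le> \<bar>u - v\<bar>"
    and len: "curve_length {0..l} g = ennreal l" and l: "0 \<le> l" and k: "0 < k" "k < 1"
  shows "negligible {s\<in>{0..l}. \<not> (\<exists>d>0. \<forall>u v. 0 \<le> u \<longrightarrow> u \<le> s \<longrightarrow> s \<le> v \<longrightarrow> v \<le> l \<longrightarrow> v - u < d \<longrightarrow>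
    k * (v - u) \<le> dist (g u) (g v))}" (is "negligible ?B")
proof (cases "l = 0")
  case True
  then have "?B \<subseteq> {0}" by auto
  then show ?thesis using negligible_subset negligible_sing by blast
next
  case False
  then have l0: "l > 0" using l by simp
  define Q where "Q = (\<lambda>u v. v - u - dist (g u) (g v))"
  have Q0: "0 \<le> Q u v" if "0 \<le> u" "u \<le> v" "v \<le> l" for u v
    using Lip[of u v] that by (auto simp: Q_def)
  have Qadd: "Q u v + Q v w \<le> Q u w" for u v w
    using dist_triangle[of "g u" "g w" "g v"] by (simp add: Q_def)
  show ?thesis unfolding negligible_outer_le
  proof (intro allI impI)
    fix e :: real assume e: "e > 0"
    \<comment> \<open>A bad interval satisfies \<open>(1 - k) * (v - u) \<le> Q u v\<close>, so a
      total defect of at most \<open>(1 - k) * e\<close> bounds the length covered by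
      \<open>e\<close>. The cap \<open>l / 2\<close> keeps \<open>l - \<eta>\<close> nonnegative
      when passing through \<open>ennreal\<close>.\<close>
    define \<eta> where "\<eta> = min (l / 2) ((1 - k) * e)"
    have \<eta>: "0 < \<eta>" "\<eta> < l" "\<eta> \<le> (1 - k) * e" using e k l0 by (auto simp: \<eta>_def min_def)
    have "ennreal (l - \<eta>) < ennreal l" using \<eta> by (intro ennreal_lessI) auto
    then have "ennreal (l - \<eta>) < curve_length {0..l} g" using len by simp
    then obtain N t where t: "mono_on {..N::nat} t" "t ` {..N} \<subseteq> {0..l}"
      "ennreal (l - \<eta>) < (\<Sum>i<N. ennreal (dist (g (t i)) (g (t (Suc i)))))"
      unfolding curve_length_def less_SUP_iff by auto
    have t': "t i \<in> {0..l}" if "i \<le> N" for i using t(2) that by auto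
    have tS: "t i \<le> t (Suc i)" if "i < N" for i using mono_onD[OF t(1)] that by auto
    have chord: "l - \<eta> < (\<Sum>i<N. dist (g (t i)) (g (t (Suc i))))"
      using t(3) \<eta> by (subst (asm) sum_ennreal) (auto simp: ennreal_less_iff)
    have sumQ: "(\<Sum>i<N. Q (t i) (t (Suc i))) + t 0 + (l - t N) \<le> \<eta>"
    proof -
      have "(\<Sum>i<N. t (Suc i) - t i) = t N - t 0" by (rule sum_lessThan_telescope)
      then show ?thesis using chord by (simp add: Q_def sum_subtractf)
    qed
    \<comment> \<open>Index \<open>N\<close> is the gap before the partition and
      \<open>Suc N\<close> the gap after it, so that all of \<open>{0..l}\<close> is covered. A gap
      has defect at most its length, which \<open>sumQ\<close> already counts.\<close>
    define I where "I = (\<lambda>i. if i < N then (t i, t (Suc i)) else if i = N then (0, t 0) else (t N, l))"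
    have IQ: "(\<Sum>i\<le>Suc N. case I i of (a, b) \<Rightarrow> Q a b) \<le> \<eta>"
    proof -
      have "(\<Sum>i\<le>Suc N. case I i of (a, b) \<Rightarrow> Q a b) =
        (\<Sum>i<N. case I i of (a, b) \<Rightarrow> Q a b) + Q 0 (t 0) + Q (t N) l"
        by (simp add: I_def lessThan_Suc_atMost[symmetric])
      also have "(\<Sum>i<N. case I i of (a, b) \<Rightarrow> Q a b) = (\<Sum>i<N. Q (t i) (t (Suc i)))"
        by (intro sum.cong) (auto simp: I_def)
      finally show ?thesis using sumQ by (simp add: Q_def) (smt (verit) zero_le_dist)
    qed
    have Ib: "0 \<le> fst (I i) \<and> fst (I i) \<le> snd (I i) \<and> snd (I i) \<le> l" if "i \<le> Suc N" for i
      using that t'[of 0] t'[of N] t'[of i] t'[of "Suc i"] tS[of i] by (auto simp: I_def)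
    \<comment> \<open>Off these finitely many points, every point lies in the interior of some
      \<open>I i\<close>, and short bad intervals around it stay in that \<open>I i\<close>. This
      lets superadditivity be applied on each \<open>I i\<close> separately.\<close>
    define P where "P = t ` {..N} \<union> {0, l}"
    have finP: "finite P" by (simp add: P_def)
    have inI: "\<exists>i\<le>Suc N. fst (I i) < s \<and> s < snd (I i)" if s: "s \<in> {0..l} - P" for s
    proof -
      consider "s < t 0" | "t N < s" | "t 0 \<le> s" "s \<le> t N" by linarith
      then show ?thesis
      proof cases
        case 1 then show ?thesis using s by (intro exI[of _ N]) (auto simp: I_def P_def)
      next
        case 2 then show ?thesis using s by (intro exI[of _ "Suc N"]) (auto simp: I_def P_def)
      next
        case 3
        define i where "i = (LEAST i. s \<le> t i)"
        have i: "s \<le> t i" "i \<le> N" unfolding i_def using 3 by (auto intro: LeastI Least_le)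
        have "s \<noteq> t j" if "j \<le> N" for j using s that by (auto simp: P_def)
        then have "s < t i" "s \<noteq> t 0" using i by (auto simp: order_less_le)
        then have "i \<noteq> 0" using i(1) 3(1) by (auto intro: Nat.gr0I)
        then obtain j where j: "i = Suc j" by (cases i) auto
        have "t j < s" using not_less_Least[of j "\<lambda>i. s \<le> t i"] j unfolding i_def by auto
        then show ?thesis using \<open>s < t i\<close> i j by (intro exI[of _ j]) (auto simp: I_def)
      qed
    qed
    define V where "V = {(u, v). u < v \<and> (1 - k) * (v - u) \<le> Q u v \<and>
      (\<exists>i\<le>Suc N. fst (I i) \<le> u \<and> v \<le> snd (I i))}"
    have "\<exists>M. M \<in> lmeasurable \<and> ?B - P \<subseteq> M \<and> measure lebesgue M \<le> e"
    proof (rule Vitali_covering_bound)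
      show "u < v" if "(u, v) \<in> V" for u v using that by (auto simp: V_def)
    next
      fix s d :: real assume s: "s \<in> ?B - P" and d: "d > 0"
      then obtain i where i: "i \<le> Suc N" "fst (I i) < s" "s < snd (I i)" using inI by auto
      define d' where "d' = Min {d, s - fst (I i), snd (I i) - s}"
      have d': "0 < d'" "d' \<le> d" "d' \<le> s - fst (I i)" "d' \<le> snd (I i) - s"
        using d i by (auto simp: d'_def)
      then obtain u v where uv: "0 \<le> u" "u \<le> s" "s \<le> v" "v \<le> l" "v - u < d'" "\<not> k * (v - u) \<le> dist (g u) (g v)"
        using s by blast
      then have "u \<noteq> v" by auto
      then have "(u, v) \<in> V" using uv d' i by (auto simp: V_def Q_def algebra_simps intro!: exI[of _ i])
      then show "\<exists>u v. (u, v) \<in> V \<and> s \<in> {u..v} \<and> v - u < d" using uv d' by (intro exI[of _ u] exI[of _ v]) auto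
    next
      fix F assume F: "F \<subseteq> V" "finite F" "disjoint_family_on (\<lambda>(u, v). {u..v}) F"
      define G where "G = (\<lambda>i. {(u, v)\<in>F. fst (I i) \<le> u \<and> v \<le> snd (I i)})"
      have FG: "F = (\<Union>i\<in>{..Suc N}. G i)" using F(1) by (fastforce simp: G_def V_def)
      have GF: "G i \<subseteq> F" for i by (auto simp: G_def)
      have finG: "finite (G i)" for i using F(2) GF by (rule finite_subset[rotated])
      have dG: "disjoint_family_on (\<lambda>(u, v). {u<..<v}) (G i)" for i
        unfolding disjoint_family_on_def
      proof (intro ballI impI)
        fix p q assume pq: "p \<in> G i" "q \<in> G i" "p \<noteq> q"
        then have "(\<lambda>(u, v). {u..v}) p \<inter> (\<lambda>(u, v). {u..v}) q = {}"
          using GF by (intro disjoint_family_onD[OF F(3)]) auto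
        then show "(\<lambda>(u, v). {u<..<v}) p \<inter> (\<lambda>(u, v). {u<..<v}) q = {}"
          by (auto simp: split_beta dest!: order_less_imp_le)
      qed
      have uvV: "u < v \<and> 0 \<le> u \<and> v \<le> l \<and> (1 - k) * (v - u) \<le> Q u v" if "(u, v) \<in> F" for u v
        using that F(1) Ib unfolding V_def by force
      have "(1 - k) * (\<Sum>(u, v)\<in>F. v - u) = (\<Sum>(u, v)\<in>F. (1 - k) * (v - u))"
        by (simp add: sum_distrib_left split_beta)
      also have "\<dots> \<le> (\<Sum>(u, v)\<in>F. Q u v)" using uvV by (intro sum_mono) auto
      also have "\<dots> \<le> (\<Sum>i\<le>Suc N. \<Sum>(u, v)\<in>G i. Q u v)"
      proof -
        have "0 \<le> (case x of (u, v) \<Rightarrow> Q u v)" if "x \<in> G i" for x i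
        proof (cases x)
          case (Pair u v)
          then have "(u, v) \<in> F" using that GF by auto
          then show ?thesis using uvV[of u v] Q0[of u v] Pair by auto
        qed
        then show ?thesis unfolding FG by (intro sum_Union_le finG) auto
      qed
      also have "\<dots> \<le> (\<Sum>i\<le>Suc N. case I i of (a, b) \<Rightarrow> Q a b)"
      proof (rule sum_mono)
        fix i assume i: "i \<in> {..Suc N}"
        have "(\<Sum>(u, v)\<in>G i. Q u v) \<le> Q (fst (I i)) (snd (I i))"
          using Ib[of i] i uvV by (intro superadditive_sum_le[OF finG _ _ dG Q0 Qadd]) (auto simp: G_def)
        then show "(\<Sum>(u, v)\<in>G i. Q u v) \<le> (case I i of (a, b) \<Rightarrow> Q a b)" by (simp add: split_beta)
      qed
      also have "\<dots> \<le> (1 - k) * e" using IQ \<eta> by simp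
      finally show "(\<Sum>(u, v)\<in>F. v - u) \<le> e" using k by simp
    qed
    then obtain M where M: "M \<in> lmeasurable" "?B - P \<subseteq> M" "measure lebesgue M \<le> e" by blast
    have nP: "negligible P" using finP by (rule negligible_finite)
    have "M \<union> P \<in> lmeasurable" "measure lebesgue (M \<union> P) \<le> e"
      using lmeasurable_Un_negligible[OF M(1) nP] M(3) by auto
    then show "\<exists>T. ?B \<subseteq> T \<and> T \<in> lmeasurable \<and> measure lebesgue T \<le> e"
      using M(2) by (intro exI[of _ "M \<union> P"]) auto
  qed
qed

section \<open>Arc length along absolutely continuous curves as a measure\<close>

lemma sum_intervals_le_measure:
  fixes F :: "(real \<times> real) set"
  assumes F: "finite F" "disjoint_family_on (\<lambda>(u, v). {u..v}) F"
    and sub: "\<And>u v. (u, v) \<in> F \<Longrightarrow> u \<le> v \<and> {u..v} \<subseteq> U" and U: "U \<in> lmeasurable"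
  shows "(\<Sum>(u, v)\<in>F. v - u) \<le> measure lebesgue U"
proof -
  have "(\<Sum>(u, v)\<in>F. v - u) = (\<Sum>i\<in>F. measure lebesgue ((\<lambda>(u, v). {u..v}) i))"
    using sub by (intro sum.cong) (auto split: prod.splits)
  also have "\<dots> = measure lebesgue (\<Union>i\<in>F. (\<lambda>(u, v). {u..v}) i)"
    by (intro measure_finite_Union[symmetric] F) (auto simp: emeasure_lborel_Icc_eq split: prod.splits)
  also have "\<dots> \<le> measure lebesgue U"
    using sub U F(1) by (intro measure_mono_fmeasurable) (auto split: prod.splits)
  finally show ?thesis .
qed

text \<open>Vitali coverings deliver finite sets of disjoint closed intervals, whereas
  \<open>abs_continuous_on\<close> speaks of indexed families with disjoint interiors; an
  enumeration of the set bridges the two.\<close>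

lemma abs_continuous_on_sum:
  assumes "abs_continuous_on S g" "e > 0"
  obtains d where "d > 0" "\<And>F. finite F \<Longrightarrow> disjoint_family_on (\<lambda>(u, v). {u..v}) F \<Longrightarrow>
    (\<And>u v. (u, v) \<in> F \<Longrightarrow> u \<le> v \<and> {u..v} \<subseteq> S) \<Longrightarrow> (\<Sum>(u, v)\<in>F. v - u) < d \<Longrightarrow>
    (\<Sum>(u, v)\<in>F. dist (g u) (g v)) < e"
proof -
  obtain d where d: "d > 0" "\<And>(N::nat) u v. (\<forall>i<N. u i \<le> v i \<and> {u i..v i} \<subseteq> S) \<Longrightarrow>
      disjoint_family_on (\<lambda>i. {u i<..<v i}) {..<N} \<Longrightarrow>
      (\<Sum>i<N. v i - u i) < d \<Longrightarrow> (\<Sum>i<N. dist (g (u i)) (g (v i))) < e"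
    using assms(1)[unfolded abs_continuous_on_def, rule_format, OF assms(2)] by blast
  have "(\<Sum>(u, v)\<in>F. dist (g u) (g v)) < e"
    if F: "finite F" "disjoint_family_on (\<lambda>(u, v). {u..v}) F" "\<And>u v. (u, v) \<in> F \<Longrightarrow> u \<le> v \<and> {u..v} \<subseteq> S"
      "(\<Sum>(u, v)\<in>F. v - u) < d" for F
  proof -
    obtain h where h: "bij_betw h {..<card F} F"
      using ex_bij_betw_nat_finite[OF F(1)] by (auto simp: atLeast0LessThan)
    have hF: "(fst (h i), snd (h i)) \<in> F" if "i < card F" for i
      using h that by (auto simp: bij_betw_def)
    have "(\<Sum>i<card F. dist (g (fst (h i))) (g (snd (h i)))) < e"
    proof (rule d(2))
      show "\<forall>i<card F. fst (h i) \<le> snd (h i) \<and> {fst (h i)..snd (h i)} \<subseteq> S"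
        using F(3)[OF hF] by auto
      show "disjoint_family_on (\<lambda>i. {fst (h i)<..<snd (h i)}) {..<card F}"
        unfolding disjoint_family_on_def
      proof (intro ballI impI)
        fix i j assume ij: "i \<in> {..<card F}" "j \<in> {..<card F}" "i \<noteq> j"
        then have "h i \<noteq> h j" using h by (auto simp: bij_betw_def inj_on_def)
        then have "{fst (h i)..snd (h i)} \<inter> {fst (h j)..snd (h j)} = {}"
          using disjoint_family_onD[OF F(2), of "h i" "h j"] hF ij by (auto simp: split_beta)
        then show "{fst (h i)<..<snd (h i)} \<inter> {fst (h j)<..<snd (h j)} = {}"
          by (auto dest!: order_less_imp_le)
      qed
      show "(\<Sum>i<card F. snd (h i) - fst (h i)) < d"
        using F(4) sum.reindex_bij_betw[OF h, of "\<lambda>(u, v). v - u"] by (simp add: split_beta)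
    qed
    then show ?thesis
      using sum.reindex_bij_betw[OF h, of "\<lambda>(u, v). dist (g u) (g v)"] by (simp add: split_beta)
  qed
  then show ?thesis using d(1) that by blast
qed

text \<open>The covering argument common to the null-set and the Lipschitz estimates below. Short
  arcs around a point outside \<open>B\<close> are at most \<open>1 / k\<close> times their chords,
  so the images under \<open>L\<close> of short intervals form a Vitali cover whose total length is
  controlled by chord sums of \<open>\<gamma>\<close>. The predicate \<open>R\<close> carries the
  local property that makes these sums small.\<close>

lemma arc_length_image_bound:
  fixes \<gamma> g :: "real \<Rightarrow> 'a::metric_space" and L :: "real \<Rightarrow> real"
  assumes ab: "a < b" and L: "continuous_on {a..b} L"
    and Lmono: "\<And>u v. a \<le> u \<Longrightarrow> u < v \<Longrightarrow> v \<le> b \<Longrightarrow> L u < L v"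
    and \<gamma>: "\<And>t. t \<in> {a..b} \<Longrightarrow> \<gamma> t = g (L t)"
    and B: "negligible B" and k: "k > 0"
    and chord: "\<And>s. s \<in> L ` {a..b} - B \<Longrightarrow> \<exists>d>0. \<forall>u v. L a \<le> u \<longrightarrow> u \<le> s \<longrightarrow> s \<le> v \<longrightarrow> v \<le> L b \<longrightarrow>
      v - u < d \<longrightarrow> k * (v - u) \<le> dist (g u) (g v)"
    and U: "open U" "A \<subseteq> U" "A \<subseteq> {a..b}"
    and R: "\<And>t. t \<in> A \<Longrightarrow> \<exists>d>0. \<forall>t'\<in>{a..b}. \<bar>t' - t\<bar> < d \<longrightarrow> R (min t t') (max t t')"
    and bound: "\<And>F. finite F \<Longrightarrow> disjoint_family_on (\<lambda>(u, v). {u..v}) F \<Longrightarrow>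
      (\<And>u v. (u, v) \<in> F \<Longrightarrow> u < v \<and> {u..v} \<subseteq> {a..b} \<and> {u..v} \<subseteq> U \<and> R u v) \<Longrightarrow>
      (\<Sum>(u, v)\<in>F. dist (\<gamma> u) (\<gamma> v)) \<le> e"
  shows "\<exists>M. M \<in> lmeasurable \<and> L ` A \<subseteq> M \<and> measure lebesgue M \<le> e / k"
proof -
  define V' where "V' = {(u, v). u < v \<and> {u..v} \<subseteq> {a..b} \<and> {u..v} \<subseteq> U \<and> R u v \<and> k * (L v - L u) \<le> dist (\<gamma> u) (\<gamma> v)}"
  define L2 where "L2 = (\<lambda>(u, v). (L u, L v))"
  have Lmono': "L u \<le> L v" if "a \<le> u" "u \<le> v" "v \<le> b" for u v
    using Lmono[of u v] that by (cases "u = v") auto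
  have V'ab: "a \<le> u \<and> u < v \<and> v \<le> b" if "(u, v) \<in> V'" for u v using that by (auto simp: V'_def)
  have "\<exists>M. M \<in> lmeasurable \<and> L ` A - B \<subseteq> M \<and> measure lebesgue M \<le> e / k"
  proof (rule Vitali_covering_bound[where V="L2 ` V'"])
    show "u < v" if "(u, v) \<in> L2 ` V'" for u v
      using that V'ab Lmono by (auto simp: L2_def)
  next
    fix s d :: real assume s: "s \<in> L ` A - B" and d: "d > 0"
    then obtain t where t: "t \<in> A" "s = L t" by auto
    then have tab: "t \<in> {a..b}" using U by auto
    obtain d1 where d1: "d1 > 0" "\<And>u v. L a \<le> u \<Longrightarrow> u \<le> s \<Longrightarrow> s \<le> v \<Longrightarrow> v \<le> L b \<Longrightarrow>
      v - u < d1 \<Longrightarrow> k * (v - u) \<le> dist (g u) (g v)"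
      using chord[of s] s t tab by auto
    obtain d2 where d2: "d2 > 0" "\<And>t'. t' \<in> {a..b} \<Longrightarrow> \<bar>t' - t\<bar> < d2 \<Longrightarrow> R (min t t') (max t t')"
      using R[OF t(1)] by auto
    obtain d3 where d3: "d3 > 0" "ball t d3 \<subseteq> U" using U t(1) by (meson openE subsetD)
    obtain d4 where d4: "d4 > 0" "\<And>t'. t' \<in> {a..b} \<Longrightarrow> dist t' t < d4 \<Longrightarrow> dist (L t') (L t) < min d d1"
        using L[unfolded continuous_on_iff, rule_format, OF tab, of "min d d1"] d d1(1) by auto
    define q where "q = Min {d2, d3, d4} / 2"
    have q: "q > 0" "q < d2" "q < d3" "q < d4" using d2 d3 d4 by (auto simp: q_def)
    \<comment> \<open>The covering interval has \<open>t\<close> as one endpoint and lies to its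
      right, or to its left when \<open>t = b\<close>. Halving the minimum in \<open>q\<close> makes
      the needed inequalities strict.\<close>
    define t' where "t' = (if t < b then min b (t + q) else max a (t - q))"
    have t': "t' \<in> {a..b}" "t' \<noteq> t" "\<bar>t' - t\<bar> \<le> q" using tab ab q by (auto simp: t'_def min_def max_def)
    define u v where "u = min t t'" and "v = max t t'"
    have uv: "u < v" "a \<le> u" "v \<le> b" "u \<le> t" "t \<le> v" using t' tab by (auto simp: u_def v_def)
    have "{u..v} \<subseteq> ball t d3" using t'(3) q by (auto simp: u_def v_def dist_real_def)
    then have UU: "{u..v} \<subseteq> U" using d3 by auto
    have RR: "R u v" using d2(2)[OF t'(1)] t'(3) q by (auto simp: u_def v_def)
    have Ls: "L u \<le> s" "s \<le> L v" "L a \<le> L u" "L v \<le> L b" using Lmono' uv t(2) tab ab by auto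
    have "\<bar>L t' - L t\<bar> < min d d1" using d4(2)[OF t'(1)] t'(3) q by (auto simp: dist_real_def)
    moreover have "L v - L u = \<bar>L t' - L t\<bar>" using Ls t(2) by (auto simp: u_def v_def min_def max_def)
    ultimately have small: "L v - L u < d" "L v - L u < d1" by auto
    have "k * (L v - L u) \<le> dist (\<gamma> u) (\<gamma> v)" using d1(2)[of "L u" "L v"] Ls small uv \<gamma> by auto
    then have "(u, v) \<in> V'" using uv UU RR by (auto simp: V'_def)
    then have "(L u, L v) \<in> L2 ` V'" by (force simp: L2_def)
    then show "\<exists>u v. (u, v) \<in> L2 ` V' \<and> s \<in> {u..v} \<and> v - u < d"
      using Ls(1,2) small(1) by auto
  next
    fix F assume F: "F \<subseteq> L2 ` V'" "finite F" "disjoint_family_on (\<lambda>(u, v). {u..v}) F"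
    obtain G where G: "G \<subseteq> V'" "finite G" "F = L2 ` G" using finite_subset_image[OF F(2,1)] by blast
    \<comment> \<open>Strict monotonicity makes the intervals in arc length correspond one-to-one to
      parameter intervals, and disjointness pulls back, so that \<open>bound\<close> applies to
      \<open>G\<close>.\<close>
    have Linj: "u = v" if "L u = L v" "u \<in> {a..b}" "v \<in> {a..b}" for u v
      using that Lmono[of u v] Lmono[of v u] by (cases u v rule: linorder_cases) auto
    have inj: "inj_on L2 G"
    proof (rule inj_onI)
      fix p q assume pq: "p \<in> G" "q \<in> G" "L2 p = L2 q"
      obtain u v x y where eq: "p = (u, v)" "q = (x, y)" by (cases p, cases q) auto
      have "a \<le> u \<and> u < v \<and> v \<le> b" "a \<le> x \<and> x < y \<and> y \<le> b" using V'ab pq G(1) eq by blast+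
      moreover have "L u = L x" "L v = L y" using pq(3) by (auto simp: L2_def eq)
      ultimately show "p = q" using Linj[of u x] Linj[of v y] by (simp add: eq)
    qed
    have disjG: "disjoint_family_on (\<lambda>(u, v). {u..v}) G"
      unfolding disjoint_family_on_def
    proof (intro ballI impI)
      fix p q assume pq: "p \<in> G" "q \<in> G" "p \<noteq> q"
      obtain u v x y where eq: "p = (u, v)" "q = (x, y)" by (cases p, cases q) auto
      have ab': "a \<le> u" "v \<le> b" "a \<le> x" "y \<le> b" using V'ab pq G(1) eq by blast+
      have "L2 p \<noteq> L2 q" using inj pq by (auto simp: inj_on_def)
      have "L2 p \<in> F" "L2 q \<in> F" using pq G(3) by auto
      then have "(\<lambda>(u, v). {u..v}) (L2 p) \<inter> (\<lambda>(u, v). {u..v}) (L2 q) = {}"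
        using \<open>L2 p \<noteq> L2 q\<close> by (rule disjoint_family_onD[OF F(3)])
      then have "{L u..L v} \<inter> {L x..L y} = {}" by (simp add: L2_def eq)
      moreover have "L z \<in> {L u..L v} \<inter> {L x..L y}" if "z \<in> {u..v} \<inter> {x..y}" for z
        using that ab' Lmono' by auto
      ultimately have "{u..v} \<inter> {x..y} = {}" by blast
      then show "(\<lambda>(u, v). {u..v}) p \<inter> (\<lambda>(u, v). {u..v}) q = {}" by (simp only: eq prod.case)
    qed
    have "k * (\<Sum>(u, v)\<in>F. v - u) = (\<Sum>(u, v)\<in>G. k * (L v - L u))"
      unfolding G(3) by (subst sum.reindex[OF inj]) (simp add: L2_def sum_distrib_left split_beta)
    also have "\<dots> \<le> (\<Sum>(u, v)\<in>G. dist (\<gamma> u) (\<gamma> v))"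
      using G(1) by (intro sum_mono) (auto simp: V'_def)
    also have "\<dots> \<le> e"
      using G(1) by (intro bound G(2) disjG) (auto simp: V'_def)
    finally show "(\<Sum>(u, v)\<in>F. v - u) \<le> e / k" using k by (simp add: field_simps)
  qed
  then obtain M where M: "M \<in> lmeasurable" "L ` A - B \<subseteq> M" "measure lebesgue M \<le> e / k" by blast
  then show ?thesis using lmeasurable_Un_negligible[OF M(1) B] by (intro exI[of _ "M \<union> B"]) auto
qed

text \<open>Approximation by simple functions reduces domination of \<open>density N \<Phi>\<close>
  by \<open>M\<close> to level sets of a simple function below \<open>\<Phi>\<close>. This stands in
  for a change of variables: \<open>M\<close> may even have a singular part.\<close>

lemma nn_integral_density_le:
  assumes sets: "sets M = sets N" and \<Phi>: "\<Phi> \<in> borel_measurable N" and F: "F \<in> borel_measurable N"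
    and le: "\<And>\<kappa> S. \<kappa> \<noteq> top \<Longrightarrow> \<kappa> \<noteq> 0 \<Longrightarrow> S \<in> sets N \<Longrightarrow> (\<And>x. x \<in> S \<Longrightarrow> \<kappa> \<le> \<Phi> x) \<Longrightarrow> \<kappa> * emeasure N S \<le> emeasure M S"
  shows "(\<integral>\<^sup>+x. \<Phi> x * F x \<partial>N) \<le> (\<integral>\<^sup>+x. F x \<partial>M)"
proof -
  have "density N \<Phi> \<le> M"
  proof (subst le_measure)
    show "\<forall>A\<in>sets (density N \<Phi>). emeasure (density N \<Phi>) A \<le> emeasure M A"
    proof
      fix A assume "A \<in> sets (density N \<Phi>)"
      then have A: "A \<in> sets N" by simp
      have "emeasure (density N \<Phi>) A = (\<integral>\<^sup>+x. \<Phi> x * indicator A x \<partial>N)"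
        using A \<Phi> by (simp add: emeasure_density)
      also have "\<dots> \<le> emeasure M A"
        unfolding nn_integral_def_finite
      proof (rule SUP_least, safe)
        fix \<sigma> assume \<sigma>: "simple_function N \<sigma>" "\<sigma> \<le> (\<lambda>x. \<Phi> x * indicator A x)" "\<forall>x. \<sigma> x < top"
        define P where "P = (\<lambda>v. \<sigma> -` {v} \<inter> space N)"
        \<comment> \<open>Dropping the value 0 costs nothing in the integral and puts each remaining
          level set inside \<open>A\<close>, where \<open>\<sigma>\<close> lies below
          \<open>\<Phi>\<close> and the hypothesis \<open>le\<close> applies.\<close>
        define W where "W = \<sigma> ` space N - {0}"
        have Ps: "P v \<in> sets N" for v using \<sigma>(1) unfolding P_def by (rule simple_functionD(2))
        have fin: "finite (\<sigma> ` space N)" using \<sigma>(1) by (rule simple_functionD(1))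
        have sub: "P v \<subseteq> A" "\<And>x. x \<in> P v \<Longrightarrow> v \<le> \<Phi> x" if "v \<in> W" for v
        proof -
          show "P v \<subseteq> A"
          proof
            fix x assume "x \<in> P v"
            then have "\<sigma> x \<noteq> 0" using that by (auto simp: P_def W_def)
            then show "x \<in> A" using le_funD[OF \<sigma>(2), of x] by (cases "x \<in> A") auto
          qed
          show "v \<le> \<Phi> x" if "x \<in> P v" for x
            using le_funD[OF \<sigma>(2), of x] that \<open>P v \<subseteq> A\<close> by (cases "x \<in> A") (auto simp: P_def)
        qed
        have "integral\<^sup>S N \<sigma> = (\<Sum>v\<in>\<sigma> ` space N. v * emeasure N (P v))"
          by (simp add: simple_integral_def P_def)
        also have "\<dots> = (\<Sum>v\<in>W. v * emeasure N (P v))"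
          using fin by (intro sum.mono_neutral_right) (auto simp: W_def)
        also have "\<dots> \<le> (\<Sum>v\<in>W. emeasure M (P v))"
        proof (rule sum_mono)
          fix v assume v: "v \<in> W"
          then have "v \<noteq> top" "v \<noteq> 0" using \<sigma>(3) by (auto simp: W_def less_top)
          then show "v * emeasure N (P v) \<le> emeasure M (P v)" by (intro le Ps sub v)
        qed
        also have "\<dots> = emeasure M (\<Union>v\<in>W. P v)"
          using fin Ps sets by (intro sum_emeasure) (auto simp: W_def P_def disjoint_family_on_def)
        also have "\<dots> \<le> emeasure M A"
          using sub(1) A sets by (intro emeasure_mono) auto
        finally show "integral\<^sup>S N \<sigma> \<le> emeasure M A" .
      qed
      finally show "emeasure (density N \<Phi>) A \<le> emeasure M A" .
    qed
  qed (simp add: sets)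
  then have "(\<integral>\<^sup>+x. F x \<partial>density N \<Phi>) \<le> (\<integral>\<^sup>+x. F x \<partial>M)"
    by (intro nn_integral_mono_measure) (auto simp: sets)
  then show ?thesis using \<Phi> F by (simp add: nn_integral_density)
qed

lemma abs_continuous_on_imp_continuous_on:
  assumes "abs_continuous_on {a..b} g"
  shows "continuous_on {a..b} g"
  unfolding continuous_on_iff
proof (intro ballI allI impI)
  fix x e :: real assume x: "x \<in> {a..b}" and e: "0 < e"
  obtain d where d: "d > 0" "\<And>(N::nat) u v. (\<forall>i<N. u i \<le> v i \<and> {u i..v i} \<subseteq> {a..b}) \<Longrightarrow>
      disjoint_family_on (\<lambda>i. {u i<..<v i}) {..<N} \<Longrightarrow>
      (\<Sum>i<N. v i - u i) < d \<Longrightarrow> (\<Sum>i<N. dist (g (u i)) (g (v i))) < e"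
    using assms[unfolded abs_continuous_on_def, rule_format, OF e] by blast
  have "dist (g y) (g x) < e" if y: "y \<in> {a..b}" "dist y x < d" for y
  proof -
    have "(\<Sum>i<1::nat. dist (g (min x y)) (g (max x y))) < e"
      using x y by (intro d(2)) (auto simp: disjoint_family_on_def dist_real_def)
    then show ?thesis by (cases "x \<le> y") (auto simp: dist_commute min_def max_def)
  qed
  then show "\<exists>d>0. \<forall>x'\<in>{a..b}. dist x' x < d \<longrightarrow> dist (g x') (g x) < e" using d(1) by blast
qed

text \<open>Lusin's condition for the arc length function of an absolutely continuous curve: in an
  open set of small measure around \<open>Z\<close> the chord sums of \<open>\<gamma>\<close> are
  small, and short arcs around points outside \<open>B\<close> are at most twice their chords. The
  factor 2 explains the bound \<open>e / 2\<close> in the proof.\<close>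

lemma arc_length_null_image:
  fixes \<gamma> g :: "real \<Rightarrow> 'a::metric_space" and L :: "real \<Rightarrow> real"
  assumes ab: "a < b" and L: "continuous_on {a..b} L"
    and Lmono: "\<And>u v. a \<le> u \<Longrightarrow> u < v \<Longrightarrow> v \<le> b \<Longrightarrow> L u < L v"
    and \<gamma>: "\<And>t. t \<in> {a..b} \<Longrightarrow> \<gamma> t = g (L t)"
    and B: "negligible B"
    and chord: "\<And>s. s \<in> L ` {a..b} - B \<Longrightarrow> \<exists>d>0. \<forall>u v. L a \<le> u \<longrightarrow> u \<le> s \<longrightarrow> s \<le> v \<longrightarrow> v \<le> L b \<longrightarrow>
      v - u < d \<longrightarrow> 1 / 2 * (v - u) \<le> dist (g u) (g v)"
    and AC: "abs_continuous_on {a..b} \<gamma>"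
    and Z: "negligible Z" "Z \<subseteq> {a..b}"
  shows "negligible (L ` Z)"
  unfolding negligible_outer_le
proof (intro allI impI)
  fix e :: real assume e: "e > 0"
  then have e2: "e / 2 > 0" by simp
  obtain d where d: "d > 0" "\<And>F. finite F \<Longrightarrow> disjoint_family_on (\<lambda>(u, v). {u..v}) F \<Longrightarrow>
    (\<And>u v. (u, v) \<in> F \<Longrightarrow> u \<le> v \<and> {u..v} \<subseteq> {a..b}) \<Longrightarrow> (\<Sum>(u, v)\<in>F. v - u) < d \<Longrightarrow>
    (\<Sum>(u, v)\<in>F. dist (\<gamma> u) (\<gamma> v)) < e / 2"
    using abs_continuous_on_sum[OF AC e2] by metis
  have Zn: "Z \<in> null_sets lebesgue" using Z(1) by (simp add: negligible_iff_null_sets)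
  obtain U where U: "open U" "Z \<subseteq> U" "U - Z \<in> lmeasurable" "emeasure lebesgue (U - Z) < ennreal d"
    using sets_lebesgue_outer_open[of Z d] Zn d(1) by blast
  have "measure lebesgue (U - Z) < d"
    using U(4) d(1) by (simp add: emeasure_eq_measure2[OF U(3)] ennreal_less_iff)
  moreover have "U = (U - Z) \<union> Z" using U(2) by auto
  ultimately have U': "U \<in> lmeasurable" "measure lebesgue U < d"
    using lmeasurable_Un_negligible[OF U(3) Z(1)] by auto
  have "\<exists>M. M \<in> lmeasurable \<and> L ` Z \<subseteq> M \<and> measure lebesgue M \<le> (e / 2) / (1 / 2)"
  proof (rule arc_length_image_bound[OF ab L Lmono \<gamma> B _ chord U(1,2) Z(2), where R="\<lambda>_ _. True"])
    fix F assume F: "finite F" "disjoint_family_on (\<lambda>(u, v). {u..v}) F"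
      "\<And>u v. (u, v) \<in> F \<Longrightarrow> u < v \<and> {u..v} \<subseteq> {a..b} \<and> {u..v} \<subseteq> U \<and> True"
    have "(\<Sum>(u, v)\<in>F. v - u) \<le> measure lebesgue U"
      using F(3) by (intro sum_intervals_le_measure F U') (auto simp: less_imp_le)
    then have "(\<Sum>(u, v)\<in>F. dist (\<gamma> u) (\<gamma> v)) < e / 2"
      using U'(2) F(3) by (intro d(2) F) (auto simp: less_imp_le)
    then show "(\<Sum>(u, v)\<in>F. dist (\<gamma> u) (\<gamma> v)) \<le> e / 2" by simp
  qed (auto intro: exI[of _ 1])
  then show "\<exists>T. L ` Z \<subseteq> T \<and> T \<in> lmeasurable \<and> measure lebesgue T \<le> e" by auto
qed

text \<open>At points of \<open>A\<close> short chords of \<open>\<gamma>\<close> are at most about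
  \<open>1 / \<kappa>\<close> times the parameter length, and arcs are almost chords; covering
  \<open>A\<close> inside an open set of nearly the same measure turns this into a comparison of
  measures.\<close>

lemma arc_length_image_Lipschitz:
  fixes \<gamma> g :: "real \<Rightarrow> 'a::metric_space" and L :: "real \<Rightarrow> real"
  assumes ab: "a < b" and L: "continuous_on {a..b} L"
    and Lmono: "\<And>u v. a \<le> u \<Longrightarrow> u < v \<Longrightarrow> v \<le> b \<Longrightarrow> L u < L v"
    and \<gamma>: "\<And>t. t \<in> {a..b} \<Longrightarrow> \<gamma> t = g (L t)"
    and B: "\<And>k. 0 < k \<Longrightarrow> k < 1 \<Longrightarrow> negligible (B k)"
    and chord: "\<And>k s. 0 < k \<Longrightarrow> k < 1 \<Longrightarrow> s \<in> L ` {a..b} - B k \<Longrightarrow> \<exists>d>0. \<forall>u v. L a \<le> u \<longrightarrow> u \<le> s \<longrightarrow> s \<le> v \<longrightarrow> v \<le> L b \<longrightarrow>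
      v - u < d \<longrightarrow> k * (v - u) \<le> dist (g u) (g v)"
    and A: "A \<in> lmeasurable" "A \<subseteq> {a..b}" and LA: "L ` A \<in> lmeasurable" and \<kappa>: "\<kappa> > 0"
    and lip: "\<And>t \<kappa>'. t \<in> A \<Longrightarrow> 0 < \<kappa>' \<Longrightarrow> \<kappa>' < \<kappa> \<Longrightarrow> \<exists>d>0. \<forall>t'\<in>{a..b}. \<bar>t' - t\<bar> < d \<longrightarrow>
      \<kappa>' * dist (\<gamma> t') (\<gamma> t) \<le> \<bar>t' - t\<bar>"
  shows "\<kappa> * measure lebesgue (L ` A) \<le> measure lebesgue A"
proof (rule field_le_mult_one_interval)
  fix z :: real assume z: "0 < z" "z < 1"
  show "z * (\<kappa> * measure lebesgue (L ` A)) \<le> measure lebesgue A"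
  proof (rule field_le_epsilon)
    fix e :: real assume e: "e > 0"
    \<comment> \<open>Two strict losses occur, arc against chord and \<open>\<kappa>'\<close>
      against \<open>\<kappa>\<close>; each is given the factor \<open>sqrt z\<close>.\<close>
    define k where "k = sqrt z"
    have k: "0 < k" "k < 1" "k * k = z" using z by (auto simp: k_def real_sqrt_lt_1_iff)
    define \<kappa>' where "\<kappa>' = \<kappa> * k"
    have \<kappa>': "0 < \<kappa>'" "\<kappa>' < \<kappa>" using \<kappa> k by (auto simp: \<kappa>'_def)
    obtain U where U: "open U" "A \<subseteq> U" "U - A \<in> lmeasurable" "emeasure lebesgue (U - A) < ennreal e"
      using sets_lebesgue_outer_open[of A e] A(1) e by (auto dest: fmeasurableD)
    have eU: "measure lebesgue (U - A) < e"
      using U(4) e by (simp add: emeasure_eq_measure2[OF U(3)] ennreal_less_iff)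
    have UA: "U = A \<union> (U - A)" using U(2) by auto
    have Um: "U \<in> lmeasurable" using fmeasurable.Un[OF A(1) U(3)] UA by simp
    have "measure lebesgue U \<le> measure lebesgue A + measure lebesgue (U - A)"
      using measure_Un_le[of A lebesgue "U - A"] A(1) U(3) UA by (auto dest: fmeasurableD)
    then have U': "measure lebesgue U \<le> measure lebesgue A + e" using eU by linarith
    have "\<exists>M. M \<in> lmeasurable \<and> L ` A \<subseteq> M \<and> measure lebesgue M \<le> ((measure lebesgue A + e) / \<kappa>') / k"
    proof (rule arc_length_image_bound[OF ab L Lmono \<gamma> B[OF k(1,2)] k(1) chord[OF k(1,2)] U(1,2) A(2),
          where R="\<lambda>u v. \<kappa>' * dist (\<gamma> u) (\<gamma> v) \<le> v - u"])
      fix t assume "t \<in> A"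
      then obtain d where "d > 0" "\<And>t'. t' \<in> {a..b} \<Longrightarrow> \<bar>t' - t\<bar> < d \<Longrightarrow> \<kappa>' * dist (\<gamma> t') (\<gamma> t) \<le> \<bar>t' - t\<bar>"
        using lip[OF _ \<kappa>'] by blast
      moreover have "dist (\<gamma> (min t t')) (\<gamma> (max t t')) = dist (\<gamma> t') (\<gamma> t)" "max t t' - min t t' = \<bar>t' - t\<bar>" for t'
        by (auto simp: min_def max_def dist_commute)
      ultimately show "\<exists>d>0. \<forall>t'\<in>{a..b}. \<bar>t' - t\<bar> < d \<longrightarrow>
          \<kappa>' * dist (\<gamma> (min t t')) (\<gamma> (max t t')) \<le> max t t' - min t t'"
        by (metis (no_types))
    next
      fix F assume F: "finite F" "disjoint_family_on (\<lambda>(u, v). {u..v}) F"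
        "\<And>u v. (u, v) \<in> F \<Longrightarrow> u < v \<and> {u..v} \<subseteq> {a..b} \<and> {u..v} \<subseteq> U \<and> \<kappa>' * dist (\<gamma> u) (\<gamma> v) \<le> v - u"
      have "\<kappa>' * (\<Sum>(u, v)\<in>F. dist (\<gamma> u) (\<gamma> v)) = (\<Sum>(u, v)\<in>F. \<kappa>' * dist (\<gamma> u) (\<gamma> v))"
        by (simp add: sum_distrib_left split_beta)
      also have "\<dots> \<le> (\<Sum>(u, v)\<in>F. v - u)" using F(3) by (intro sum_mono) auto
      also have "\<dots> \<le> measure lebesgue U"
        using F(3) by (intro sum_intervals_le_measure F Um) (auto simp: less_imp_le)
      finally show "(\<Sum>(u, v)\<in>F. dist (\<gamma> u) (\<gamma> v)) \<le> (measure lebesgue A + e) / \<kappa>'"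
        using \<kappa>' U' by (simp add: field_simps)
    qed auto
    then obtain M where M: "M \<in> lmeasurable" "L ` A \<subseteq> M" "measure lebesgue M \<le> ((measure lebesgue A + e) / \<kappa>') / k"
      by blast
    have "measure lebesgue (L ` A) \<le> measure lebesgue M"
      using M LA by (intro measure_mono_fmeasurable) (auto dest: fmeasurableD)
    then have "measure lebesgue (L ` A) \<le> ((measure lebesgue A + e) / \<kappa>') / k" using M(3) by linarith
    then have "(k * \<kappa>') * measure lebesgue (L ` A) \<le> measure lebesgue A + e"
      using \<kappa>' k by (simp add: field_simps)
    moreover have "k * \<kappa>' = z * \<kappa>" using k by (simp add: \<kappa>'_def mult_ac)
    ultimately show "z * (\<kappa> * measure lebesgue (L ` A)) \<le> measure lebesgue A + e" by (simp only: mult.assoc)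
  qed
qed

text \<open>Change of variables \<open>s = L t\<close> as an inequality, without a derivative of
  \<open>L\<close>: applied to superlevel sets of \<open>\<phi> \<circ> g\<close>, the preceding
  lemma says that the image of Lebesgue measure under \<open>L\<close> dominates the measure with
  density \<open>\<phi> (g s)\<close>. Integrating \<open>\<rho> / \<phi>\<close> against both gives
  the claim.\<close>

lemma arc_integral_le:
  fixes \<gamma> g :: "real \<Rightarrow> 'a::euclidean_space" and L :: "real \<Rightarrow> real" and \<phi> :: "'a \<Rightarrow> real"
  assumes ab: "a < b" and L: "continuous_on {a..b} L"
    and Lmono: "\<And>u v. a \<le> u \<Longrightarrow> u < v \<Longrightarrow> v \<le> b \<Longrightarrow> L u < L v"
    and L0: "L a = 0" "L b = l"
    and \<gamma>: "\<And>t. t \<in> {a..b} \<Longrightarrow> \<gamma> t = g (L t)"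
    and Lip: "\<And>u v. u \<in> {0..l} \<Longrightarrow> v \<in> {0..l} \<Longrightarrow> dist (g u) (g v) \<le> \<bar>u - v\<bar>"
    and len: "curve_length {0..l} g = ennreal l"
    and AC: "abs_continuous_on {a..b} \<gamma>"
    and Z: "Z \<in> null_sets lborel" "Z \<subseteq> {a..b}"
    and \<phi>: "\<phi> \<in> borel_measurable borel" and \<rho>: "\<rho> \<in> borel_measurable borel"
    and pos: "\<And>t. t \<in> {a..b} - Z \<Longrightarrow> 0 < \<phi> (\<gamma> t)"
    and lip: "\<And>t \<kappa>. t \<in> {a..b} - Z \<Longrightarrow> 0 < \<kappa> \<Longrightarrow> \<kappa> < \<phi> (\<gamma> t) \<Longrightarrow>
      \<exists>d>0. \<forall>t'\<in>{a..b}. \<bar>t' - t\<bar> < d \<longrightarrow> \<kappa> * dist (\<gamma> t') (\<gamma> t) \<le> \<bar>t' - t\<bar>"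
  shows "(\<integral>\<^sup>+s\<in>{0..l}. \<rho> (g s) \<partial>lborel) \<le> (\<integral>\<^sup>+t\<in>{a..b}. \<rho> (\<gamma> t) / ennreal (\<phi> (\<gamma> t)) \<partial>lborel)"
proof -
  note [measurable] = \<phi> \<rho>
  have l0: "0 < l" using Lmono[of a b] ab L0 by auto
  have onto: "L ` {a..b} = {0..l}"
  proof
    show "L ` {a..b} \<subseteq> {0..l}"
    proof
      fix s assume "s \<in> L ` {a..b}"
      then obtain t where t: "t \<in> {a..b}" "s = L t" by auto
      show "s \<in> {0..l}" using Lmono[of a t] Lmono[of t b] t L0 by (cases "t = a"; cases "t = b") auto
    qed
    show "{0..l} \<subseteq> L ` {a..b}"
    proof
      fix y assume "y \<in> {0..l}"
      then obtain x where "a \<le> x" "x \<le> b" "L x = y"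
        using IVT'[of L a y b] L L0 ab by auto
      then show "y \<in> L ` {a..b}" by auto
    qed
  qed
  have Linj: "u = v" if "L u = L v" "u \<in> {a..b}" "v \<in> {a..b}" for u v
    using that Lmono[of u v] Lmono[of v u] by (cases u v rule: linorder_cases) auto
  have cg: "continuous_on {0..l} g"
    unfolding continuous_on_iff using Lip by (metis dist_real_def le_less_trans)
  have gm[measurable]: "g \<in> borel_measurable (restrict_space borel {0..l})"
    by (rule borel_measurable_continuous_on_restrict[OF cg])
  have Lm[measurable]: "L \<in> borel_measurable (restrict_space borel {a..b})"
    by (rule borel_measurable_continuous_on_restrict[OF L])
  define B where "B = (\<lambda>k. {s\<in>{0..l}. \<not> (\<exists>d>0. \<forall>u v. 0 \<le> u \<longrightarrow> u \<le> s \<longrightarrow> s \<le> v \<longrightarrow> v \<le> l \<longrightarrow> v - u < d \<longrightarrow>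
    k * (v - u) \<le> dist (g u) (g v))})"
  have B: "negligible (B k)" if "0 < k" "k < 1" for k
    unfolding B_def by (rule arc_length_chord_lower_bound[OF Lip len less_imp_le[OF l0] that])
  have chord: "\<exists>d>0. \<forall>u v. L a \<le> u \<longrightarrow> u \<le> s \<longrightarrow> s \<le> v \<longrightarrow> v \<le> L b \<longrightarrow>
      v - u < d \<longrightarrow> k * (v - u) \<le> dist (g u) (g v)"
    if "0 < k" "k < 1" "s \<in> L ` {a..b} - B k" for k s
    using that unfolding onto B_def L0 by blast
  have "negligible Z" using Z(1) by (simp add: negligible_iff_null_sets null_sets_completionI)
  then have "negligible (L ` Z)"
    using arc_length_null_image[OF ab L Lmono \<gamma> B chord AC _ Z(2), of "1/2"] by auto
  then obtain W where W: "W \<in> null_sets lborel" "L ` Z \<subseteq> W"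
    unfolding negligible_iff_null_sets null_sets_completion_iff2 by auto
  have [measurable]: "W \<in> sets borel" using W(1) by auto
  define S0 where "S0 = {0..l} - W"
  have [measurable]: "S0 \<in> sets borel" by (simp add: S0_def)
  \<comment> \<open>\<open>W\<close> is a Borel null set containing the image of \<open>Z\<close>.
    Cutting \<open>\<phi> \<circ> g\<close> off there makes the superlevel sets of
    \<open>\<Phi>\<close> pull back to sets that avoid \<open>Z\<close>, where the Lipschitz
    hypothesis is available.\<close>
  define \<Phi> where "\<Phi> = (\<lambda>s. ennreal (\<phi> (g s)) * indicator S0 s)"
  define F where "F = (\<lambda>s. \<rho> (g s) / ennreal (\<phi> (g s)) * indicator {0..l} s)"
  have m1: "(\<lambda>s. ennreal (\<phi> (g s)) * indicator {0..l} s) \<in> borel_measurable borel"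
    by (subst borel_measurable_restrict_space_iff_ennreal[symmetric]) auto
  have "\<Phi> = (\<lambda>s. (ennreal (\<phi> (g s)) * indicator {0..l} s) * indicator S0 s)"
    by (auto simp: \<Phi>_def S0_def indicator_def fun_eq_iff)
  then have \<Phi>m: "\<Phi> \<in> borel_measurable borel" using m1 by simp
  have Fm: "F \<in> borel_measurable borel"
    unfolding F_def by (subst borel_measurable_restrict_space_iff_ennreal[symmetric]) auto
  define \<mu> where "\<mu> = distr (restrict_space lborel {a..b}) borel L"
  have Lm': "L \<in> measurable (restrict_space lborel {a..b}) borel"
    using Lm by (simp cong: measurable_cong_sets add: sets_restrict_space)
  have key: "(\<integral>\<^sup>+s. \<Phi> s * F s \<partial>lborel) \<le> (\<integral>\<^sup>+s. F s \<partial>\<mu>)"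
  proof (rule nn_integral_density_le)
    fix \<kappa>e S assume \<kappa>e: "\<kappa>e \<noteq> top" "\<kappa>e \<noteq> 0" and S: "S \<in> sets lborel" and le: "\<And>x. x \<in> S \<Longrightarrow> \<kappa>e \<le> \<Phi> x"
    obtain \<kappa> where \<kappa>: "\<kappa>e = ennreal \<kappa>" "\<kappa> > 0" using \<kappa>e by (cases \<kappa>e) (auto simp: ennreal_eq_0_iff not_le)
    have SS0: "S \<subseteq> S0"
    proof
      fix x assume "x \<in> S"
      then have "\<Phi> x \<noteq> 0" using le[of x] \<kappa>e(2) by auto
      then show "x \<in> S0" by (cases "x \<in> S0") (auto simp: \<Phi>_def)
    qed
    have \<kappa>le: "\<kappa> \<le> \<phi> (g s)" if "s \<in> S" for s
    proof -
      have "ennreal \<kappa> \<le> ennreal (\<phi> (g s))" using le[OF that] \<kappa>(1) SS0 that by (auto simp: \<Phi>_def)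
      then show ?thesis using \<kappa>(2) by (auto simp: ennreal_le_iff2)
    qed
    define A where "A = {t\<in>{a..b}. L t \<in> S}"
    have LA: "L ` A = S"
    proof
      show "S \<subseteq> L ` A"
      proof
        fix x assume x: "x \<in> S"
        then have "x \<in> L ` {a..b}" using SS0 unfolding onto by (auto simp: S0_def)
        then show "x \<in> L ` A" using x by (auto simp: A_def)
      qed
    qed (auto simp: A_def)
    have "L -` S \<inter> space (restrict_space borel {a..b}) \<in> sets (restrict_space borel {a..b})"
      using S by (intro measurable_sets[OF Lm]) auto
    moreover have "L -` S \<inter> space (restrict_space borel {a..b}) = A" by (auto simp: A_def space_restrict_space)
    ultimately have Ab: "A \<in> sets borel" by (auto simp: sets_restrict_space)
    have Al: "A \<in> lmeasurable"
      using Ab by (intro bounded_set_imp_lmeasurable[OF bounded_subset[OF bounded_closed_interval, of A a b]]) (auto simp: A_def)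
    have Sl: "S \<in> lmeasurable"
      using S SS0 by (intro bounded_set_imp_lmeasurable[OF bounded_subset[OF bounded_closed_interval, of S 0 l]]) (auto simp: S0_def)
    have AZ: "A \<inter> Z = {}" using W(2) SS0 by (auto simp: A_def S0_def)
    have "\<kappa> * measure lebesgue (L ` A) \<le> measure lebesgue A"
    proof (rule arc_length_image_Lipschitz[OF ab L Lmono \<gamma> B chord Al _ _ \<kappa>(2)])
      show "A \<subseteq> {a..b}" by (auto simp: A_def)
      show "L ` A \<in> lmeasurable" using LA Sl by simp
      fix t \<kappa>' assume t: "t \<in> A" and \<kappa>': "0 < \<kappa>'" "\<kappa>' < \<kappa>"
      have "\<kappa> \<le> \<phi> (\<gamma> t)" using \<kappa>le[of "L t"] t \<gamma>[of t] by (auto simp: A_def)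
      then show "\<exists>d>0. \<forall>t'\<in>{a..b}. \<bar>t' - t\<bar> < d \<longrightarrow> \<kappa>' * dist (\<gamma> t') (\<gamma> t) \<le> \<bar>t' - t\<bar>"
        using t AZ \<kappa>' by (intro lip) (auto simp: A_def)
    qed
    then have "ennreal (\<kappa> * measure lebesgue S) \<le> ennreal (measure lebesgue A)" unfolding LA by (rule ennreal_leI)
    then have "ennreal \<kappa> * emeasure lebesgue S \<le> emeasure lebesgue A"
      using \<kappa>(2) by (simp add: emeasure_eq_measure2[OF Sl] emeasure_eq_measure2[OF Al] ennreal_mult)
    then have "\<kappa>e * emeasure lborel S \<le> emeasure lborel A" using S Ab \<kappa>(1) by simp
    also have "emeasure lborel A = emeasure \<mu> S"
      unfolding \<mu>_def using S Lm' 
      by (subst emeasure_distr) (auto simp: emeasure_restrict_space space_restrict_space A_def intro!: arg_cong[where f="emeasure lborel"])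
    finally show "\<kappa>e * emeasure lborel S \<le> emeasure \<mu> S" .
  qed (auto simp: \<mu>_def \<Phi>m Fm)
  have "(\<integral>\<^sup>+s\<in>{0..l}. \<rho> (g s) \<partial>lborel) = (\<integral>\<^sup>+s. \<Phi> s * F s \<partial>lborel)"
  proof (rule nn_integral_cong_AE)
    have "AE s in lborel. s \<notin> W" using W(1) by (rule AE_not_in)
    then show "AE s in lborel. \<rho> (g s) * indicator {0..l} s = \<Phi> s * F s"
    proof eventually_elim
      case (elim s)
      show ?case
      proof (cases "s \<in> {0..l}")
        case True
        then have "s \<in> L ` {a..b}" unfolding onto .
        then obtain t where t: "t \<in> {a..b}" "s = L t" by blast
        then have "t \<notin> Z" using W(2) elim by auto
        then have "0 < \<phi> (g s)" using pos[of t] t \<gamma>[of t] by auto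
        then have "\<rho> (g s) = ennreal (\<phi> (g s)) * (\<rho> (g s) / ennreal (\<phi> (g s)))"
          by (simp add: ennreal_times_divide ennreal_mult_divide_eq mult.commute)
        then show ?thesis using True elim by (simp add: \<Phi>_def F_def S0_def)
      qed (simp add: \<Phi>_def F_def S0_def)
    qed
  qed
  also have "\<dots> \<le> (\<integral>\<^sup>+s. F s \<partial>\<mu>)" by (rule key)
  also have "\<dots> = (\<integral>\<^sup>+t. F (L t) \<partial>restrict_space lborel {a..b})"
    unfolding \<mu>_def using Fm Lm' by (intro nn_integral_distr) auto
  also have "\<dots> = (\<integral>\<^sup>+t\<in>{a..b}. F (L t) \<partial>lborel)"
    by (rule nn_integral_restrict_space) auto
  also have "\<dots> = (\<integral>\<^sup>+t\<in>{a..b}. \<rho> (\<gamma> t) / ennreal (\<phi> (\<gamma> t)) \<partial>lborel)"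
    using onto \<gamma> by (intro nn_integral_cong) (auto simp: F_def indicator_def split: if_splits)
  finally show ?thesis .
qed

section \<open>Change of variables on regular pieces\<close>

text \<open>The change of variables theory of the library requires the index type of \<open>real^'n\<close> to
  be well-ordered, so we transfer its estimate along the isometry onto the
  vectors indexed by a well-ordered copy of the index type.\<close>

typedef 'a wo_copy = "UNIV :: 'a set" by simp

instance wo_copy :: (finite) finite
proof
  have "(UNIV :: 'a wo_copy set) = range Abs_wo_copy"
    by (metis Rep_wo_copy_inverse surjI)
  then show "finite (UNIV :: 'a wo_copy set)" by (metis finite finite_imageI)
qed

definition wo_rank :: "'a::finite wo_copy \<Rightarrow> nat" where
  "wo_rank x = to_nat_on UNIV (Rep_wo_copy x)"

lemma inj_wo_rank: "wo_rank x = wo_rank y \<Longrightarrow> x = y"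
  using inj_on_to_nat_on[OF countable_finite[OF finite[of "UNIV :: 'a set"]]]
  by (auto simp: wo_rank_def inj_def Rep_wo_copy_inject)

instantiation wo_copy :: (finite) wellorder
begin

definition "x \<le> y \<longleftrightarrow> wo_rank x \<le> wo_rank y"
definition "x < y \<longleftrightarrow> wo_rank x < wo_rank y"

instance
proof
  fix P :: "'a wo_copy \<Rightarrow> bool" and a
  assume "\<And>x. (\<And>y. y < x \<Longrightarrow> P y) \<Longrightarrow> P x"
  then show "P a"
    unfolding less_wo_copy_def by (induction a rule: measure_induct_rule[of wo_rank]) blast
qed (auto simp: less_eq_wo_copy_def less_wo_copy_def inj_wo_rank)

end

lemma bij_Rep_wo_copy: "bij Rep_wo_copy"
  by (rule o_bij[where g=Abs_wo_copy]) (auto simp: fun_eq_iff Rep_wo_copy_inverse Abs_wo_copy_inverse)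

definition vec_to_copy :: "real^'n \<Rightarrow> real^('n::finite wo_copy)" where
  "vec_to_copy x = (\<chi> i. x $ Rep_wo_copy i)"

definition vec_of_copy :: "real^('n::finite wo_copy) \<Rightarrow> real^'n" where
  "vec_of_copy y = (\<chi> i. y $ Abs_wo_copy i)"

lemma vec_copy_inverse [simp]:
  "vec_of_copy (vec_to_copy x) = x" "vec_to_copy (vec_of_copy y) = y"
  by (simp_all add: vec_eq_iff vec_of_copy_def vec_to_copy_def Abs_wo_copy_inverse Rep_wo_copy_inverse)

lemma bounded_linear_vec_to_copy: "bounded_linear vec_to_copy"
  unfolding linear_conv_bounded_linear[symmetric]
  by (rule linearI) (simp_all add: vec_eq_iff vec_to_copy_def)

lemma bounded_linear_vec_of_copy: "bounded_linear vec_of_copy"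
  unfolding linear_conv_bounded_linear[symmetric]
  by (rule linearI) (simp_all add: vec_eq_iff vec_of_copy_def)

lemma measurable_vec_copy [measurable]:
  "vec_to_copy \<in> borel_measurable borel" "vec_of_copy \<in> borel_measurable borel"
  by (intro borel_measurable_continuous_onI linear_continuous_on bounded_linear_vec_to_copy bounded_linear_vec_of_copy)+

lemma prod_Basis_cart:
  fixes h :: "real^'n \<Rightarrow> 'c::comm_monoid_mult"
  shows "(\<Prod>b\<in>Basis. h b) = (\<Prod>i\<in>UNIV. h (axis i (1::real)))"
proof -
  have B: "(Basis :: (real^'n) set) = (\<lambda>i. axis i 1) ` UNIV" by (auto simp: Basis_vec_def)
  have "inj (\<lambda>i::'n. axis i (1::real))" by (auto simp: inj_def axis_eq_axis)
  then show ?thesis unfolding B by (subst prod.reindex) (auto simp: comp_def)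
qed

text \<open>Relabelling coordinates only permutes the factors in the volume of a box, and box
  volumes determine \<open>lborel\<close>.\<close>

lemma distr_lborel_vec_of_copy: "distr lborel borel vec_of_copy = (lborel :: (real^'n) measure)"
proof (rule lborel_eqI[symmetric])
  fix l u :: "real^'n" assume le: "\<And>b. b \<in> Basis \<Longrightarrow> l \<bullet> b \<le> u \<bullet> b"
  have le': "l $ i \<le> u $ i" for i using le[of "axis i 1"] by (simp add: inner_axis)
  have "vec_of_copy -` box l u = box (vec_to_copy l) (vec_to_copy u)"
    by (auto simp: mem_box_cart vec_of_copy_def vec_to_copy_def; metis Abs_wo_copy_inverse Rep_wo_copy_inverse UNIV_I)
  then have "emeasure (distr lborel borel vec_of_copy) (box l u) = emeasure lborel (box (vec_to_copy l) (vec_to_copy u))"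
    by (simp add: emeasure_distr)
  also have "\<dots> = (\<Prod>b\<in>Basis. (vec_to_copy u - vec_to_copy l) \<bullet> b)"
    using le' by (intro emeasure_lborel_box) (auto simp: Basis_vec_def inner_axis vec_to_copy_def)
  also have "(\<Prod>b\<in>Basis. (vec_to_copy u - vec_to_copy l) \<bullet> b) = (\<Prod>i\<in>UNIV. (u - l) $ Rep_wo_copy i)"
    by (simp add: prod_Basis_cart inner_axis vec_to_copy_def)
  also have "\<dots> = (\<Prod>i\<in>UNIV. (u - l) $ i)"
    by (rule prod.reindex_bij_betw[OF bij_Rep_wo_copy])
  also have "\<dots> = (\<Prod>b\<in>Basis. (u - l) \<bullet> b)" by (simp add: prod_Basis_cart inner_axis)
  finally show "emeasure (distr lborel borel vec_of_copy) (box l u) = ennreal (\<Prod>b\<in>Basis. (u - l) \<bullet> b)" .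
qed simp

text \<open>Conjugation by \<open>e\<close> matches the permutations of the two index types and
  preserves signs, so the Leibniz sums agree term by term.\<close>

lemma det_reindex:
  fixes A :: "real^'n^'n" and e :: "'m::finite \<Rightarrow> 'n"
  assumes e: "bij e"
  shows "det (\<chi> i j. A $ e i $ e j :: real^'m^'m) = det A"
proof -
  have inj: "inj_on e UNIV" using e by (simp add: bij_is_inj)
  have surj: "e ` UNIV = UNIV" using e by (simp add: bij_is_surj)
  have "det A = (\<Sum>p | p permutes (UNIV :: 'm set). of_int (sign (map_permutation UNIV e p)) *
      (\<Prod>i\<in>UNIV. A $ i $ map_permutation UNIV e p i))"
    unfolding det_def
  proof (rule sum.reindex_bij_betw[symmetric])
    show "bij_betw (map_permutation UNIV e) {p. p permutes (UNIV :: 'm set)} {p. p permutes (UNIV :: 'n set)}"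
    proof (rule bij_betw_byWitness[where f' = "map_permutation UNIV (inv e)"])
      show "\<forall>p\<in>{p. p permutes (UNIV :: 'm set)}. map_permutation UNIV (inv e) (map_permutation UNIV e p) = p"
        using e inj surj by (auto intro!: map_permutation_compose_inv simp: bij_betw_def inv_f_f bij_imp_bij_inv bij_is_inj)
      show "\<forall>p\<in>{p. p permutes (UNIV :: 'n set)}. map_permutation UNIV e (map_permutation UNIV (inv e) p) = p"
        using e inj surj bij_imp_bij_inv[OF e]
        by (auto intro!: map_permutation_compose_inv simp: bij_betw_def surj_f_inv_f)
    qed (use e bij_imp_bij_inv[OF e] in \<open>auto intro!: map_permutation_permutes simp: bij_betw_def\<close>)
  qed
  also have "\<dots> = det (\<chi> i j. A $ e i $ e j)"
    unfolding det_def
  proof (rule sum.cong[OF refl])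
    fix p assume "p \<in> {p. p permutes (UNIV :: 'm set)}"
    then have p: "p permutes (UNIV :: 'm set)" by simp
    have "sign (map_permutation UNIV e p) = sign p" using p inj by (intro sign_map_permutation) auto
    moreover have "(\<Prod>i\<in>UNIV. A $ i $ map_permutation UNIV e p i) = (\<Prod>i\<in>UNIV. A $ e i $ e (p i))"
      by (subst prod.reindex_bij_betw[OF e, symmetric]) (simp add: map_permutation_apply[OF inj])
    ultimately show "of_int (sign (map_permutation UNIV e p)) * (\<Prod>i\<in>UNIV. A $ i $ map_permutation UNIV e p i) =
      of_int (sign p) * (\<Prod>i\<in>UNIV. (\<chi> i j. A $ e i $ e j) $ i $ p i)" by simp
  qed
  finally show ?thesis by simp
qed

text \<open>\<open>J\<close> is a Borel function that has to agree with the Jacobian only on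
  \<open>S\<close>, so the bound can be read as an extended-real integral. An infinite bound is
  trivial; a finite one supplies the integrability on which the area estimate rests. Overlaps of the
  image are counted once, hence an inequality.\<close>

lemma emeasure_differentiable_image_wellorder:
  fixes f :: "real^'m::{finite,wellorder} \<Rightarrow> real^'m::_"
  assumes S: "S \<in> sets borel" and der: "\<And>x. x \<in> S \<Longrightarrow> (f has_derivative f' x) (at x within S)"
    and J[measurable]: "J \<in> borel_measurable borel" and det: "\<And>x. x \<in> S \<Longrightarrow> J x = \<bar>det (matrix (f' x))\<bar>"
  shows "emeasure lebesgue (f ` S) \<le> (\<integral>\<^sup>+x\<in>S. ennreal (J x) \<partial>lborel)"
proof (cases "(\<integral>\<^sup>+x\<in>S. ennreal (J x) \<partial>lborel) = \<infinity>")
  case False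
  note [measurable] = S
  let ?h = "\<lambda>x. indicator S x * J x"
  have eq: "(\<integral>\<^sup>+x. ennreal (?h x) \<partial>lborel) = (\<integral>\<^sup>+x\<in>S. ennreal (J x) \<partial>lborel)"
    by (intro nn_integral_cong) (auto simp: indicator_def)
  have nonneg: "0 \<le> ?h x" for x using det by (auto simp: indicator_def)
  have int: "integrable lborel ?h"
    using False nonneg by (intro integrableI_nonneg) (auto simp: eq less_top)
  have "(?h has_integral integral\<^sup>L lborel ?h) UNIV" using int by (rule has_integral_integral_lborel)
  moreover have "?h = (\<lambda>x. if x \<in> S then J x else 0)" by (auto simp: indicator_def)
  ultimately have "(J has_integral integral\<^sup>L lborel ?h) S" by (simp add: has_integral_restrict_UNIV)
  then have I: "((\<lambda>x. \<bar>det (matrix (f' x))\<bar>) has_integral integral\<^sup>L lborel ?h) S"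
    using det by (rule has_integral_eq[rotated]) auto
  have Sl: "S \<in> sets lebesgue" using S by simp
  have "f ` S \<in> lmeasurable" "measure lebesgue (f ` S) \<le> integral\<^sup>L lborel ?h"
    using measurable_differentiable_image[OF Sl der] measure_differentiable_image[OF Sl der] I
      integral_unique[OF I] by (auto simp: has_integral_integrable)
  then have "emeasure lebesgue (f ` S) \<le> ennreal (integral\<^sup>L lborel ?h)"
    by (simp add: emeasure_eq_measure2 ennreal_leI)
  also have "\<dots> = (\<integral>\<^sup>+x\<in>S. ennreal (J x) \<partial>lborel)"
    using nonneg by (subst nn_integral_eq_integral[symmetric, OF int]) (auto simp: eq)
  finally show ?thesis .
qed simp

lemma emeasure_differentiable_image_le:
  fixes f :: "real^'n \<Rightarrow> real^'n"
  assumes S: "S \<in> sets borel" "f ` S \<in> sets borel" and der: "\<And>x. x \<in> S \<Longrightarrow> (f has_derivative f' x) (at x within S)"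
    and J[measurable]: "J \<in> borel_measurable borel" and det: "\<And>x. x \<in> S \<Longrightarrow> J x = \<bar>det (matrix (f' x))\<bar>"
  shows "emeasure lborel (f ` S) \<le> (\<integral>\<^sup>+x\<in>S. ennreal (J x) \<partial>lborel)"
proof -
  note [measurable] = S
  define g where "g = vec_to_copy \<circ> f \<circ> vec_of_copy"
  define g' where "g' = (\<lambda>y. vec_to_copy \<circ> f' (vec_of_copy y) \<circ> vec_of_copy)"
  define T where "T = vec_of_copy -` S"
  have Tb: "T \<in> sets borel" unfolding T_def using measurable_sets[OF measurable_vec_copy(2) S(1)] by simp
  have "vec_of_copy ` T = S"
  proof -
    have "x \<in> vec_of_copy ` T" if "x \<in> S" for x
      using that by (intro image_eqI[of _ _ "vec_to_copy x"]) (auto simp: T_def)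
    then show ?thesis by (auto simp: T_def)
  qed
  \<comment> \<open>Written as a preimage under \<open>vec_of_copy\<close>, the image has a measure
    that is read off the push-forward of Lebesgue measure.\<close>
  have gT: "g ` T = vec_of_copy -` (f ` S)"
  proof -
    have "y \<in> g ` T" if y: "vec_of_copy y \<in> f ` S" for y
    proof -
      obtain x where x: "x \<in> S" "vec_of_copy y = f x" using y by auto
      have "y = g (vec_to_copy x)" using x(2)[symmetric] by (simp add: g_def)
      then show ?thesis using x(1) by (auto simp: T_def)
    qed
    then show ?thesis by (auto simp: g_def T_def)
  qed
  have derg: "(g has_derivative g' y) (at y within T)" if y: "y \<in> T" for y
  proof -
    have "(f has_derivative f' (vec_of_copy y)) (at (vec_of_copy y) within vec_of_copy ` T)"
      unfolding \<open>vec_of_copy ` T = S\<close> using y by (intro der) (auto simp: T_def)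
    then have "(f \<circ> vec_of_copy has_derivative f' (vec_of_copy y) \<circ> vec_of_copy) (at y within T)"
      by (rule diff_chain_within[OF bounded_linear_imp_has_derivative[OF bounded_linear_vec_of_copy]])
    then show ?thesis
      unfolding g_def g'_def comp_assoc
      by (rule diff_chain_within) (rule bounded_linear_imp_has_derivative[OF bounded_linear_vec_to_copy])
  qed
  have mat: "matrix (g' y) = (\<chi> i j. matrix (f' (vec_of_copy y)) $ Rep_wo_copy i $ Rep_wo_copy j)" for y
  proof -
    have ax: "vec_of_copy (axis j (1::real)) = axis (Rep_wo_copy j) 1" for j :: "'n wo_copy"
      by (auto simp: vec_eq_iff vec_of_copy_def axis_def Abs_wo_copy_inverse Rep_wo_copy_inverse)
    show ?thesis by (simp add: vec_eq_iff matrix_def g'_def vec_to_copy_def ax)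
  qed
  have "emeasure lborel (f ` S) = emeasure (distr lborel borel vec_of_copy) (f ` S)"
    by (simp add: distr_lborel_vec_of_copy)
  also have "\<dots> = emeasure lborel (g ` T)" using S by (simp add: emeasure_distr gT)
  also have "\<dots> = emeasure lebesgue (g ` T)"
    using measurable_sets[OF measurable_vec_copy(2) S(2)] by (simp add: gT)
  also have "\<dots> \<le> (\<integral>\<^sup>+y\<in>T. ennreal (J (vec_of_copy y)) \<partial>lborel)"
  proof (rule emeasure_differentiable_image_wellorder[OF Tb derg])
    show "J (vec_of_copy y) = \<bar>det (matrix (g' y))\<bar>" if "y \<in> T" for y
      using det[of "vec_of_copy y"] that by (simp add: mat T_def det_reindex[OF bij_Rep_wo_copy])
  qed auto
  also have "\<dots> = (\<integral>\<^sup>+y. ennreal (J (vec_of_copy y)) * indicator S (vec_of_copy y) \<partial>lborel)"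
    by (intro nn_integral_cong) (auto simp: T_def indicator_def)
  also have "\<dots> = (\<integral>\<^sup>+x. ennreal (J x) * indicator S x \<partial>distr lborel borel vec_of_copy)"
    by (rule nn_integral_distr[symmetric]) auto
  finally show ?thesis by (simp add: distr_lborel_vec_of_copy)
qed

text \<open>On Borel subsets of a compact set on which \<open>f\<close> is injective, images are Borel because the
  inverse is continuous.\<close>

lemma nn_integral_injective_piece_le:
  fixes f :: "real^'n \<Rightarrow> real^'n"
  assumes C: "compact C" "continuous_on C f" "inj_on f C" and G: "G \<in> sets borel" "G \<subseteq> C"
    and der: "\<And>x. x \<in> G \<Longrightarrow> (f has_derivative f' x) (at x)"
    and J[measurable]: "J \<in> borel_measurable borel" and det: "\<And>x. x \<in> G \<Longrightarrow> J x = \<bar>det (matrix (f' x))\<bar>"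
    and H[measurable]: "H \<in> borel_measurable borel"
  shows "(\<lambda>y. H (inv_into C f y) * indicator (f ` G) y) \<in> borel_measurable borel"
    and "(\<integral>\<^sup>+y. H (inv_into C f y) * indicator (f ` G) y \<partial>lborel) \<le> (\<integral>\<^sup>+x. ennreal (J x) * H x * indicator G x \<partial>lborel)"
proof -
  note [measurable] = G(1)
  let ?i = "inv_into C f"
  have ci: "continuous_on (f ` C) ?i" by (rule continuous_on_inv[OF C(2,1)]) (simp add: C(3))
  have fCb: "f ` C \<in> sets borel" using C by (intro borel_compact compact_continuous_image)
  have im: "?i \<in> measurable (restrict_space borel (f ` C)) borel"
    by (rule borel_measurable_continuous_on_restrict[OF ci])
  have fA: "f ` A = {y \<in> f ` C. ?i y \<in> A}" if "A \<subseteq> C" for A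
    using that C(3) by (auto simp: inv_into_f_f f_inv_into_f subset_iff image_iff) 
  have fAb: "f ` A \<in> sets borel" if "A \<in> sets borel" "A \<subseteq> C" for A
  proof -
    have "?i -` A \<inter> space (restrict_space borel (f ` C)) \<in> sets (restrict_space borel (f ` C))"
      by (rule measurable_sets[OF im that(1)])
    moreover have "?i -` A \<inter> space (restrict_space borel (f ` C)) = f ` A"
      using fA[OF that(2)] by (auto simp: space_restrict_space)
    ultimately show ?thesis using fCb by (auto simp: sets_restrict_space)
  qed
  have fG[measurable]: "f ` G \<in> sets borel" using fAb G by auto
  have im': "?i \<in> measurable (restrict_space borel (f ` G)) borel"
    using G(2) by (intro borel_measurable_continuous_on_restrict continuous_on_subset[OF ci] image_mono)
  show "(\<lambda>y. H (?i y) * indicator (f ` G) y) \<in> borel_measurable borel"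
    using im' by (subst borel_measurable_restrict_space_iff_ennreal[symmetric]) auto
  have im2: "?i \<in> measurable (restrict_space lborel (f ` G)) borel"
    using im' by (simp cong: measurable_cong_sets add: sets_restrict_space)
  \<comment> \<open>\<open>M\<close> assigns to \<open>A\<close> the measure of the image of
    \<open>G \<inter> A\<close>. The area estimate for all Borel \<open>A\<close> bounds
    \<open>M\<close> by the measure with density \<open>J\<close> on \<open>G\<close>, and
    integrating \<open>H\<close> passes from sets to functions.\<close>
  define M where "M = distr (restrict_space lborel (f ` G)) borel ?i"
  have "M \<le> density lborel (\<lambda>x. ennreal (J x) * indicator G x)"
  proof (subst le_measure)
    show "\<forall>A\<in>sets M. emeasure M A \<le> emeasure (density lborel (\<lambda>x. ennreal (J x) * indicator G x)) A"
    proof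
      fix A assume "A \<in> sets M"
      then have A[measurable]: "A \<in> sets borel" by (simp add: M_def)
      have eq: "?i -` A \<inter> f ` G = f ` (G \<inter> A)"
        using G(2) C(3) by (auto simp: inv_into_f_f subset_iff image_iff)
      have "emeasure M A = emeasure lborel (f ` (G \<inter> A))"
        unfolding M_def using im2 A
        by (subst emeasure_distr) (auto simp: space_restrict_space eq intro!: emeasure_restrict_space)
      also have "\<dots> \<le> (\<integral>\<^sup>+x\<in>G \<inter> A. ennreal (J x) \<partial>lborel)"
        using G det by (intro emeasure_differentiable_image_le fAb) (auto intro: has_derivative_at_withinI[OF der])
      also have "\<dots> = emeasure (density lborel (\<lambda>x. ennreal (J x) * indicator G x)) A"
        by (subst emeasure_density) (auto intro!: nn_integral_cong simp: indicator_def)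
      finally show "emeasure M A \<le> emeasure (density lborel (\<lambda>x. ennreal (J x) * indicator G x)) A" .
    qed
  qed (simp add: M_def)
  then have "(\<integral>\<^sup>+x. H x \<partial>M) \<le> (\<integral>\<^sup>+x. H x \<partial>density lborel (\<lambda>x. ennreal (J x) * indicator G x))"
    by (intro nn_integral_mono_measure) (auto simp: M_def)
  also have "\<dots> = (\<integral>\<^sup>+x. ennreal (J x) * H x * indicator G x \<partial>lborel)"
    by (subst nn_integral_density) (auto intro!: nn_integral_cong simp: mult_ac)
  also have "(\<integral>\<^sup>+x. H x \<partial>M) = (\<integral>\<^sup>+y. H (?i y) \<partial>restrict_space lborel (f ` G))"
    unfolding M_def using im2 by (intro nn_integral_distr) auto
  also have "\<dots> = (\<integral>\<^sup>+y. H (?i y) * indicator (f ` G) y \<partial>lborel)"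
    by (rule nn_integral_restrict_space) auto
  finally show "(\<integral>\<^sup>+y. H (?i y) * indicator (f ` G) y \<partial>lborel) \<le> (\<integral>\<^sup>+x. ennreal (J x) * H x * indicator G x \<partial>lborel)" .
qed

section \<open>Minimal stretch and measurability of derivative data\<close>

lemma min_stretch_le:
  fixes A :: "'a::euclidean_space \<Rightarrow> 'b::real_normed_vector"
  assumes "bounded_linear A"
  shows "min_stretch A * norm h \<le> norm (A h)"
proof (cases "h = 0")
  case False
  interpret A: bounded_linear A by fact
  have "bdd_below {norm (A h) | h. norm h = 1}" by (intro bdd_belowI[of _ 0]) auto
  moreover have "norm (A (inverse (norm h) *\<^sub>R h)) \<in> {norm (A h) | h. norm h = 1}"
    using False by force
  ultimately have "min_stretch A \<le> norm (A (inverse (norm h) *\<^sub>R h))"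
    unfolding min_stretch_def by (rule cInf_lower[rotated])
  also have "\<dots> = norm (A h) / norm h" by (simp add: A.scaleR divide_inverse mult.commute)
  finally show ?thesis using False by (simp add: field_simps)
next
  case True then show ?thesis by (simp add: linear_0[OF bounded_linear.linear[OF assms]])
qed

lemma le_min_stretchI:
  fixes A :: "'a::euclidean_space \<Rightarrow> 'b::real_normed_vector"
  assumes "\<And>h. r * norm h \<le> norm (A h)"
  shows "r \<le> min_stretch A"
  unfolding min_stretch_def
proof (rule cInf_greatest)
  obtain b :: 'a where "b \<in> Basis" using nonempty_Basis by blast
  then have "norm (A b) \<in> {norm (A h) | h. norm h = 1}" by auto
  then show "{norm (A h) | h. norm h = 1} \<noteq> {}" by blast
  show "r \<le> x" if "x \<in> {norm (A h) | h. norm h = 1}" for x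
  proof -
    obtain h where "x = norm (A h)" "norm h = 1" using \<open>x \<in> _\<close> by auto
    then show ?thesis using assms[of h] by simp
  qed
qed

lemma min_stretch_pos:
  fixes A :: "real^'n \<Rightarrow> real^'n"
  assumes "bounded_linear A" "det (matrix A) \<noteq> 0"
  shows "0 < min_stretch A"
proof -
  have lin: "linear A" using assms(1) by (rule bounded_linear.linear)
  then have "inj A" using assms(2) det_nz_iff_inj by blast
  then obtain B where B: "B > 0" "\<And>x. B * norm x \<le> norm (A x)"
    using linear_inj_bounded_below_pos[OF lin] by blast
  have "B \<le> min_stretch A" by (rule le_min_stretchI[OF B(2)])
  then show ?thesis using B(1) by linarith
qed

text \<open>The slack between \<open>k\<close> and the minimal stretch absorbs the remainder of the
  linear approximation.\<close>

lemma differentiable_lower_bound: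
  fixes f :: "'a::euclidean_space \<Rightarrow> 'b::real_normed_vector"
  assumes f: "f differentiable (at x)" and k: "k < min_stretch (frechet_derivative f (at x))"
  shows "\<exists>d>0. \<forall>y. dist y x < d \<longrightarrow> k * dist y x \<le> dist (f y) (f x)"
proof -
  let ?A = "frechet_derivative f (at x)"
  have der: "(f has_derivative ?A) (at x)" using f frechet_derivative_works by blast
  define e where "e = min_stretch ?A - k"
  have "e > 0" using k by (simp add: e_def)
  then obtain d where d: "d > 0" "\<And>y. norm (y - x) < d \<Longrightarrow> norm (f y - f x - ?A (y - x)) \<le> e * norm (y - x)"
    using der unfolding has_derivative_at_alt by blast
  have "k * dist y x \<le> dist (f y) (f x)" if "dist y x < d" for y
  proof -
    have "min_stretch ?A * norm (y - x) \<le> norm (?A (y - x))"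
      by (rule min_stretch_le[OF has_derivative_bounded_linear[OF der]])
    also have "\<dots> \<le> norm (f y - f x) + norm (f y - f x - ?A (y - x))"
      by (metis norm_minus_commute norm_triangle_sub add.commute)
    also have "\<dots> \<le> norm (f y - f x) + e * norm (y - x)" using d(2)[of y] that by (simp add: dist_norm)
    finally show ?thesis by (simp add: e_def dist_norm algebra_simps)
  qed
  then show ?thesis using d(1) by blast
qed

text \<open>A pointwise limit of difference quotients with steps \<open>1 / Suc n\<close>. Extending
  \<open>f\<close> by zero makes the quotients Borel on the whole space; since \<open>D\<close> is
  open, they eventually see only values of \<open>f\<close> itself.\<close>

lemma borel_measurable_directional_derivative:
  fixes f :: "'a::euclidean_space \<Rightarrow> 'b::euclidean_space"
  assumes D: "open D" "continuous_on D f" and E: "E \<in> sets lebesgue" "E \<subseteq> D"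
    and diff: "\<And>x. x \<in> E \<Longrightarrow> f differentiable (at x)"
  shows "(\<lambda>x. frechet_derivative f (at x) h) \<in> borel_measurable (lebesgue_on E)"
proof -
  define f0 where "f0 = (\<lambda>x. indicator D x *\<^sub>R f x)"
  have f0[measurable]: "f0 \<in> borel_measurable borel"
    unfolding f0_def using D by (intro borel_measurable_continuous_on_indicator) auto
  define q where "q = (\<lambda>n x. real (Suc n) *\<^sub>R (f0 (x + (1 / real (Suc n)) *\<^sub>R h) - f0 x))"
  have "q n \<in> borel_measurable borel" for n unfolding q_def by measurable
  then have "q n \<in> borel_measurable lebesgue" for n
    using measurable_completion[of "q n" lborel borel] by simp
  then have qm: "q n \<in> borel_measurable (lebesgue_on E)" for n by (rule measurable_restrict_space1)
  show ?thesis
  proof (rule borel_measurable_LIMSEQ_metric[OF qm])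
    fix x assume "x \<in> space (lebesgue_on E)"
    then have x: "x \<in> E" by (simp add: space_restrict_space)
    let ?A = "frechet_derivative f (at x)"
    have der: "(f has_derivative ?A) (at x)" using diff[OF x] frechet_derivative_works by blast
    interpret A: bounded_linear ?A using der by (rule has_derivative_bounded_linear)
    have y0: "(\<lambda>n. x + (1 / real (Suc n)) *\<^sub>R h) \<longlonglongrightarrow> x + 0 *\<^sub>R h"
      by (intro tendsto_intros lim_inverse_n' LIMSEQ_Suc[OF lim_1_over_n])
    have evD: "\<forall>\<^sub>F n in sequentially. x + (1 / real (Suc n)) *\<^sub>R h \<in> D"
      using y0 D(1) x E(2) by (intro topological_tendstoD[OF y0]) auto
    show "(\<lambda>n. q n x) \<longlonglongrightarrow> ?A h"
    proof (rule metric_LIMSEQ_I)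
      fix r :: real assume r: "r > 0"
      define e where "e = r / (norm h + 1)"
      have e: "e > 0" "e * norm h < r" using r by (auto simp: e_def field_simps add_pos_nonneg)
      obtain d where d: "d > 0" "\<And>y. norm (y - x) < d \<Longrightarrow> norm (f y - f x - ?A (y - x)) \<le> e * norm (y - x)"
        using der e(1) unfolding has_derivative_at_alt by blast
      have "\<forall>\<^sub>F n in sequentially. dist (x + (1 / real (Suc n)) *\<^sub>R h) x < d"
        using tendstoD[OF y0 d(1)] by simp
      then have "\<forall>\<^sub>F n in sequentially. dist (q n x) (?A h) < r"
        using evD
      proof eventually_elim
        case (elim n)
        let ?y = "x + (1 / real (Suc n)) *\<^sub>R h"
        have yx: "?y - x = (1 / real (Suc n)) *\<^sub>R h" by simp
        have "norm (f ?y - f x - ?A (?y - x)) \<le> e * norm (?y - x)" using elim(1) by (intro d(2)) (simp add: dist_norm)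
        then have "real (Suc n) * norm (f ?y - f x - ?A (?y - x)) \<le> real (Suc n) * (e * norm (?y - x))"
          by (intro mult_left_mono) auto
        also have "\<dots> = e * norm h" unfolding yx by simp
        finally have "norm (real (Suc n) *\<^sub>R (f ?y - f x - ?A (?y - x))) \<le> e * norm h" by simp
        moreover have "real (Suc n) *\<^sub>R (f ?y - f x - ?A (?y - x)) = q n x - ?A h"
        proof -
          have "real (Suc n) *\<^sub>R ?A (?y - x) = ?A h" unfolding yx by (simp add: A.scaleR del: of_nat_Suc)
          then show ?thesis using elim(2) x E(2) by (simp add: q_def f0_def scaleR_diff_right subset_iff del: of_nat_Suc)
        qed
        ultimately have "norm (q n x - ?A h) \<le> e * norm h" by (simp only:)
        then show ?case using e(2) by (simp add: dist_norm)
      qed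
      then show "\<exists>no. \<forall>n\<ge>no. dist (q n x) (?A h) < r" by (simp add: eventually_sequentially)
    qed
  qed
qed

text \<open>In the homogeneous form \<open>r * norm h \<le> norm (A h)\<close>, the condition
  \<open>r \<le> min_stretch A\<close> is closed in \<open>h\<close> and may be tested on a
  countable dense subset of the whole space instead of on the unit sphere.\<close>

lemma borel_measurable_min_stretch:
  fixes f :: "'a::euclidean_space \<Rightarrow> 'b::euclidean_space"
  assumes "open D" "continuous_on D f" "E \<in> sets lebesgue" "E \<subseteq> D"
    and diff: "\<And>x. x \<in> E \<Longrightarrow> f differentiable (at x)"
  shows "(\<lambda>x. min_stretch (frechet_derivative f (at x))) \<in> borel_measurable (lebesgue_on E)"
proof -
  have [measurable]: "(\<lambda>x. frechet_derivative f (at x) h) \<in> borel_measurable (lebesgue_on E)" for h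
    by (rule borel_measurable_directional_derivative[OF assms])
  obtain Q :: "'a set" where Q: "countable Q" "\<And>X. open X \<Longrightarrow> X \<noteq> {} \<Longrightarrow> \<exists>d\<in>Q. d \<in> X"
    using countable_dense_setE by blast
  have iff: "r \<le> min_stretch (frechet_derivative f (at x)) \<longleftrightarrow>
      (\<forall>h\<in>Q. r * norm h \<le> norm (frechet_derivative f (at x) h))" if x: "x \<in> E" for x r
  proof
    let ?A = "frechet_derivative f (at x)"
    have bl: "bounded_linear ?A"
      using diff[OF x] frechet_derivative_works has_derivative_bounded_linear by blast
    show "\<forall>h\<in>Q. r * norm h \<le> norm (?A h)" if "r \<le> min_stretch ?A"
    proof
      fix h :: 'a
      have "r * norm h \<le> min_stretch ?A * norm h" using that by (intro mult_right_mono) auto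
      then show "r * norm h \<le> norm (?A h)" using min_stretch_le[OF bl, of h] by linarith
    qed
    assume *: "\<forall>h\<in>Q. r * norm h \<le> norm (?A h)"
    have op: "open {h. norm (?A h) < r * norm h}"
      using bl by (intro open_Collect_less continuous_intros linear_continuous_on)
    have "r * norm h \<le> norm (?A h)" for h
    proof (rule ccontr)
      assume "\<not> r * norm h \<le> norm (?A h)"
      then have "{h. norm (?A h) < r * norm h} \<noteq> {}" by (auto simp: not_le)
      then show False using Q(2)[OF op] * by force
    qed
    then show "r \<le> min_stretch ?A" by (rule le_min_stretchI)
  qed
  show ?thesis
    unfolding borel_measurable_iff_ge
  proof
    fix r
    have "{x \<in> space (lebesgue_on E). r \<le> min_stretch (frechet_derivative f (at x))} =
      {x \<in> space (lebesgue_on E). \<forall>h\<in>Q. r * norm h \<le> norm (frechet_derivative f (at x) h)}"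
      using iff by (auto simp: space_restrict_space)
    also have "\<dots> \<in> sets (lebesgue_on E)"
      using Q(1) by (intro sets.sets_Collect_countable_All') measurable
    finally show "{x \<in> space (lebesgue_on E). r \<le> min_stretch (frechet_derivative f (at x))} \<in> sets (lebesgue_on E)" .
  qed
qed

lemma borel_measurable_jacobian_det:
  assumes "open D" "continuous_on D f" "E \<in> sets lebesgue" "E \<subseteq> D"
    and "\<And>x. x \<in> E \<Longrightarrow> f differentiable (at x)"
  shows "jacobian_det f \<in> borel_measurable (lebesgue_on E)"
proof -
  have [measurable]: "(\<lambda>x. frechet_derivative f (at x) h) \<in> borel_measurable (lebesgue_on E)" for h
    by (rule borel_measurable_directional_derivative[OF assms])
  have [measurable]: "(\<lambda>x. frechet_derivative f (at x) h $ i) \<in> borel_measurable (lebesgue_on E)" for h i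
    by (rule borel_measurable_continuous_on[where f="\<lambda>y. y $ i" and g="\<lambda>x. frechet_derivative f (at x) h"])
       (auto intro!: continuous_intros)
  show ?thesis unfolding jacobian_det_def det_def matrix_def by simp
qed

text \<open>Admissible functions have to be Borel, while minimal stretch and Jacobian are only
  Lebesgue measurable; the points where a Borel replacement differs are moved to the exceptional
  set.\<close>

lemma lebesgue_on_ex_borel:
  fixes h :: "'a::euclidean_space \<Rightarrow> real"
  assumes h: "h \<in> borel_measurable (lebesgue_on E)" and E: "E \<in> sets lebesgue"
  obtains h' where "h' \<in> borel_measurable borel" "negligible {x\<in>E. h x \<noteq> h' x}"
proof -
  have "(\<lambda>x. if x \<in> E then h x else 0) \<in> borel_measurable lebesgue"
    using h E borel_measurable_if by blast
  then obtain h' where h': "h' \<in> borel_measurable lborel" "AE x in lborel. (if x \<in> E then h x else 0) = h' x"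
    using completion_ex_borel_measurable_real by blast
  then obtain N where N: "N \<in> null_sets lborel" "{x. (if x \<in> E then h x else 0) \<noteq> h' x} \<subseteq> N"
    unfolding eventually_ae_filter by auto
  then have "negligible N" by (simp add: negligible_iff_null_sets null_sets_completionI)
  then have "negligible {x\<in>E. h x \<noteq> h' x}" by (rule negligible_subset) (use N(2) in auto)
  then show ?thesis using that h'(1) by simp
qed

section \<open>Decomposition of the domain into injective pieces\<close>

lemma lebesgue_set_compact_Union:
  fixes E :: "'a::euclidean_space set"
  assumes "E \<in> sets lebesgue"
  obtains K :: "nat \<Rightarrow> 'a set" and T where "\<And>i. compact (K i)" "negligible T" "E = (\<Union>i. K i) \<union> T"
proof -
  obtain C T where CT: "fsigma C" "negligible T" "C \<union> T = E"
    using lebesgue_set_almost_fsigma[OF assms] by (metis negligible_iff_null_sets)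
  obtain K :: "nat \<Rightarrow> 'a set" where "range K \<subseteq> Collect compact" "C = \<Union>(range K)"
    using CT(1) fsigma_Union_compact by metis
  then show ?thesis using that[of K T] CT by auto
qed

text \<open>The area estimate with Jacobian zero settles each compact part, whose compactness makes
  the image Borel. The null remainder \<open>T\<close> is covered by the
  \<open>N\<close>-property.\<close>

lemma negligible_image_critical:
  fixes f :: "real^'n \<Rightarrow> real^'n"
  assumes D: "open D" "continuous_on D f" and N: "N_property D f" and S: "S \<in> sets lebesgue" "S \<subseteq> D"
    and diff: "\<And>x. x \<in> S \<Longrightarrow> f differentiable (at x)" and crit: "\<And>x. x \<in> S \<Longrightarrow> jacobian_det f x = 0"
  shows "negligible (f ` S)"
proof -
  obtain K T where K: "\<And>i::nat. compact (K i)" "negligible T" "S = (\<Union>i. K i) \<union> T"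
    using lebesgue_set_compact_Union[OF S(1)] by metis
  have neg: "negligible (f ` K i)" for i
  proof -
    have KS: "K i \<subseteq> S" using K(3) by auto
    then have "compact (f ` K i)"
      using S(2) by (intro compact_continuous_image K(1) continuous_on_subset[OF D(2)]) auto
    then have fK: "f ` K i \<in> sets borel" by (rule borel_compact)
    have "emeasure lborel (f ` K i) \<le> (\<integral>\<^sup>+x\<in>K i. ennreal 0 \<partial>lborel)"
    proof (rule emeasure_differentiable_image_le[OF borel_compact[OF K(1)] fK])
      fix x assume x: "x \<in> K i"
      then have "f differentiable (at x)" using KS diff by auto
      then show "(f has_derivative frechet_derivative f (at x)) (at x within K i)"
        using frechet_derivative_works has_derivative_at_withinI by blast
      show "0 = \<bar>det (matrix (frechet_derivative f (at x)))\<bar>"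
        using crit[of x] x KS by (auto simp: jacobian_det_def)
    qed simp
    then have "f ` K i \<in> null_sets lborel" using fK by (auto simp: null_sets_def)
    then show ?thesis by (simp add: negligible_iff_null_sets null_sets_completionI)
  qed
  have "T \<subseteq> D" using K(3) S(2) by auto
  then have "negligible (f ` T)" using N K(2) by (auto simp: N_property_def negligible_iff_null_sets)
  moreover have "f ` S = (\<Union>i. f ` K i) \<union> f ` T" using K(3) by auto
  moreover have "negligible (\<Union>i. f ` K i)"
    using neg by (intro negligible_countable_Union) auto
  ultimately show ?thesis by (metis negligible_Un)
qed

text \<open>The points at which \<open>f\<close> satisfies a quantitative injectivity estimate at scale \<open>1 / Suc i\<close>
  form a relatively closed set, whose compact pieces of smaller diameter are mapped injectively.\<close>

lemma regular_pieces:
  fixes f :: "real^'n \<Rightarrow> real^'n"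
  assumes D: "open D" "continuous_on D f" and AE: "AE x in lebesgue. x \<in> D \<longrightarrow> f differentiable (at x)"
    and N: "N_property D f"
  obtains G C :: "nat \<Rightarrow> (real^'n) set" and \<phi> J :: "real^'n \<Rightarrow> real" where
    "\<phi> \<in> borel_measurable borel" "J \<in> borel_measurable borel"
    "\<And>k. G k \<in> sets borel" "disjoint_family G" "\<And>k. G k \<subseteq> C k" "\<And>k. compact (C k)" "\<And>k. C k \<subseteq> D"
    "\<And>k. inj_on f (C k)"
    "\<And>k x. x \<in> G k \<Longrightarrow> f differentiable (at x) \<and> jacobian_det f x \<noteq> 0 \<and>
      \<phi> x = min_stretch (frechet_derivative f (at x)) \<and> J x = \<bar>jacobian_det f x\<bar>"
    "negligible (f ` (D - (\<Union>k. G k)))"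
proof -
  define E where "E = {x\<in>D. f differentiable (at x)}"
  obtain M where M: "M \<in> null_sets lebesgue" "{x. \<not> (x \<in> D \<longrightarrow> f differentiable (at x))} \<subseteq> M"
    using AE unfolding eventually_ae_filter by auto
  have nDE: "negligible (D - E)"
    by (rule negligible_subset[of M]) (use M in \<open>auto simp: E_def negligible_iff_null_sets\<close>)
  have ED: "E \<subseteq> D" and Ediff: "\<And>x. x \<in> E \<Longrightarrow> f differentiable (at x)" by (auto simp: E_def)
  have Es: "E \<in> sets lebesgue"
  proof -
    have "E = D - (D - E)" using ED by auto
    moreover have "D - E \<in> sets lebesgue" using nDE by (simp add: negligible_imp_sets)
    moreover have "D \<in> sets lebesgue" using D(1) by simp
    ultimately show ?thesis by (metis sets.Diff)
  qed
  have jm: "jacobian_det f \<in> borel_measurable (lebesgue_on E)"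
    by (rule borel_measurable_jacobian_det[OF D Es ED Ediff])
  define Z where "Z = {x\<in>E. jacobian_det f x = 0}"
  have Zs: "Z \<in> sets lebesgue"
  proof -
    have "{x \<in> space (lebesgue_on E). jacobian_det f x = 0} \<in> sets (lebesgue_on E)"
      using jm by measurable
    then show ?thesis using Es by (simp add: Z_def space_restrict_space sets_restrict_space_iff)
  qed
  have nfZ: "negligible (f ` Z)"
    by (rule negligible_image_critical[OF D N Zs]) (use ED Ediff in \<open>auto simp: Z_def\<close>)
  obtain \<phi> where \<phi>: "\<phi> \<in> borel_measurable borel" "negligible {x\<in>E. min_stretch (frechet_derivative f (at x)) \<noteq> \<phi> x}"
    by (rule lebesgue_on_ex_borel[OF borel_measurable_min_stretch[OF D Es ED Ediff] Es])
  have jm': "(\<lambda>x. \<bar>jacobian_det f x\<bar>) \<in> borel_measurable (lebesgue_on E)" using jm by measurable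
  obtain J where J: "J \<in> borel_measurable borel" "negligible {x\<in>E. \<bar>jacobian_det f x\<bar> \<noteq> J x}"
    by (rule lebesgue_on_ex_borel[OF jm' Es])
  define P where "P = {x\<in>E. min_stretch (frechet_derivative f (at x)) \<noteq> \<phi> x} \<union> {x\<in>E. \<bar>jacobian_det f x\<bar> \<noteq> J x}"
  have nP: "negligible P" unfolding P_def by (intro negligible_Un \<phi> J)
  define R where "R = E - Z - P"
  have Rs: "R \<in> sets lebesgue" unfolding R_def by (intro sets.Diff Es Zs negligible_imp_sets nP)
  obtain K T where K: "\<And>i::nat. compact (K i)" "negligible T" "R = (\<Union>i. K i) \<union> T"
    by (rule lebesgue_set_compact_Union[OF Rs]) blast
  have KR: "K i \<subseteq> R" for i using K(3) by auto
  have RD: "R \<subseteq> D" using ED by (auto simp: R_def)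
  define X where "X = (\<lambda>i::nat. {x\<in>D. \<forall>y\<in>D. dist y x < 1 / Suc i \<longrightarrow> dist y x / Suc i \<le> dist (f y) (f x)})"
  have Xcl: "closedin (top_of_set D) (X i)" for i
  proof -
    \<comment> \<open>The implication in \<open>X i\<close> is an alternative: \<open>y\<close> is
      at distance at least \<open>1 / Suc i\<close>, or it satisfies the estimate. As nonnegativity
      of a maximum this is a relatively closed condition on \<open>x\<close>.\<close>
    define h where "h = (\<lambda>y x. max (dist (f y) (f x) - dist y x / Suc i) (dist y x - 1 / Suc i))"
    have eq: "X i = D \<inter> (\<Inter>y\<in>D. D \<inter> h y -` {0..})"
      unfolding X_def h_def vimage_def atLeast_iff le_max_iff_disj
      by (auto simp: not_less[symmetric] simp del: not_less)
    have cl: "closedin (top_of_set D) (D \<inter> h y -` {0..})" for y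
      unfolding h_def using D(2) by (intro continuous_closedin_preimage continuous_intros) auto
    show ?thesis
    proof (cases "D = {}")
      case False
      then have "closedin (top_of_set D) (\<Inter>y\<in>D. D \<inter> h y -` {0..})"
        using cl by (intro closedin_INT)
      moreover have "closedin (top_of_set D) D" by simp
      ultimately show ?thesis unfolding eq by (intro closedin_Int)
    qed (simp add: eq)
  qed
  have Xcov: "\<exists>i. x \<in> X i" if x: "x \<in> R" for x
  proof -
    have d: "f differentiable (at x)" and j: "jacobian_det f x \<noteq> 0" using x Ediff by (auto simp: R_def Z_def)
    let ?m = "min_stretch (frechet_derivative f (at x))"
    have "bounded_linear (frechet_derivative f (at x))"
      using d frechet_derivative_works has_derivative_bounded_linear by blast
    then have m: "0 < ?m" using j by (intro min_stretch_pos) (auto simp: jacobian_det_def)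
    then obtain e where e: "e > 0" "\<And>y. dist y x < e \<Longrightarrow> ?m / 2 * dist y x \<le> dist (f y) (f x)"
      using differentiable_lower_bound[OF d, of "?m / 2"] by auto
    \<comment> \<open>One index has to serve both as the radius and as the constant of the
      estimate.\<close>
    obtain i where i: "1 / real (Suc i) < min e (?m / 2)"
      using reals_Archimedean[of "min e (?m / 2)"] e(1) m by (auto simp: inverse_eq_divide)
    have "dist y x / Suc i \<le> dist (f y) (f x)" if "dist y x < 1 / Suc i" for y
    proof -
      have "dist y x * (1 / Suc i) \<le> dist y x * (?m / 2)" using i by (intro mult_left_mono) auto
      also have "\<dots> \<le> dist (f y) (f x)" using e(2)[of y] that i by (simp add: mult.commute)
      finally show ?thesis by simp
    qed
    then show ?thesis using x RD by (auto simp: X_def)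
  qed
  obtain Q :: "(real^'n) set" where Q: "countable Q" "\<And>X. open X \<Longrightarrow> X \<noteq> {} \<Longrightarrow> \<exists>d\<in>Q. d \<in> X"
    using countable_dense_setE by blast
  \<comment> \<open>Two points of a ball of radius \<open>1 / (4 * Suc i)\<close> are closer than
    \<open>1 / Suc i\<close>, hence within range of the estimate defining \<open>X i\<close>, which
    then separates their images.\<close>
  define \<C> where "\<C> = (\<lambda>(i, q, j). X i \<inter> K j \<inter> cball q (1 / (4 * Suc i))) ` (UNIV \<times> Q \<times> UNIV)"
  have cC: "countable \<C>" unfolding \<C>_def using Q(1) by auto
  have "Q \<noteq> {}" using Q(2)[of UNIV] by auto
  then have neC: "\<C> \<noteq> {}" by (auto simp: \<C>_def)
  have \<C>: "compact A \<and> A \<subseteq> R \<and> inj_on f A" if AC: "A \<in> \<C>" for A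
  proof -
    obtain i q j where A: "A = X i \<inter> K j \<inter> cball q (1 / (4 * Suc i))" using AC by (auto simp: \<C>_def)
    \<comment> \<open>\<open>X i\<close> is closed only relative to \<open>D\<close>; compactness
      comes from \<open>K j\<close>, which lies in \<open>D\<close>.\<close>
    obtain T' where "closed T'" "X i = D \<inter> T'" using Xcl[of i] unfolding closedin_closed by auto
    then have "A = T' \<inter> K j \<inter> cball q (1 / (4 * Suc i))" using A KR[of j] RD by auto
    then have "compact A" using \<open>closed T'\<close> K(1) by (simp add: closed_Int_compact compact_Int_closed)
    moreover have "inj_on f A"
    proof (rule inj_onI, rule ccontr)
      fix x y assume xy: "x \<in> A" "y \<in> A" "f x = f y" "x \<noteq> y"
      have "dist y x \<le> dist q y + dist q x" by (metis dist_commute dist_triangle)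
      also have "\<dots> \<le> 1 / (4 * Suc i) + 1 / (4 * Suc i)" using xy A by (intro add_mono) auto
      also have "\<dots> < 1 / Suc i" by (simp add: field_simps)
      finally have "dist y x / Suc i \<le> dist (f y) (f x)" using xy A by (auto simp: X_def)
      then have "dist y x / Suc i \<le> 0" using xy(3) by simp
      moreover have "0 < dist y x / Suc i" using xy(4) by (intro divide_pos_pos) auto
      ultimately show False by linarith
    qed
    ultimately show ?thesis using A KR by auto
  qed
  have UC: "\<Union>\<C> = (\<Union>i. K i)"
  proof
    show "(\<Union>i. K i) \<subseteq> \<Union>\<C>"
    proof
      fix x assume "x \<in> (\<Union>i. K i)"
      then obtain j where j: "x \<in> K j" by auto
      obtain i where i: "x \<in> X i" using Xcov[of x] j KR by auto
      obtain q where q: "q \<in> Q" "q \<in> ball x (1 / (4 * Suc i))" using Q(2)[of "ball x (1 / (4 * Suc i))"] by auto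
      then have "x \<in> X i \<inter> K j \<inter> cball q (1 / (4 * Suc i))" using i j by (auto simp: dist_commute)
      moreover have "X i \<inter> K j \<inter> cball q (1 / (4 * Suc i)) \<in> \<C>" unfolding \<C>_def using q(1)
        by (intro image_eqI[of _ _ "(i, q, j)"]) auto
      ultimately show "x \<in> \<Union>\<C>" by blast
    qed
  qed (auto simp: \<C>_def)
  define C where "C = from_nat_into \<C>"
  have C: "compact (C k) \<and> C k \<subseteq> R \<and> inj_on f (C k)" for k
    unfolding C_def by (intro \<C> from_nat_into neC)
  have rC: "(\<Union>k. C k) = (\<Union>i. K i)" using range_from_nat_into[OF neC cC] UC by (simp add: C_def)
  define G where "G = disjointed C"
  have GC: "G k \<subseteq> C k" for k unfolding G_def by (rule disjointed_subset)
  show ?thesis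
  proof (rule that[of \<phi> J G C])
    show "G k \<in> sets borel" for k
      using sets.range_disjointed_sets[of C borel] C by (auto simp: G_def intro: borel_compact)
    show "disjoint_family G" unfolding G_def by (rule disjoint_family_disjointed)
    show "C k \<subseteq> D" for k using C RD by blast
    show "f differentiable (at x) \<and> jacobian_det f x \<noteq> 0 \<and>
      \<phi> x = min_stretch (frechet_derivative f (at x)) \<and> J x = \<bar>jacobian_det f x\<bar>" if "x \<in> G k" for k x
    proof -
      have "x \<in> R" using that GC C by blast
      then show ?thesis using Ediff by (auto simp: R_def Z_def P_def)
    qed
    have UG: "(\<Union>k. G k) = (\<Union>i. K i)" unfolding G_def UN_disjointed_eq rC ..
    \<comment> \<open>Of these four sets only \<open>Z\<close> may have positive measure; its image
      is null by the critical-set lemma, those of the others by the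
      \<open>N\<close>-property.\<close>
    have "D - (\<Union>k. G k) \<subseteq> (D - E) \<union> Z \<union> P \<union> T" unfolding UG using K(3) by (auto simp: R_def)
    then have sub: "f ` (D - (\<Union>k. G k)) \<subseteq> f ` (D - E) \<union> f ` Z \<union> f ` P \<union> f ` T" by blast
    have im: "negligible (f ` A)" if "negligible A" "A \<subseteq> D" for A
      using N that by (auto simp: N_property_def negligible_iff_null_sets)
    have "P \<subseteq> D" "T \<subseteq> D" using ED K(3) RD by (auto simp: P_def)
    then have "negligible (f ` (D - E) \<union> f ` Z \<union> f ` P \<union> f ` T)"
      by (intro negligible_Un im nDE nfZ nP K(2)) auto
    then show "negligible (f ` (D - (\<Union>k. G k)))" using sub by (rule negligible_subset)
  qed (use C GC \<phi> J in auto)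
qed

section \<open>Representations of curves and the modulus inequality\<close>

lemma curve_length_const:
  assumes "\<And>t. t \<in> S \<Longrightarrow> \<gamma> t = x"
  shows "curve_length S \<gamma> = 0"
proof -
  have "curve_length S \<gamma> \<le> 0"
  proof (rule curve_length_leI)
    fix N t assume "t ` {..N::nat} \<subseteq> S"
    then have "\<gamma> (t i) = x" if "i \<le> N" for i using assms that by auto
    then show "(\<Sum>i<N. ennreal (dist (\<gamma> (t i)) (\<gamma> (t (Suc i))))) \<le> 0" by simp
  qed
  then show ?thesis by simp
qed

text \<open>A point of \<open>A\<close> is isolated in \<open>S\<close>, hence both open and closed
  in \<open>A\<close>, and by connectedness it is all of \<open>A\<close>.\<close>

lemma connected_subset_discrete:
  fixes A :: "'a::t1_space set"
  assumes "connected A" "A \<subseteq> S" "discrete S" "x \<in> A" "y \<in> A"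
  shows "x = y"
proof -
  have "x isolated_in S" using assms by (auto dest: discreteD)
  then obtain T where T: "open T" "T \<inter> S = {x}" by (auto simp: isolated_in_def)
  have "A \<inter> T = {x}" using T assms by auto
  then have "openin (top_of_set A) {x}" using T(1) by (metis openin_open)
  moreover have "closedin (top_of_set A) {x}" using assms by (simp add: closedin_singleton)
  ultimately have "{x} = A" using assms(1) unfolding connected_clopen by blast
  then show ?thesis using assms(5) by blast
qed

text \<open>Where the length of \<open>f \<circ> \<alpha>\<close> does not grow,
  \<open>f \<circ> \<alpha>\<close> is constant and \<open>\<alpha>\<close> runs inside one fibre; a
  connected image in a discrete set is a point. So \<open>\<alpha>\<close> factors through the
  length function.\<close>

lemma f_rep_length_fun:
  fixes f :: "'a::t1_space \<Rightarrow> 'b::metric_space"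
  assumes f: "discrete_map D f" "continuous_on {a..b} \<alpha>" "\<alpha> ` {a..b} \<subseteq> D" and rect: "rectifiable {a..b} (f \<circ> \<alpha>)"
    and t: "t \<in> {a..b}"
  shows "f_rep f {a..b} \<alpha> (length_fun {a..b} (f \<circ> \<alpha>) t) = \<alpha> t"
proof -
  let ?l = "length_fun {a..b} (f \<circ> \<alpha>)"
  have *: "\<alpha> u = \<alpha> v" if uv: "u \<in> {a..b}" "v \<in> {a..b}" "u \<le> v" "?l u = ?l v" for u v
  proof -
    have const: "(f \<circ> \<alpha>) w = (f \<circ> \<alpha>) u" if w: "w \<in> {u..v}" for w
    proof -
      have "?l w \<le> ?l v" using uv w by (intro length_fun_mono[OF rect]) auto
      moreover have "dist ((f \<circ> \<alpha>) u) ((f \<circ> \<alpha>) w) \<le> ?l w - ?l u"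
        using uv w by (intro dist_le_length_fun_diff[OF rect]) auto
      ultimately have "dist ((f \<circ> \<alpha>) u) ((f \<circ> \<alpha>) w) \<le> 0" using uv(4) by linarith
      then show ?thesis by (simp add: dist_commute)
    qed
    have sub: "\<alpha> ` {u..v} \<subseteq> {x\<in>D. f x = f (\<alpha> u)}"
    proof
      fix x assume "x \<in> \<alpha> ` {u..v}"
      then obtain w where w: "w \<in> {u..v}" "x = \<alpha> w" by blast
      then have "x \<in> D" using f(3) uv by auto
      then show "x \<in> {x\<in>D. f x = f (\<alpha> u)}" using const[OF w(1)] w(2) by simp
    qed
    have "{u..v} \<subseteq> {a..b}" using uv by auto
    then have "connected (\<alpha> ` {u..v})"
      by (intro connected_continuous_image continuous_on_subset[OF f(2)]) auto
    then show ?thesis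
      by (rule connected_subset_discrete[OF _ sub]) (use f(1) uv in \<open>auto simp: discrete_map_def\<close>)
  qed
  have "\<exists>\<alpha>'. \<forall>t\<in>{a..b}. \<alpha> t = \<alpha>' (?l t)"
  proof (rule factor_through)
    fix u v assume uv: "u \<in> {a..b}" "v \<in> {a..b}" "?l u = ?l v"
    show "\<alpha> u = \<alpha> v"
    proof (cases "u \<le> v")
      case True then show ?thesis by (intro * uv)
    next
      case False then show ?thesis by (intro *[symmetric] uv uv(3)[symmetric]) simp
    qed
  qed
  from someI_ex[OF this] show ?thesis using t unfolding f_rep_def by auto
qed

lemma abs_continuous_on_subset:
  assumes "abs_continuous_on S g" "T \<subseteq> S"
  shows "abs_continuous_on T g"
  unfolding abs_continuous_on_def
proof (intro allI impI)
  fix e :: real assume e: "e > 0"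
  obtain d where d: "d > 0" "\<And>(N::nat) u v. (\<forall>i<N. u i \<le> v i \<and> {u i..v i} \<subseteq> S) \<Longrightarrow>
      disjoint_family_on (\<lambda>i. {u i<..<v i}) {..<N} \<Longrightarrow>
      (\<Sum>i<N. v i - u i) < d \<Longrightarrow> (\<Sum>i<N. dist (g (u i)) (g (v i))) < e"
    using assms(1)[unfolded abs_continuous_on_def, rule_format, OF e] by blast
  show "\<exists>d>0. \<forall>(N::nat) u v. (\<forall>i<N. u i \<le> v i \<and> {u i..v i} \<subseteq> T) \<longrightarrow>
      disjoint_family_on (\<lambda>i. {u i<..<v i}) {..<N} \<longrightarrow>
      (\<Sum>i<N. v i - u i) < d \<longrightarrow> (\<Sum>i<N. dist (g (u i)) (g (v i))) < e"
  proof (intro exI[of _ d] conjI allI impI d(1))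
    fix N :: nat and u v :: "nat \<Rightarrow> real"
    assume *: "\<forall>i<N. u i \<le> v i \<and> {u i..v i} \<subseteq> T" "disjoint_family_on (\<lambda>i. {u i<..<v i}) {..<N}"
      "(\<Sum>i<N. v i - u i) < d"
    have "\<forall>i<N. u i \<le> v i \<and> {u i..v i} \<subseteq> S" using *(1) assms(2) by blast
    then show "(\<Sum>i<N. dist (g (u i)) (g (v i))) < e" using *(2,3) by (rule d(2))
  qed
qed

text \<open>In the arc length of \<open>\<beta>\<close>, each closed subcurve of
  \<open>\<alpha>\<close> becomes \<open>\<alpha>'\<close> on some \<open>{t0..t1}\<close>, and the
  arc length function \<open>L\<close> of \<open>\<alpha>'\<close> links it to the normal
  representation of the subcurve. Thus \<open>arc_integral_le\<close> bounds every subcurve by the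
  integral over \<open>{0..c}\<close>.\<close>

lemma curve_integral_f_rep_le:
  fixes \<alpha> \<alpha>' :: "real \<Rightarrow> 'a::euclidean_space" and \<beta> :: "real \<Rightarrow> 'b::metric_space" and \<phi> :: "'a \<Rightarrow> real"
  assumes \<alpha>: "continuous_on {a..b} \<alpha>" "rectifiable {a..b} \<alpha>"
    and \<beta>: "continuous_on {a..b} \<beta>" "rectifiable {a..b} \<beta>"
    and fib: "\<And>u v. u \<in> {a..b} \<Longrightarrow> v \<in> {a..b} \<Longrightarrow> \<alpha> u = \<alpha> v \<Longrightarrow> \<beta> u = \<beta> v"
    and rep: "\<And>t. t \<in> {a..b} \<Longrightarrow> \<alpha>' (length_fun {a..b} \<beta> t) = \<alpha> t"
    and c: "c = enn2real (curve_length {a..b} \<beta>)"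
    and AC: "abs_continuous_on {0..c} \<alpha>'"
    and Z: "Z \<in> null_sets lborel"
    and \<phi>: "\<phi> \<in> borel_measurable borel" and \<rho>: "\<rho> \<in> borel_measurable borel"
    and pos: "\<And>t. t \<in> {0..c} - Z \<Longrightarrow> 0 < \<phi> (\<alpha>' t)"
    and lip: "\<And>t \<kappa>. t \<in> {0..c} - Z \<Longrightarrow> 0 < \<kappa> \<Longrightarrow> \<kappa> < \<phi> (\<alpha>' t) \<Longrightarrow>
      \<exists>d>0. \<forall>t'\<in>{0..c}. \<bar>t' - t\<bar> < d \<longrightarrow> \<kappa> * dist (\<alpha>' t') (\<alpha>' t) \<le> \<bar>t' - t\<bar>"
  shows "curve_integral {a..b} \<alpha> \<rho> \<le> (\<integral>\<^sup>+t\<in>{0..c}. \<rho> (\<alpha>' t) / ennreal (\<phi> (\<alpha>' t)) \<partial>lborel)"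
  unfolding curve_integral_def
proof (rule SUP_least, clarify)
  fix a' b' :: real assume le: "a' \<le> b'" and sub: "{a'..b'} \<subseteq> {a..b}"
  have ab: "a \<le> a'" "b' \<le> b" using le sub by auto
  let ?l = "length_fun {a..b} \<beta>" and ?g = "normal_rep {a'..b'} \<alpha>"
  define t0 t1 where "t0 = ?l a'" and "t1 = ?l b'"
  define l where "l = enn2real (curve_length {a'..b'} \<alpha>)"
  have lmono: "?l u \<le> ?l v" if "u \<in> {a..b}" "v \<in> {a..b}" "u \<le> v" for u v
    using that by (intro length_fun_mono[OF \<beta>(2)]) auto
  have img: "?l ` {u..v} = {?l u..?l v}" if "a \<le> u" "u \<le> v" "v \<le> b" for u v
    by (rule length_fun_image_Icc[OF \<beta> that])
  have len: "curve_length {?l u..?l v} \<alpha>' = curve_length {u..v} \<alpha>" if "a \<le> u" "u \<le> v" "v \<le> b" for u v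
    unfolding img[OF that, symmetric] using that rep lmono by (intro curve_length_reparam) auto
  have t01: "0 \<le> t0" "t0 \<le> t1" "t1 \<le> c"
    using lmono[of a' b'] lmono[of a a'] lmono[of b' b] le ab
    by (auto simp: t0_def t1_def c length_fun_left length_fun_right)
  have \<alpha>r: "rectifiable {a'..b'} \<alpha>" using rectifiable_subset[OF \<alpha>(2) sub] .
  have \<alpha>c: "continuous_on {a'..b'} \<alpha>" using continuous_on_subset[OF \<alpha>(1) sub] .
  have fin: "curve_length {a'..b'} \<alpha> = ennreal l" using \<alpha>r by (simp add: l_def rectifiable_def)
  have "(\<integral>\<^sup>+ s\<in>{0..l}. \<rho> (?g s) \<partial>lborel) \<le> (\<integral>\<^sup>+t\<in>{0..c}. \<rho> (\<alpha>' t) / ennreal (\<phi> (\<alpha>' t)) \<partial>lborel)"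
  proof (cases "t0 = t1")
    \<comment> \<open>No length of \<open>\<beta>\<close> is spent here, so the subcurve of
      \<open>\<alpha>\<close> has length zero and is integrated over a single point.\<close>
    case True
    then have "curve_length {a'..b'} \<alpha> = 0" using len[of a' b'] ab le by (simp add: t0_def t1_def)
    then have "l = 0" by (simp add: l_def)
    have "(\<integral>\<^sup>+ s\<in>{0..l}. \<rho> (?g s) \<partial>lborel) = (\<integral>\<^sup>+ s. 0 \<partial>(lborel :: real measure))"
    proof (rule nn_integral_cong_AE)
      show "AE s in lborel. \<rho> (?g s) * indicator {0..l} s = 0"
        using AE_lborel_singleton[of 0] by eventually_elim (auto simp: \<open>l = 0\<close>)
    qed
    then show ?thesis by simp
  next
    case False
    then have lt: "t0 < t1" using t01 by simp
    define L where "L = length_fun {t0..t1} \<alpha>'"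
    have sub': "{t0..t1} \<subseteq> {0..c}" using t01 by auto
    have AC': "abs_continuous_on {t0..t1} \<alpha>'" by (rule abs_continuous_on_subset[OF AC sub'])
    have \<alpha>'c: "continuous_on {t0..t1} \<alpha>'" by (rule abs_continuous_on_imp_continuous_on[OF AC'])
    have len01: "curve_length {t0..t1} \<alpha>' = ennreal l" using len[of a' b'] ab le fin by (simp add: t0_def t1_def)
    then have \<alpha>'r: "rectifiable {t0..t1} \<alpha>'" by (simp add: rectifiable_def)
    have onto: "\<exists>u. u \<in> {a'..b'} \<and> ?l u = t" if "t \<in> {t0..t1}" for t
    proof -
      have "t \<in> ?l ` {a'..b'}" using that unfolding img[OF ab(1) le ab(2)] t0_def t1_def .
      then show ?thesis by blast
    qed
    have L_l: "L (?l u) = length_fun {a'..b'} \<alpha> u" if u: "u \<in> {a'..b'}" for u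
    proof -
      have "?l u \<in> {t0..t1}" using u lmono ab le by (auto simp: t0_def t1_def)
      then have "L (?l u) = enn2real (curve_length {t0..?l u} \<alpha>')" unfolding L_def by (rule length_fun_Icc)
      also have "curve_length {t0..?l u} \<alpha>' = curve_length {a'..u} \<alpha>"
        using len[of a' u] u ab by (simp add: t0_def)
      finally show ?thesis using u by (simp add: length_fun_Icc)
    qed
    have "(\<integral>\<^sup>+ s\<in>{0..l}. \<rho> (?g s) \<partial>lborel) \<le> (\<integral>\<^sup>+t\<in>{t0..t1}. \<rho> (\<alpha>' t) / ennreal (\<phi> (\<alpha>' t)) \<partial>lborel)"
    proof (rule arc_integral_le[OF lt, where L=L and Z="Z \<inter> {t0..t1}"])
      show "continuous_on {t0..t1} L" unfolding L_def by (rule continuous_on_length_fun[OF \<alpha>'c \<alpha>'r])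
      \<comment> \<open>If \<open>L\<close> were constant on \<open>{u..v}\<close>, so would be
        \<open>\<alpha>'\<close>, and by \<open>fib\<close> also \<open>\<beta>\<close> on the
        corresponding parameters. But \<open>u\<close> and \<open>v\<close> are values of the arc
        length of \<open>\<beta>\<close>, which could then not grow from \<open>u\<close> to
        \<open>v\<close>.\<close>
      show "L u < L v" if uv: "t0 \<le> u" "u < v" "v \<le> t1" for u v
      proof (rule ccontr)
        assume "\<not> L u < L v"
        then have Luv: "L v \<le> L u" by simp
        have const: "\<alpha>' w = \<alpha>' u" if w: "w \<in> {u..v}" for w
        proof -
          have "L w \<le> L v" "dist (\<alpha>' u) (\<alpha>' w) \<le> L w - L u" unfolding L_def
            using uv w by (auto intro!: length_fun_mono[OF \<alpha>'r] dist_le_length_fun_diff[OF \<alpha>'r])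
          then have "dist (\<alpha>' u) (\<alpha>' w) \<le> 0" using Luv by linarith
          then show ?thesis by simp
        qed
        obtain x where x: "x \<in> {a'..b'}" "?l x = u" using onto[of u] uv by auto
        obtain y where y: "y \<in> {a'..b'}" "?l y = v" using onto[of v] uv by auto
        have "x \<le> y" using lmono[of y x] x y uv ab by (cases "x \<le> y") auto
        have "\<beta> w = \<beta> x" if w: "w \<in> {x..y}" for w
        proof (rule fib)
          show "w \<in> {a..b}" "x \<in> {a..b}" using w x y ab by auto
          have "?l w \<in> {u..v}" using w x y ab lmono[of x w] lmono[of w y] by auto
          then have "\<alpha>' (?l w) = \<alpha>' (?l x)" unfolding x(2) by (rule const)
          then show "\<alpha> w = \<alpha> x" using rep \<open>w \<in> {a..b}\<close> \<open>x \<in> {a..b}\<close> by simp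
        qed
        then have "curve_length {x..y} \<beta> = 0" by (rule curve_length_const)
        then have "?l y - ?l x = 0" using x y ab \<open>x \<le> y\<close> by (subst length_fun_diff[OF \<beta>(2)]) auto
        then show False using x y uv by simp
      qed
      show "L t0 = 0" "L t1 = l" unfolding L_def using t01 len01
        by (auto simp: length_fun_left length_fun_right l_def)
      show "\<alpha>' t = ?g (L t)" if t: "t \<in> {t0..t1}" for t
      proof -
        obtain u where u: "u \<in> {a'..b'}" "?l u = t" using onto[OF t] by auto
        then show ?thesis using L_l[OF u(1)] normal_rep_length_fun[OF \<alpha>r u(1)] rep[of u] sub by auto
      qed
      show "dist (?g u) (?g v) \<le> \<bar>u - v\<bar>" if "u \<in> {0..l}" "v \<in> {0..l}" for u v
        using that unfolding l_def by (rule dist_normal_rep_le[OF \<alpha>c \<alpha>r le])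
      have "curve_length (length_fun {a'..b'} \<alpha> ` {a'..b'}) ?g = curve_length {a'..b'} \<alpha>"
        by (rule curve_length_reparam) (auto simp: normal_rep_length_fun[OF \<alpha>r] intro!: length_fun_mono[OF \<alpha>r])
      then show "curve_length {0..l} ?g = ennreal l"
        by (simp only: length_fun_image[OF \<alpha>c \<alpha>r le] l_def[symmetric]) (simp only: fin)
      show "Z \<inter> {t0..t1} \<in> null_sets lborel" using Z by (intro null_set_Int2) auto
      show "0 < \<phi> (\<alpha>' t)" if "t \<in> {t0..t1} - Z \<inter> {t0..t1}" for t using that sub' by (intro pos) auto
      show "\<exists>d>0. \<forall>t'\<in>{t0..t1}. \<bar>t' - t\<bar> < d \<longrightarrow> \<kappa> * dist (\<alpha>' t') (\<alpha>' t) \<le> \<bar>t' - t\<bar>"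
        if "t \<in> {t0..t1} - Z \<inter> {t0..t1}" "0 < \<kappa>" "\<kappa> < \<phi> (\<alpha>' t)" for t \<kappa>
        using lip[of t \<kappa>] that sub' by blast
    qed (use AC' \<phi> \<rho> in auto)
    also have "\<dots> \<le> (\<integral>\<^sup>+t\<in>{0..c}. \<rho> (\<alpha>' t) / ennreal (\<phi> (\<alpha>' t)) \<partial>lborel)"
      using sub' by (intro nn_integral_mono mult_left_mono) (auto simp: indicator_def)
    finally show ?thesis .
  qed
  then show "(\<integral>\<^sup>+ s\<in>{0..enn2real (curve_length {a'..b'} \<alpha>)}. \<rho> (?g s) \<partial>lborel)
    \<le> (\<integral>\<^sup>+t\<in>{0..c}. \<rho> (\<alpha>' t) / ennreal (\<phi> (\<alpha>' t)) \<partial>lborel)" by (simp add: l_def)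
qed

section \<open>Folding along periods, extended powers and the power mean\<close>

lemma nn_integral_split_periods:
  fixes F :: "real \<Rightarrow> ennreal"
  assumes F[measurable]: "F \<in> borel_measurable borel" and h: "0 \<le> h"
  shows "(\<integral>\<^sup>+t\<in>{0..<real m * h}. F t \<partial>lborel) = (\<integral>\<^sup>+t\<in>{0..<h}. (\<Sum>j<m. F (t + real j * h)) \<partial>lborel)"
proof (induction m)
  case (Suc m)
  have "(\<integral>\<^sup>+t\<in>{0..<real (Suc m) * h}. F t \<partial>lborel) =
    (\<integral>\<^sup>+t. F t * indicator {0..<real m * h} t + F t * indicator {real m * h..<real (Suc m) * h} t \<partial>lborel)"
  proof (rule nn_integral_cong)
    fix t :: real
    have "0 \<le> real m * h" "real m * h \<le> real (Suc m) * h" using h by (auto simp: algebra_simps)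
    then show "F t * indicator {0..<real (Suc m) * h} t =
      F t * indicator {0..<real m * h} t + F t * indicator {real m * h..<real (Suc m) * h} t"
      by (auto simp: indicator_def simp del: of_nat_Suc)
  qed
  also have "\<dots> = (\<integral>\<^sup>+t\<in>{0..<real m * h}. F t \<partial>lborel) + (\<integral>\<^sup>+t\<in>{real m * h..<real (Suc m) * h}. F t \<partial>lborel)"
    by (rule nn_integral_add) auto
  also have "(\<integral>\<^sup>+t\<in>{real m * h..<real (Suc m) * h}. F t \<partial>lborel) = (\<integral>\<^sup>+t\<in>{0..<h}. F (t + real m * h) \<partial>lborel)"
  proof -
    have "(\<integral>\<^sup>+t\<in>{real m * h..<real (Suc m) * h}. F t \<partial>lborel) =
      (\<integral>\<^sup>+t. F (real m * h + t) * indicator {real m * h..<real (Suc m) * h} (real m * h + t) \<partial>lborel)"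
      using nn_integral_real_affine[of "\<lambda>t. F t * indicator {real m * h..<real (Suc m) * h} t" 1 "real m * h"] by simp
    also have "\<dots> = (\<integral>\<^sup>+t\<in>{0..<h}. F (t + real m * h) \<partial>lborel)"
      by (intro nn_integral_cong) (auto simp: indicator_def algebra_simps)
    finally show ?thesis .
  qed
  also have "(\<integral>\<^sup>+t\<in>{0..<real m * h}. F t \<partial>lborel) + (\<integral>\<^sup>+t\<in>{0..<h}. F (t + real m * h) \<partial>lborel) =
    (\<integral>\<^sup>+t. (\<Sum>j<m. F (t + real j * h)) * indicator {0..<h} t + F (t + real m * h) * indicator {0..<h} t \<partial>lborel)"
    unfolding Suc.IH by (rule nn_integral_add[symmetric]) auto
  also have "\<dots> = (\<integral>\<^sup>+t\<in>{0..<h}. (\<Sum>j<Suc m. F (t + real j * h)) \<partial>lborel)"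
    by (intro nn_integral_cong) (simp add: distrib_right)
  finally show ?case .
qed simp

lemma ennpowr_mono: "0 \<le> p \<Longrightarrow> x \<le> y \<Longrightarrow> ennpowr x p \<le> ennpowr y p"
  by (auto simp: ennpowr_def top_unique less_top intro!: ennreal_leI powr_mono2 enn2real_mono)

lemma ennpowr_ennreal: "0 \<le> x \<Longrightarrow> ennpowr (ennreal x) p = ennreal (x powr p)"
  by (simp add: ennpowr_def)

lemma ennpowr_top [simp]: "ennpowr \<infinity> p = \<infinity>" "ennpowr top p = top"
  by (simp_all add: ennpowr_def)

lemma ennpowr_inverse:
  assumes "p \<noteq> 0" shows "ennpowr (ennpowr x (1 / p)) p = x" "ennpowr (ennpowr x p) (1 / p) = x"
  using assms by (cases x; simp add: ennpowr_ennreal powr_powr)+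

lemma borel_measurable_ennpowr [measurable]:
  assumes [measurable]: "g \<in> borel_measurable M"
  shows "(\<lambda>x. ennpowr (g x) p) \<in> borel_measurable M"
  unfolding ennpowr_def by measurable

text \<open>At the endpoint 0 convexity amounts to \<open>(s * x) powr p \<le> s * x powr p\<close>,
  which holds because \<open>s powr p \<le> s\<close> for \<open>0 < s < 1\<close>.\<close>

lemma convex_on_powr_atLeast_0:
  assumes "p \<ge> 1" shows "convex_on {0..} (\<lambda>x. x powr p :: real)"
proof (rule convex_onI)
  have scale: "(s * x) powr p \<le> s * x powr p" if "0 < s" "s < 1" "0 \<le> x" for s x :: real
  proof -
    have "s powr p \<le> s" using powr_mono_both'[of 1 p s s] powr_mono'[of 1 p s] that assms by simp
    then show ?thesis using that by (simp add: powr_mult mult_right_mono)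
  qed
  fix t x y :: real assume t: "0 < t" "t < 1" and xy: "x \<in> {0..}" "y \<in> {0..}"
  show "((1 - t) *\<^sub>R x + t *\<^sub>R y) powr p \<le> (1 - t) * x powr p + t * y powr p"
  proof (cases "x = 0 \<or> y = 0")
    case True
    then show ?thesis using scale[of t y] scale[of "1 - t" x] t xy assms by auto
  next
    case False
    then show ?thesis using convex_onD[OF powr_convex[OF assms], of t x y] t xy by auto
  qed
qed auto

text \<open>Jensen's inequality for the \<open>p\<close>-th power with equal weights
  \<open>1 / m\<close>, followed by a \<open>p\<close>-th root. An infinite summand makes the
  right-hand side infinite as well.\<close>

lemma sum_le_power_mean:
  fixes a :: "nat \<Rightarrow> ennreal"
  assumes p: "p \<ge> 1" and m: "m \<ge> 1"
  shows "(\<Sum>j<m. a j) \<le> of_nat m * ennpowr (ennreal (1 / real m) * (\<Sum>j<m. ennpowr (a j) p)) (1 / p)"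
proof (cases "\<exists>j<m. a j = \<infinity>")
  case True
  then obtain j where j: "j < m" "a j = \<infinity>" by auto
  then have "ennpowr (a j) p \<le> (\<Sum>j<m. ennpowr (a j) p)" by (intro member_le_sum) auto
  then have s: "(\<Sum>j<m. ennpowr (a j) p) = \<infinity>" using j by (simp only: ennpowr_top infinity_ennreal_def top_unique)
  have "of_nat m * ennpowr (ennreal (1 / real m) * \<infinity>) (1 / p) = \<infinity>"
    using m by (simp add: ennreal_mult_top)
  then show ?thesis unfolding s by simp
next
  case False
  define r where "r = (\<lambda>j. enn2real (a j))"
  have a: "a j = ennreal (r j)" "0 \<le> r j" if "j < m" for j
    using False that by (auto simp: r_def less_top)
  let ?s = "\<Sum>j<m. 1 / real m * (r j powr p)"
  have "(\<Sum>j<m. (1 / real m) *\<^sub>R r j) powr p \<le> ?s"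
    using m a by (intro convex_on_sum[OF _ _ convex_on_powr_atLeast_0[OF p]]) (auto simp: lessThan_empty_iff)
  then have "((\<Sum>j<m. (1 / real m) *\<^sub>R r j) powr p) powr (1 / p) \<le> ?s powr (1 / p)"
    using p by (intro powr_mono2) auto
  moreover have "0 \<le> (\<Sum>j<m. (1 / real m) *\<^sub>R r j)" using a by (intro sum_nonneg) auto
  ultimately have "(\<Sum>j<m. (1 / real m) *\<^sub>R r j) \<le> ?s powr (1 / p)"
    using p by (simp add: powr_powr)
  then have le: "(\<Sum>j<m. r j) \<le> real m * ?s powr (1 / p)"
    using m by (simp add: sum_distrib_left[symmetric] sum_divide_distrib[symmetric] field_simps)
  have "(\<Sum>j<m. a j) = ennreal (\<Sum>j<m. r j)" using a by (subst sum_ennreal[symmetric]) (auto intro!: sum.cong)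
  also have "\<dots> \<le> ennreal (real m * ?s powr (1 / p))" by (rule ennreal_leI[OF le])
  also have "\<dots> = of_nat m * ennpowr (ennreal ?s) (1 / p)"
    by (subst ennpowr_ennreal) (auto simp: ennreal_mult sum_nonneg ennreal_of_nat_eq_real_of_nat)
  also have "ennreal ?s = ennreal (1 / real m) * (\<Sum>j<m. ennpowr (a j) p)"
  proof -
    have "(\<Sum>j<m. ennpowr (a j) p) = (\<Sum>j<m. ennreal (r j powr p))"
      using a by (intro sum.cong) (auto simp: ennpowr_ennreal)
    then show ?thesis 
      by (simp add: ennreal_mult[symmetric] sum_nonneg sum_divide_distrib)
  qed
  finally show ?thesis .
qed

lemma curve_integral_mono:
  "(\<And>x. \<rho> x \<le> \<rho>' x) \<Longrightarrow> curve_integral \<Delta> \<gamma> \<rho> \<le> curve_integral \<Delta> \<gamma> \<rho>'"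
  unfolding curve_integral_def
  by (intro SUP_mono') (auto intro!: nn_integral_mono mult_right_mono)

lemma nn_integral_le_curve_integral:
  assumes "a \<le> b"
  shows "(\<integral>\<^sup>+s\<in>{0..enn2real (curve_length {a..b} \<gamma>)}. \<rho> (normal_rep {a..b} \<gamma> s) \<partial>lborel) \<le> curve_integral {a..b} \<gamma> \<rho>"
  unfolding curve_integral_def using assms by (intro SUP_upper2[where i="(a, b)"]) auto

lemma borel_measurable_compose_indicator:
  fixes g :: "real \<Rightarrow> 'a::euclidean_space" and \<rho> :: "'a \<Rightarrow> ennreal"
  assumes "continuous_on {a..b} g" "\<rho> \<in> borel_measurable borel"
  shows "(\<lambda>t. \<rho> (g t) * indicator {a..b} t) \<in> borel_measurable borel"
proof -
  have "g \<in> borel_measurable (restrict_space borel {a..b})"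
    by (rule borel_measurable_continuous_on_restrict[OF assms(1)])
  then have "(\<lambda>t. \<rho> (g t)) \<in> borel_measurable (restrict_space borel {a..b})"
    using assms(2) by measurable
  then show ?thesis by (subst borel_measurable_restrict_space_iff_ennreal[symmetric]) auto
qed

lemma nn_integral_Icc_eq_Ico:
  fixes F :: "real \<Rightarrow> ennreal"
  shows "(\<integral>\<^sup>+t\<in>{a..b}. F t \<partial>lborel) = (\<integral>\<^sup>+t\<in>{a..<b}. F t \<partial>lborel)"
proof (rule nn_integral_cong_AE)
  show "AE t in lborel. F t * indicator {a..b} t = F t * indicator {a..<b} t"
    using AE_lborel_singleton[of b] by eventually_elim (auto simp: indicator_def)
qed

lemma sum_injective_le_suminf:
  fixes g :: "nat \<Rightarrow> ennreal" and m :: nat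
  assumes "inj_on k {..<m}" "\<And>j. j < m \<Longrightarrow> a j = g (k j)"
  shows "(\<Sum>j<m. a j) \<le> (\<Sum>i. g i)"
proof -
  have "(\<Sum>j<m. a j) = (\<Sum>i\<in>k ` {..<m}. g i)" using assms by (simp add: sum.reindex)
  also have "\<dots> \<le> (\<Sum>i. g i)" by (rule sum_le_suminf) auto
  finally show ?thesis .
qed

section \<open>Admissibility on winding curves and the final estimate\<close>

lemma modulus_eq_0D:
  assumes "modulus p \<Gamma> = 0" "e > 0"
  obtains \<sigma> where "\<sigma> \<in> adm \<Gamma>" "(\<integral>\<^sup>+x. ennpowr (\<sigma> x) p \<partial>lebesgue) \<le> ennreal e"
proof -
  have "modulus p \<Gamma> < ennreal e" using assms by simp
  then show ?thesis using that unfolding modulus_def INF_less_iff by (auto intro: less_imp_le)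
qed

text \<open>\<open>H k y\<close> stands for the \<open>p\<close>-th power of
  \<open>\<rho> / \<phi>\<close> at the point over \<open>y\<close> in \<open>G k\<close>. Only a
  lower bound on \<open>\<rho>'\<close> is asked for, so that a term for the
  \<open>ACP\<close>-exceptional curves can be included in it.\<close>

lemma admissible_on_winding_curve:
  fixes f :: "'a::euclidean_space \<Rightarrow> 'b::euclidean_space" and G :: "nat \<Rightarrow> 'a set"
  assumes p: "p \<ge> 1" and m: "m \<ge> 1"
    and f: "continuous_on D f" "discrete_map D f"
    and G: "\<And>k. inj_on f (G k)" 
    and lower: "\<And>x \<kappa>. x \<in> (\<Union>k. G k) \<Longrightarrow> 0 < \<kappa> \<Longrightarrow> \<kappa> < \<phi> x \<Longrightarrow>
      \<exists>d>0. \<forall>y. dist y x < d \<longrightarrow> \<kappa> * dist y x \<le> dist (f y) (f x)"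
    and pos: "\<And>x. x \<in> (\<Union>k. G k) \<Longrightarrow> 0 < \<phi> x"
    and E: "E \<in> sets borel" "f ` (D - (\<Union>k. G k)) \<subseteq> E"
    and \<phi>: "\<phi> \<in> borel_measurable borel" and \<rho>: "\<rho> \<in> borel_measurable borel"
    and \<rho>': "\<rho>' \<in> borel_measurable borel" "\<And>y. y \<in> E \<Longrightarrow> \<rho>' y = \<infinity>"
      "\<And>y. ennpowr (ennreal (1 / real m) * (\<Sum>k. H k y)) (1 / p) \<le> \<rho>' y"
    and H: "\<And>k x. x \<in> G k \<Longrightarrow> H k (f x) = ennpowr (\<rho> x / ennreal (\<phi> x)) p"
    and \<gamma>: "a \<le> b" "continuous_on {a..b} \<gamma>" "\<gamma> ` {a..b} \<subseteq> D" "rectifiable {a..b} \<gamma>"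
    and winds: "winds f m {a..b} \<gamma>"
    and AC: "abs_continuous_on {0..enn2real (curve_length {a..b} (f \<circ> \<gamma>))} (f_rep f {a..b} \<gamma>)"
    and one: "1 \<le> curve_integral {a..b} \<gamma> \<rho>"
  shows "1 \<le> curve_integral {a..b} (f \<circ> \<gamma>) \<rho>'"
proof -
  let ?\<beta> = "f \<circ> \<gamma>"
  define c where "c = enn2real (curve_length {a..b} ?\<beta>)"
  define h where "h = c / real m"
  define \<alpha> where "\<alpha> = f_rep f {a..b} \<gamma>"
  define \<beta> where "\<beta> = normal_rep {a..b} ?\<beta>"
  let ?l = "length_fun {a..b} ?\<beta>"
  have c0: "0 \<le> c" by (simp add: c_def)
  have h0: "0 \<le> h" using c0 by (simp add: h_def)
  have mh: "real m * h = c" using m by (simp add: h_def)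
  have \<beta>c: "continuous_on {a..b} ?\<beta>"
    by (rule continuous_on_compose[OF \<gamma>(2) continuous_on_subset[OF f(1) \<gamma>(3)]])
  have \<beta>r: "rectifiable {a..b} ?\<beta>" using winds by (simp add: winds_def)
  have \<alpha>l: "\<alpha> (?l t) = \<gamma> t" if "t \<in> {a..b}" for t
    unfolding \<alpha>_def by (rule f_rep_length_fun[OF f(2) \<gamma>(2,3) \<beta>r that])
  have onto: "?l ` {a..b} = {0..c}" unfolding c_def by (rule length_fun_image[OF \<beta>c \<beta>r \<gamma>(1)])
  have \<beta>\<alpha>: "\<beta> t = f (\<alpha> t) \<and> \<alpha> t \<in> D" if t: "t \<in> {0..c}" for t
  proof -
    have "t \<in> ?l ` {a..b}" using t unfolding onto .
    then obtain u where u: "u \<in> {a..b}" "t = ?l u" by blast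
    then show ?thesis using \<alpha>l[OF u(1)] normal_rep_length_fun[OF \<beta>r u(1)] \<gamma>(3) by (auto simp: \<beta>_def)
  qed
  have \<beta>lip: "dist (\<beta> s) (\<beta> t) \<le> \<bar>s - t\<bar>" if "s \<in> {0..c}" "t \<in> {0..c}" for s t
    using that unfolding \<beta>_def c_def by (rule dist_normal_rep_le[OF \<beta>c \<beta>r \<gamma>(1)])
  have \<beta>cont: "continuous_on {0..c} \<beta>"
    unfolding continuous_on_iff using \<beta>lip by (metis dist_real_def le_less_trans)
  have \<alpha>AC: "abs_continuous_on {0..c} \<alpha>" using AC by (simp add: c_def \<alpha>_def)
  have \<alpha>cont: "continuous_on {0..c} \<alpha>" by (rule abs_continuous_on_imp_continuous_on[OF \<alpha>AC])
  have wind: "\<beta> (t + real j * h) = \<beta> t \<and> \<alpha> (t + real j * h) \<noteq> \<alpha> t"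
    if "j \<in> {1..m-1}" "0 \<le> t" "t < t + real j * h" "t + real j * h < c" for t j
    using winds that unfolding winds_def Let_def h_def c_def \<alpha>_def \<beta>_def by blast
  have int\<beta>: "(\<integral>\<^sup>+s\<in>{0..c}. \<rho>' (\<beta> s) \<partial>lborel) \<le> curve_integral {a..b} ?\<beta> \<rho>'"
    unfolding \<beta>_def c_def by (rule nn_integral_le_curve_integral[OF \<gamma>(1)])
  have \<rho>'m: "(\<lambda>t. \<rho>' (\<beta> t) * indicator {0..c} t) \<in> borel_measurable borel"
    by (rule borel_measurable_compose_indicator[OF \<beta>cont \<rho>'(1)])
  define Z where "Z = {t\<in>{0..c}. \<beta> t \<in> E}"
  have Zb: "Z \<in> sets borel"
  proof -
    have "\<beta> \<in> borel_measurable (restrict_space borel {0..c})"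
      by (rule borel_measurable_continuous_on_restrict[OF \<beta>cont])
    from measurable_sets[OF this E(1)] have "\<beta> -` E \<inter> {0..c} \<in> sets (restrict_space borel {0..c})"
      by (simp add: space_restrict_space)
    moreover have "\<beta> -` E \<inter> {0..c} = Z" by (auto simp: Z_def)
    ultimately show ?thesis by (auto simp: sets_restrict_space)
  qed
  show ?thesis
  proof (cases "emeasure lborel Z = 0")
    \<comment> \<open>The image curve has positive length in \<open>E\<close>, where
      \<open>\<rho>'\<close> is infinite.\<close>
    case False
    have "\<infinity> = (\<integral>\<^sup>+s. \<infinity> * indicator Z s \<partial>lborel)"
      using False Zb by (subst nn_integral_cmult_indicator) (auto simp: ennreal_top_mult)
    also have "\<dots> \<le> (\<integral>\<^sup>+s\<in>{0..c}. \<rho>' (\<beta> s) \<partial>lborel)"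
      using \<rho>'(2) by (intro nn_integral_mono) (auto simp: Z_def indicator_def)
    finally show ?thesis using int\<beta> by (simp add: top_unique)
  next
    case True
    then have Z0: "Z \<in> null_sets lborel" using Zb by auto
    have good: "\<alpha> t \<in> (\<Union>k. G k)" if "t \<in> {0..c}" "\<beta> t \<notin> E" for t
      using \<beta>\<alpha>[OF that(1)] that(2) E(2) by auto
    define I where "I = (\<lambda>t. \<rho> (\<alpha> t) / ennreal (\<phi> (\<alpha> t)))"
    have "curve_integral {a..b} \<gamma> \<rho> \<le> (\<integral>\<^sup>+t\<in>{0..c}. I t \<partial>lborel)"
      unfolding I_def
    proof (rule curve_integral_f_rep_le[OF \<gamma>(2,4) \<beta>c \<beta>r _ \<alpha>l c_def \<alpha>AC Z0 \<phi> \<rho>])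
      show "?\<beta> u = ?\<beta> v" if "\<gamma> u = \<gamma> v" for u v using that by simp
      show "0 < \<phi> (\<alpha> t)" if "t \<in> {0..c} - Z" for t using that by (intro pos good) (auto simp: Z_def)
      show "\<exists>d>0. \<forall>t'\<in>{0..c}. \<bar>t' - t\<bar> < d \<longrightarrow> \<kappa> * dist (\<alpha> t') (\<alpha> t) \<le> \<bar>t' - t\<bar>"
        if t: "t \<in> {0..c} - Z" and \<kappa>: "0 < \<kappa>" "\<kappa> < \<phi> (\<alpha> t)" for t \<kappa>
      proof -
        have "\<alpha> t \<in> (\<Union>k. G k)" using t by (intro good) (auto simp: Z_def)
        then obtain d where d: "d > 0" "\<And>y. dist y (\<alpha> t) < d \<Longrightarrow> \<kappa> * dist y (\<alpha> t) \<le> dist (f y) (f (\<alpha> t))"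
          using lower \<kappa> by blast
        obtain e where e: "e > 0" "\<And>t'. t' \<in> {0..c} \<Longrightarrow> dist t' t < e \<Longrightarrow> dist (\<alpha> t') (\<alpha> t) < d"
          using \<alpha>cont t d(1) unfolding continuous_on_iff by (meson DiffD1)
        have "\<kappa> * dist (\<alpha> t') (\<alpha> t) \<le> \<bar>t' - t\<bar>" if t': "t' \<in> {0..c}" "\<bar>t' - t\<bar> < e" for t'
        proof -
          have "\<kappa> * dist (\<alpha> t') (\<alpha> t) \<le> dist (f (\<alpha> t')) (f (\<alpha> t))"
            using t' by (intro d(2) e(2)) (auto simp: dist_real_def)
          also have "\<dots> = dist (\<beta> t') (\<beta> t)" using \<beta>\<alpha>[OF t'(1)] \<beta>\<alpha>[of t] t by simp
          also have "\<dots> \<le> \<bar>t' - t\<bar>" using t t' by (intro \<beta>lip) auto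
          finally show ?thesis .
        qed
        then show ?thesis using e(1) by blast
      qed
    qed
    then have I1: "1 \<le> (\<integral>\<^sup>+t\<in>{0..c}. I t \<partial>lborel)" using one by (rule order_trans[rotated])
    \<comment> \<open>The periodicity clause of \<open>winds\<close> is vacuous when
      \<open>c = 0\<close>, but then the integral of \<open>I\<close> vanishes, contradicting
      \<open>I1\<close>.\<close>
    have cpos: "0 < c"
    proof (rule ccontr)
      assume "\<not> 0 < c"
      then have "c = 0" using c0 by simp
      then have "(\<integral>\<^sup>+t\<in>{0..c}. I t \<partial>lborel) = 0" by (simp add: nn_integral_Icc_eq_Ico)
      then show False using I1 by simp
    qed
    have hpos: "0 < h" using cpos m by (simp add: h_def)
    \<comment> \<open>The half-open period keeps \<open>t + real j * h\<close> strictly below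
      \<open>c\<close>, as \<open>winds\<close> requires.\<close>
    have tj: "t + real j * h < c" "t + real j * h \<in> {0..c}" if "t \<in> {0..<h}" "j < m" for t j
    proof -
      have "t + real j * h < (real j + 1) * h" using that by (simp add: algebra_simps)
      also have "\<dots> \<le> real m * h" using that h0 by (intro mult_right_mono) auto
      finally show "t + real j * h < c" using mh by simp
      then show "t + real j * h \<in> {0..c}" using that h0 by auto
    qed
    have \<beta>per: "\<beta> (t + real j * h) = \<beta> t" if "t \<in> {0..<h}" "j < m" for t j
    proof (cases "j = 0")
      case False
      then have "j \<in> {1..m-1}" using that by auto
      then show ?thesis using wind[of j t] that tj[OF that] hpos False by simp
    qed simp
    \<comment> \<open>\<open>winds\<close> separates a parameter from its own shifts; two shifts
      \<open>i < j\<close> are compared by starting at \<open>t + real i * h\<close> and moving on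
      by \<open>j - i\<close> periods.\<close>
    have \<alpha>inj: "\<alpha> (t + real i * h) \<noteq> \<alpha> (t + real j * h)" if t: "t \<in> {0..<h}" and ij: "i < j" "j < m" for t i j
    proof -
      have eq: "(t + real i * h) + real (j - i) * h = t + real j * h"
        using ij by (simp add: of_nat_diff algebra_simps)
      have "0 < real (j - i) * h" using ij hpos by simp
      then show ?thesis
        using wind[of "j - i" "t + real i * h"] tj[OF t ij(2)] t h0 ij unfolding eq by force
    qed
    have pointwise: "(\<Sum>j<m. I (t + real j * h)) \<le> of_nat m * \<rho>' (\<beta> t)" if t: "t \<in> {0..<h}" for t
    proof (cases "\<beta> t \<in> E")
      case True
      then show ?thesis using \<rho>'(2) m by (simp add: ennreal_mult_top)
    next
      case False
      let ?x = "\<lambda>j. \<alpha> (t + real j * h)"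
      have fx: "f (?x j) = \<beta> t" if "j < m" for j
        using \<beta>\<alpha>[OF tj(2)[OF t that]] \<beta>per[OF t that] by simp
      have "\<exists>k. ?x j \<in> G k" if "j < m" for j
        using good[OF tj(2)[OF t that]] \<beta>per[OF t that] False by auto
      then obtain k where k: "\<And>j. j < m \<Longrightarrow> ?x j \<in> G (k j)" by metis
      \<comment> \<open>Points of one fibre in the same piece coincide, so distinct points lie in
        distinct pieces and each accounts for its own term of the series over
        \<open>k\<close>.\<close>
      have kinj: "inj_on k {..<m}"
      proof (rule inj_onI, rule ccontr)
        fix i j assume ij: "i \<in> {..<m}" "j \<in> {..<m}" "k i = k j" "i \<noteq> j"
        have "?x i = ?x j"
          using k[of i] k[of j] ij fx[of i] fx[of j] by (intro inj_onD[OF G[of "k i"]]) auto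
        then show False using \<alpha>inj[OF t, of i j] \<alpha>inj[OF t, of j i] ij by (cases "i < j") auto
      qed
      have "(\<Sum>j<m. ennpowr (I (t + real j * h)) p) \<le> (\<Sum>k. H k (\<beta> t))"
      proof (rule sum_injective_le_suminf[OF kinj])
        show "ennpowr (I (t + real j * h)) p = H (k j) (\<beta> t)" if "j < m" for j
          using H[OF k[OF that]] fx[OF that] by (simp add: I_def)
      qed
      then have "ennpowr (ennreal (1 / real m) * (\<Sum>j<m. ennpowr (I (t + real j * h)) p)) (1 / p) \<le>
          ennpowr (ennreal (1 / real m) * (\<Sum>k. H k (\<beta> t))) (1 / p)"
        using p by (intro ennpowr_mono mult_left_mono) auto
      also have "\<dots> \<le> \<rho>' (\<beta> t)" by (rule \<rho>'(3))
      finally have "of_nat m * ennpowr (ennreal (1 / real m) * (\<Sum>j<m. ennpowr (I (t + real j * h)) p)) (1 / p) \<le>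
        of_nat m * \<rho>' (\<beta> t)" by (rule mult_left_mono) simp
      then show ?thesis using sum_le_power_mean[OF p m, of "\<lambda>j. I (t + real j * h)"] by (rule order_trans[rotated])
    qed
    let ?F = "\<lambda>t. I t * indicator {0..c} t" and ?K = "\<lambda>t. \<rho>' (\<beta> t) * indicator {0..c} t"
    have Im: "?F \<in> borel_measurable borel"
    proof -
      note [measurable] = \<phi> \<rho>
      have "(\<lambda>x. \<rho> x / ennreal (\<phi> x)) \<in> borel_measurable borel" by measurable
      then show ?thesis unfolding I_def by (rule borel_measurable_compose_indicator[OF \<alpha>cont])
    qed
    \<comment> \<open>The indicator is kept as a factor because the integrands are known to be Borel
      on the line only after being cut off at \<open>{0..c}\<close>.\<close>
    have ico: "(\<integral>\<^sup>+t\<in>{0..c}. X t \<partial>lborel) = (\<integral>\<^sup>+t\<in>{0..<real m * h}. X t * indicator {0..c} t \<partial>lborel)" for X :: "real \<Rightarrow> ennreal"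
      unfolding nn_integral_Icc_eq_Ico mh by (intro nn_integral_cong) (auto simp: indicator_def)
    have "(\<integral>\<^sup>+t\<in>{0..c}. I t \<partial>lborel) = (\<integral>\<^sup>+t\<in>{0..<h}. (\<Sum>j<m. ?F (t + real j * h)) \<partial>lborel)"
      unfolding ico by (rule nn_integral_split_periods[OF Im h0])
    also have "\<dots> \<le> (\<integral>\<^sup>+t\<in>{0..<h}. (\<Sum>j<m. ?K (t + real j * h)) \<partial>lborel)"
    proof (rule nn_integral_mono)
      fix t
      show "(\<Sum>j<m. ?F (t + real j * h)) * indicator {0..<h} t \<le> (\<Sum>j<m. ?K (t + real j * h)) * indicator {0..<h} t"
      proof (cases "t \<in> {0..<h}")
        case True
        have "(\<Sum>j<m. ?F (t + real j * h)) = (\<Sum>j<m. I (t + real j * h))"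
          using tj(2)[OF True] by (intro sum.cong) auto
        also have "\<dots> \<le> of_nat m * \<rho>' (\<beta> t)" by (rule pointwise[OF True])
        \<comment> \<open>\<open>\<beta>\<close> takes the same value at all \<open>m\<close>
          shifts, so the factor \<open>m\<close> unfolds into the \<open>m\<close> periods of
          \<open>{0..c}\<close>.\<close>
        also have "\<dots> = (\<Sum>j<m. ?K (t + real j * h))"
        proof -
          have "(\<Sum>j<m. ?K (t + real j * h)) = (\<Sum>j<m. \<rho>' (\<beta> t))"
            using tj(2)[OF True] \<beta>per[OF True] by (intro sum.cong) auto
          then show ?thesis by simp
        qed
        finally show ?thesis using True by simp
      qed simp
    qed
    also have "\<dots> = (\<integral>\<^sup>+t\<in>{0..c}. \<rho>' (\<beta> t) \<partial>lborel)"
      unfolding ico by (rule nn_integral_split_periods[OF \<rho>'m h0, symmetric])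
    also have "\<dots> \<le> curve_integral {a..b} ?\<beta> \<rho>'" by (rule int\<beta>)
    finally show ?thesis using I1 by (rule order_trans[rotated])
  qed
qed

theorem theorem1p2:
  fixes D :: "(real^'n) set"
    and f :: "real^'n \<Rightarrow> real^'n"
    and p :: real
    and m :: nat
    and \<Gamma> :: "(real^'n) curve set"
    and \<rho> :: "real^'n \<Rightarrow> ennreal"
  assumes "CARD('n) \<ge> 2"
    and "open D" and "connected D" and "D \<noteq> {}"
    and "p \<ge> 1"
    and "continuous_on D f"
    and "discrete_map D f"
    and "AE x in lebesgue. x \<in> D \<longrightarrow> f differentiable (at x)"
    and "N_property D f"
    and "N_inv_property D f"
    and "ACP_inv p D f"
    and "m \<ge> 1"
    and "\<forall>(\<Delta>, \<gamma>) \<in> \<Gamma>. closed_curve_in D (\<Delta>, \<gamma>) \<and> winds f m \<Delta> \<gamma>"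
    and "\<rho> \<in> adm \<Gamma>"
  shows "modulus p (image_family f \<Gamma>)
    \<le> ennreal (1 / real m) * (\<integral>\<^sup>+ x \<in> D. inner_dilatation p f x * ennpowr (\<rho> x) p \<partial>lebesgue)"
proof -
  note D = \<open>open D\<close> and cf = \<open>continuous_on D f\<close> and p = \<open>p \<ge> 1\<close> and m = \<open>m \<ge> 1\<close>
  have \<rho>[measurable]: "\<rho> \<in> borel_measurable borel" using \<open>\<rho> \<in> adm \<Gamma>\<close> by (simp add: adm_def)
  obtain G C :: "nat \<Rightarrow> (real^'n) set" and \<phi> J :: "real^'n \<Rightarrow> real" where
    \<phi>[measurable]: "\<phi> \<in> borel_measurable borel" and J[measurable]: "J \<in> borel_measurable borel" and
    Gb: "\<And>k. G k \<in> sets borel" and Gd: "disjoint_family G" and GC: "\<And>k. G k \<subseteq> C k" and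
    C: "\<And>k. compact (C k)" "\<And>k. C k \<subseteq> D" "\<And>k. inj_on f (C k)" and
    G: "\<And>k x. x \<in> G k \<Longrightarrow> f differentiable (at x) \<and> jacobian_det f x \<noteq> 0 \<and>
      \<phi> x = min_stretch (frechet_derivative f (at x)) \<and> J x = \<bar>jacobian_det f x\<bar>" and
    nG: "negligible (f ` (D - (\<Union>k. G k)))"
    by (rule regular_pieces[OF D cf assms(8,9)]) blast
  note [measurable] = Gb
  have pos: "0 < \<phi> x" if "x \<in> G k" for k x
  proof -
    have "bounded_linear (frechet_derivative f (at x))"
      using G[OF that] frechet_derivative_works has_derivative_bounded_linear by blast
    then show ?thesis using G[OF that] min_stretch_pos by (auto simp: jacobian_det_def)
  qed
  \<comment> \<open>A Borel superset is taken because \<open>\<rho>'\<close>, which will be infinite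
    on \<open>E\<close>, has to be Borel.\<close>
  obtain E where E: "E \<in> null_sets lborel" "f ` (D - (\<Union>k. G k)) \<subseteq> E"
    using nG unfolding negligible_iff_null_sets null_sets_completion_iff2 by auto
  have Eb[measurable]: "E \<in> sets borel" using E(1) by auto
  define g where "g = (\<lambda>x. ennpowr (\<rho> x / ennreal (\<phi> x)) p)"
  have g[measurable]: "g \<in> borel_measurable borel" unfolding g_def by measurable
  \<comment> \<open>On the image of \<open>G k\<close> the inverse taken in \<open>C k\<close>
    returns the point of \<open>G k\<close>; it is compactness of \<open>C k\<close> that makes this
    inverse continuous.\<close>
  define H where "H = (\<lambda>k y. g (inv_into (C k) f y) * indicator (f ` G k) y)"
  have HG: "H k (f x) = g x" if "x \<in> G k" for k x
    using that GC[of k] C(3)[of k] by (auto simp: H_def inv_into_f_f)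
  have piece: "H k \<in> borel_measurable borel"
    "(\<integral>\<^sup>+y. H k y \<partial>lborel) \<le> (\<integral>\<^sup>+x. ennreal (J x) * g x * indicator (G k) x \<partial>lborel)" for k
  proof -
    have der: "(f has_derivative frechet_derivative f (at x)) (at x)" if "x \<in> G k" for x
      using G[OF that] frechet_derivative_works by blast
    have det: "J x = \<bar>det (matrix (frechet_derivative f (at x)))\<bar>" if "x \<in> G k" for x
      using G[OF that] by (simp add: jacobian_det_def)
    have cC: "continuous_on (C k) f" by (rule continuous_on_subset[OF cf C(2)])
    show "H k \<in> borel_measurable borel"
      "(\<integral>\<^sup>+y. H k y \<partial>lborel) \<le> (\<integral>\<^sup>+x. ennreal (J x) * g x * indicator (G k) x \<partial>lborel)"
      unfolding H_def
      using nn_integral_injective_piece_le[OF C(1) cC C(3) Gb GC der J det g] by auto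
  qed
  note [measurable] = piece(1)
  \<comment> \<open>The pieces are disjoint, so at most one term survives; on a piece
    \<open>J x / \<phi> x powr p\<close> is the inner dilatation, and elsewhere the left-hand side
    is zero.\<close>
  have dil: "(\<Sum>k. ennreal (J x) * g x * indicator (G k) x) \<le>
      inner_dilatation p f x * ennpowr (\<rho> x) p * indicator D x" for x
  proof (cases "\<exists>k. x \<in> G k")
    case True
    then obtain k where k: "x \<in> G k" by blast
    have "(\<Sum>i. ennreal (J x) * g x * indicator (G i) x) = ennreal (J x) * g x"
    proof -
      have "(\<Sum>i. ennreal (J x) * g x * indicator (G i) x) =
        (\<Sum>i\<in>{k}. ennreal (J x) * g x * indicator (G i) x)"
      proof (rule suminf_finite)
        show "ennreal (J x) * g x * indicator (G i) x = 0" if "i \<notin> {k}" for i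
          using that k disjoint_family_onD[OF Gd, of i k] by (auto simp: indicator_def)
      qed simp
      then show ?thesis using k by simp
    qed
    also have "\<dots> = inner_dilatation p f x * ennpowr (\<rho> x) p"
    proof -
      have J0: "J x > 0" using G[OF k] by simp
      have K: "inner_dilatation p f x = ennreal (J x / \<phi> x powr p)"
        using G[OF k] by (simp add: inner_dilatation_def)
      show ?thesis
      proof (cases "\<rho> x")
        case (real r)
        have "g x = ennreal ((r / \<phi> x) powr p)"
          using real pos[OF k] by (simp add: g_def divide_ennreal ennpowr_ennreal)
        then show ?thesis using real J0 pos[OF k] unfolding K
          by (simp add: ennpowr_ennreal ennreal_mult[symmetric] powr_divide)
      next
        case top
        have "g x = \<infinity>" using top pos[OF k] by (simp add: g_def ennreal_top_divide)
        then show ?thesis using top J0 pos[OF k] unfolding K by (simp add: ennreal_mult_top)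
      qed
    qed
    finally show ?thesis using k GC[of k] C(2)[of k] by auto
  qed simp
  have int: "(\<integral>\<^sup>+y. (\<Sum>k. H k y) \<partial>lborel) \<le> (\<integral>\<^sup>+ x \<in> D. inner_dilatation p f x * ennpowr (\<rho> x) p \<partial>lebesgue)"
  proof -
    have "(\<integral>\<^sup>+y. (\<Sum>k. H k y) \<partial>lborel) = (\<Sum>k. \<integral>\<^sup>+y. H k y \<partial>lborel)"
      by (rule nn_integral_suminf) simp
    also have "\<dots> \<le> (\<Sum>k. \<integral>\<^sup>+x. ennreal (J x) * g x * indicator (G k) x \<partial>lborel)"
      by (intro suminf_le piece(2)) auto
    also have "\<dots> = (\<integral>\<^sup>+x. (\<Sum>k. ennreal (J x) * g x * indicator (G k) x) \<partial>lborel)"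
      by (rule nn_integral_suminf[symmetric]) simp
    also have "\<dots> \<le> (\<integral>\<^sup>+ x \<in> D. inner_dilatation p f x * ennpowr (\<rho> x) p \<partial>lborel)"
      by (intro nn_integral_mono dil)
    finally show ?thesis by (simp add: nn_integral_completion)
  qed
  define B where "B = {\<beta> \<in> {\<beta>. closed_curve_in UNIV \<beta>}. \<not> (\<lambda>(\<Delta>, \<beta>). \<forall>\<alpha>. lifting D f \<Delta> \<beta> \<alpha> \<longrightarrow>
    rectifiable \<Delta> \<alpha> \<and> abs_continuous_on {0..enn2real (curve_length \<Delta> \<beta>)} (f_rep f \<Delta> \<alpha>)) \<beta>}"
  have B0: "modulus p B = 0" using \<open>ACP_inv p D f\<close> by (simp add: ACP_inv_def ae_curve_def B_def)
  show ?thesis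
  proof (rule ennreal_le_epsilon)
    fix e :: real assume e: "0 < e"
    obtain \<sigma> where \<sigma>: "\<sigma> \<in> adm B" "(\<integral>\<^sup>+x. ennpowr (\<sigma> x) p \<partial>lebesgue) \<le> ennreal e"
      by (rule modulus_eq_0D[OF B0 e])
    have \<sigma>m[measurable]: "\<sigma> \<in> borel_measurable borel" using \<sigma>(1) by (simp add: adm_def)
    \<comment> \<open>Adding the three terms before taking the root makes their integrals add up,
      while \<open>\<rho>'\<close> still dominates the root of each. They serve ordinary curves,
      curves with positive length in \<open>E\<close>, and curves in \<open>B\<close>.\<close>
    define s where "s = (\<lambda>y. ennreal (1 / real m) * (\<Sum>k. H k y) + \<infinity> * indicator E y + ennpowr (\<sigma> y) p)"
    have sm[measurable]: "s \<in> borel_measurable borel" unfolding s_def by measurable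
    define \<rho>' where "\<rho>' = (\<lambda>y. ennpowr (s y) (1 / p))"
    have \<rho>'m: "\<rho>' \<in> borel_measurable borel" unfolding \<rho>'_def by measurable
    have adm: "\<rho>' \<in> adm (image_family f \<Gamma>)"
      unfolding adm_def image_family_def
    proof (clarsimp simp: \<rho>'m)
      fix \<Delta> \<gamma> assume \<gamma>: "(\<Delta>, \<gamma>) \<in> \<Gamma>" and lr: "locally_rectifiable \<Delta> (f \<circ> \<gamma>)"
      have cl: "closed_curve_in D (\<Delta>, \<gamma>)" and wi: "winds f m \<Delta> \<gamma>" using assms(13) \<gamma> by auto
      obtain a b where ab: "a \<le> b" "\<Delta> = {a..b}" and \<gamma>c: "continuous_on {a..b} \<gamma>" "\<gamma> ` {a..b} \<subseteq> D"
        and cu: "curve_in D (\<Delta>, \<gamma>)"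
        using cl by (auto simp: closed_curve_in_def curve_in_def)
      have c\<beta>: "continuous_on {a..b} (f \<circ> \<gamma>)"
        by (rule continuous_on_compose[OF \<gamma>c(1) continuous_on_subset[OF cf \<gamma>c(2)]])
      show "1 \<le> curve_integral \<Delta> (f \<circ> \<gamma>) \<rho>'"
      proof (cases "(\<Delta>, f \<circ> \<gamma>) \<in> B")
        case True
        then have "1 \<le> curve_integral \<Delta> (f \<circ> \<gamma>) \<sigma>" using \<sigma>(1) lr by (auto simp: adm_def)
        also have "\<dots> \<le> curve_integral \<Delta> (f \<circ> \<gamma>) \<rho>'"
        proof (rule curve_integral_mono)
          fix y
          have "\<sigma> y = ennpowr (ennpowr (\<sigma> y) p) (1 / p)" using p by (simp add: ennpowr_inverse)
          also have "\<dots> \<le> \<rho>' y" unfolding \<rho>'_def s_def using p by (intro ennpowr_mono) auto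
          finally show "\<sigma> y \<le> \<rho>' y" .
        qed
        finally show ?thesis .
      next
        case False
        have "closed_curve_in UNIV (\<Delta>, f \<circ> \<gamma>)"
          using c\<beta> ab by (auto simp: closed_curve_in_def curve_in_def is_interval_cc)
        \<comment> \<open>\<open>\<gamma>\<close> is itself a lifting of its image, so outside
          \<open>B\<close> the \<open>ACP\<close> condition applies to it.\<close>
        moreover have "lifting D f \<Delta> (f \<circ> \<gamma>) \<gamma>" using cu by (simp add: lifting_def)
        ultimately have rAC: "rectifiable \<Delta> \<gamma>"
          "abs_continuous_on {0..enn2real (curve_length \<Delta> (f \<circ> \<gamma>))} (f_rep f \<Delta> \<gamma>)"
          using False unfolding B_def by auto
        \<comment> \<open>Admissibility of \<open>\<rho>\<close> speaks only of locally rectifiable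
          curves; rectifiability of \<open>\<gamma>\<close> comes from \<open>ACP\<close>, not from
          that of its image.\<close>
        have "locally_rectifiable \<Delta> \<gamma>"
          using rAC(1) by (auto simp: locally_rectifiable_def intro: rectifiable_subset)
        then have one: "1 \<le> curve_integral \<Delta> \<gamma> \<rho>" using \<open>\<rho> \<in> adm \<Gamma>\<close> \<gamma> by (auto simp: adm_def)
        show ?thesis unfolding ab(2)
        proof (rule admissible_on_winding_curve[OF p m cf assms(7), where G=G and E=E and \<phi>=\<phi> and \<rho>=\<rho> and H=H])
          show "inj_on f (G k)" for k using C(3) GC by (rule inj_on_subset)
          show "\<exists>d>0. \<forall>y. dist y x < d \<longrightarrow> \<kappa> * dist y x \<le> dist (f y) (f x)"
            if "x \<in> (\<Union>k. G k)" "0 < \<kappa>" "\<kappa> < \<phi> x" for x \<kappa>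
            using that G by (auto intro!: differentiable_lower_bound)
          show "0 < \<phi> x" if "x \<in> (\<Union>k. G k)" for x using that pos by auto
          show "\<rho>' y = \<infinity>" if "y \<in> E" for y
            using that by (simp add: \<rho>'_def s_def)
          show "ennpowr (ennreal (1 / real m) * (\<Sum>k. H k y)) (1 / p) \<le> \<rho>' y" for y
            unfolding \<rho>'_def s_def using p by (intro ennpowr_mono) (auto simp: add.assoc)
          show "H k (f x) = ennpowr (\<rho> x / ennreal (\<phi> x)) p" if "x \<in> G k" for k x
            using HG[OF that] by (simp add: g_def)
        qed (use E Eb \<phi> \<rho> \<rho>'m ab \<gamma>c rAC wi one in auto)
      qed
    qed
    have "modulus p (image_family f \<Gamma>) \<le> (\<integral>\<^sup>+y. ennpowr (\<rho>' y) p \<partial>lebesgue)"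
      unfolding modulus_def by (rule INF_lower[OF adm])
    also have "\<dots> = (\<integral>\<^sup>+y. s y \<partial>lborel)"
      using p by (simp add: \<rho>'_def ennpowr_inverse nn_integral_completion)
    \<comment> \<open>The infinite term lives on the null set \<open>E\<close> and drops out of the
      integral.\<close>
    also have "\<dots> = (\<integral>\<^sup>+y. ennreal (1 / real m) * (\<Sum>k. H k y) + ennpowr (\<sigma> y) p \<partial>lborel)"
    proof (rule nn_integral_cong_AE)
      show "AE y in lborel. s y = ennreal (1 / real m) * (\<Sum>k. H k y) + ennpowr (\<sigma> y) p"
        using AE_not_in[OF E(1)] by eventually_elim (simp add: s_def)
    qed
    also have "\<dots> = ennreal (1 / real m) * (\<integral>\<^sup>+y. (\<Sum>k. H k y) \<partial>lborel) + (\<integral>\<^sup>+y. ennpowr (\<sigma> y) p \<partial>lborel)"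
      by (subst nn_integral_add) (auto simp: nn_integral_cmult)
    also have "\<dots> \<le> ennreal (1 / real m) * (\<integral>\<^sup>+ x \<in> D. inner_dilatation p f x * ennpowr (\<rho> x) p \<partial>lebesgue) + ennreal e"
      using int \<sigma>(2) by (intro add_mono mult_left_mono) (auto simp: nn_integral_completion)
    finally show "modulus p (image_family f \<Gamma>) \<le>
      ennreal (1 / real m) * (\<integral>\<^sup>+ x \<in> D. inner_dilatation p f x * ennpowr (\<rho> x) p \<partial>lebesgue) + ennreal e" .
  qed
qed

end
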